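(* Let $n\geq 4$ be an integer, let $(R,\Delta)$ be a Hermitian form ring with $R$ commutative, let $(I,\Omega)$ be an odd form ideal of $(R,\Delta)$ and let $H$ be a subgroup of $\mathrm{U}_{2n+1}(R,\Delta)$ normalised by $\mathrm{EU}_{2n+1}(I,\Omega)$. Then \[\mathrm{EU}_{2n+1}(U(H)\ast I^{10})\leq H\leq \mathrm{CU}_{2n+1}((R,\Delta),U(H)).\]
   Context: Form rings. Rings are associative with $1\neq 0$; $R$ is a commutative ring. A Hermitian ring $(R,\bar{\ },\lambda,\mu)$ consists of $R$, a bijection $x\mapsto\bar x$ of $R$ with $\overline{x+y}=\bar x+\bar y$, $\overline{xy}=\bar y\bar x$, $\bar 1=1$, an element $\lambda\in R$ with $\bar{\bar x}=\lambda x\bar\lambda$ for all $x\in R$ (it follows that $\bar\lambda=\lambda^{-1}$), and an element $\mu\in R$ with $\mu=\bar\mu\lambda$. A subset $A\subseteq R$ is involution invariant if $\bar x\in A$ for all $x\in A$. The Heisenberg group $\mathfrak{H}$ is $R\times R$ with group operation $(x_1,y_1)\dotplus(x_2,y_2)=(x_1+x_2,\,y_1+y_2-\bar x_1\mu x_2)$; the inverse of $\alpha$ is written $\dot{-}\alpha$, and $\alpha\,\dot{-}\,\beta:=\alpha\dotplus(\dot{-}\beta)$. For $a\in R$ put $(x,y)\circ a=(xa,\bar a y a)$; $\circ$ has higher priority than $\dotplus$ and $\dot{-}$. An $R^{\bullet}$-submodule of $\mathfrak{H}$ is a subgroup stable under all maps $\alpha\mapsto\alpha\circ a$ ($a\in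 R$). For $A\subseteq\mathfrak{H}$, $B\subseteq R$, $A\circ B$ is the subgroup of $\mathfrak{H}$ generated by all $\alpha\circ b$ ($\alpha\in A$, $b\in B$); for $A,B\subseteq \mathfrak{H}$, $A\dotplus B=\{\alpha\dotplus\beta\mid\alpha\in A,\beta\in B\}$. For a subgroup $\Omega$ of $\mathfrak{H}$, $\alpha\equiv\beta\bmod\Omega$ means $\alpha\,\dot{-}\,\beta\in\Omega$. Let $\Delta_{\min}=\{(0,x-\bar x\lambda)\mid x\in R\}$ and $\Delta_{\max}=\{(x,y)\mid \bar x\mu x+y+\bar y\lambda=0\}$. An odd form parameter is an $R^\bullet$-submodule $\Delta$ of $\mathfrak{H}$ with $\Delta_{\min}\subseteq\Delta\subseteq\Delta_{\max}$; then $(R,\Delta)$ (short for $((R,\bar{\ },\lambda,\mu),\Delta)$) is called a Hermitian form ring. Put $J(\Delta)=\{y\in R\mid\exists z\in R:(y,z)\in\Delta\}$. For an involution invariant ideal $I$ of $R$ put $\tilde I=\{x\in R\mid\overline{J(\Delta)}\mu x\subseteq I\}$, $\Omega^I_{\min}=\{(0,x-\bar x\lambda)\mid x\in I\}\dotplus\Delta\circ I$ and $\Omega^I_{\max}=\Delta\cap(\tilde I\times I)$. An odd form ideal of $(R,\Delta)$ is a pair $(I,\Omega)$ where $I$ is an involution invariant ideal and $\Omega$ is an $R^\bullet$-submodule of $\mathfrak{H}$ with $\Omega^I_{\min}\subseteq\Omega\subseteq\Omega^I_{\max}$. Put $\Delta^{1}=\Delta$, $\Delta^{-1}=\{(x,y)\mid(x,\bar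 y)\in\Delta\}$, $\Omega^1=\Omega$, $\Omega^{-1}=\{(x,y)\mid(x,\bar y)\in\Omega\}$. Product. For an odd form ideal $(J,\Sigma)$ and an involution invariant ideal $K$, $(J,\Sigma)\ast K$ is the odd form ideal $(JK,\Omega^{JK}_{\min}\dotplus\Sigma\circ K)$. Groups. Let $\Theta_+=\{1,\dots,n\}$, $\Theta_-=\{-n,\dots,-1\}$, $\Theta=\Theta_+\cup\{0\}\cup\Theta_-$, $\Theta_{\mathrm{hb}}=\Theta\setminus\{0\}$, $\epsilon(i)=1$ for $i\in\Theta_+$ and $\epsilon(i)=-1$ for $i\in\Theta_-$. Coordinates of $M=R^{2n+1}$ (columns) and rows/columns of $(2n+1)\times(2n+1)$ matrices are indexed by $\Theta$ in the order $1,\dots,n,0,-n,\dots,-1$. $\sigma_{ij}$ is the $(i,j)$ entry and $\sigma_{*j}$ the $j$-th column of $\sigma$; $\sigma_{\mathrm{hb}}=(\sigma_{ij})_{i,j\in\Theta_{\mathrm{hb}}}$; $e$ is the identity matrix, $e^{ij}$ a matrix unit. For $u,v\in M$ let $B(u,v)=\sum_{i=1}^n\bar u_iv_{-i}+\bar u_0\mu v_0+\sum_{i=-n}^{-1}\bar u_i\lambda v_{-i}$ and $Q(u)=(u_0,\sum_{i=1}^n\bar u_iu_{-i})\in\mathfrak{H}$. $\mathrm{U}_{2n+1}(R,\Delta)$ is the group of $\sigma\in\mathrm{GL}_{2n+1}(R)$ with $B(\sigma u,\sigma v)=B(u,v)$ and $Q(\sigma u)\equiv Q(u)\bmod\Delta$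 for all $u,v\in M$. Elementary subgroups. For $i,j\in\Theta_{\mathrm{hb}}$, $i\neq\pm j$, $x\in R$: $T_{ij}(x)=e+xe^{ij}-\lambda^{(\epsilon(j)-1)/2}\bar x\lambda^{(1-\epsilon(i))/2}e^{-j,-i}$. For $i\in\Theta_{\mathrm{hb}}$, $(x,y)\in\Delta^{-\epsilon(i)}$: $T_i(x,y)=e+xe^{0,-i}-\lambda^{-(1+\epsilon(i))/2}\bar x\mu e^{i0}+ye^{i,-i}$. $\mathrm{EU}_{2n+1}(R,\Delta)$ is the subgroup of $\mathrm{U}_{2n+1}(R,\Delta)$ generated by all these elements. For an odd form ideal $(I,\Omega)$, $\mathrm{EU}_{2n+1}(I,\Omega)$ is the subgroup generated by all $T_{ij}(x)$ with $x\in I$ and all $T_i(x,y)$ with $(x,y)\in\Omega^{-\epsilon(i)}$. Congruence subgroups. Let $M(R,\Delta)=\{u\in M\mid u_0\in J(\Delta)\}$. $\mathrm{U}_{2n+1}((R,\Delta),(I,\Omega))$ is the group of $\sigma\in\mathrm{U}_{2n+1}(R,\Delta)$ with $\sigma_{\mathrm{hb}}\equiv e_{\mathrm{hb}}\bmod I$ and $Q(\sigma u)\equiv Q(u)\bmod\Omega$ for all $u\in M(R,\Delta)$. $\mathrm{NU}_{2n+1}((R,\Delta),(I,\Omega))$ is its normaliser in $\mathrm{U}_{2n+1}(R,\Delta)$, and $\mathrm{CU}_{2n+1}((R,\Delta),(I,\Omega))=\{\sigma\in\mathrm{NU}_{2n+1}((R,\Delta),(I,\Omega))\mid[\sigma,\mathrm{EU}_{2n+1}(R,\Delta)]\leq\mathrm{U}_{2n+1}((R,\Delta),(I,\Omega))\}$,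 where $[g,h]=ghg^{-1}h^{-1}$. Upper level. For a subgroup $H\leq\mathrm{U}_{2n+1}(R,\Delta)$, the upper level $U(H)$ is the odd form ideal $(J,\Sigma)$ where $J$ is the ideal generated by $Y\cup\bar Y$, $Y$ being the set of all elements $\sigma_{ij}$, $\sigma_{ii}-\sigma_{jj}$ and all elements of the sets $\sigma_{i0}J(\Delta)$, $\overline{J(\Delta)}\mu\sigma_{0j}$, $\overline{J(\Delta)}\mu(\sigma_{00}-\sigma_{jj})J(\Delta)$ with $\sigma\in H$, $i\neq j\in\Theta_{\mathrm{hb}}$; and $\Sigma=\Omega^J_{\min}\dotplus Z\circ R$, where $Z$ is the set of all $Q(\sigma_{*j})$ and $(Q(\sigma_{*0})\,\dot{-}\,(1,0))\circ y\dotplus(y,z)\,\dot{-}\,(y,z)\circ\sigma_{ii}$ with $\sigma\in H$, $i,j\in\Theta_{\mathrm{hb}}$, $(y,z)\in\Delta$. *)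

theory Defs
  imports "HOL-Analysis.Cartesian_Space" "HOL-Algebra.Generated_Groups" "HOL-Algebra.Group_Action"
begin

section \<open>Ideals of a commutative ring type\<close>

text \<open>Ideals of \<open>'a\<close> are the subspaces of \<open>'a\<close> as a module over itself.\<close>

abbreviation ring_ideal :: "'a::comm_ring_1 set \<Rightarrow> bool" where
  "ring_ideal \<equiv> module.subspace (*)"

abbreviation ideal_gen :: "'a::comm_ring_1 set \<Rightarrow> 'a set" where
  "ideal_gen \<equiv> module.span (*)"

definition ideal_mult :: "'a::comm_ring_1 set \<Rightarrow> 'a set \<Rightarrow> 'a set" where
  "ideal_mult J K = ideal_gen {x * y | x y. x \<in> J \<and> y \<in> K}"

definition ideal_power :: "'a::comm_ring_1 set \<Rightarrow> nat \<Rightarrow> 'a set" where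
  "ideal_power I k = (ideal_mult I ^^ k) UNIV"


section \<open>Hermitian form rings\<close>

record 'a hermitian =
  bar :: "'a \<Rightarrow> 'a"
  lam :: 'a
  mu :: 'a

definition hermitian_ring :: "'a::comm_ring_1 hermitian \<Rightarrow> bool" where
  "hermitian_ring R \<longleftrightarrow>
     bij (bar R) \<and>
     (\<forall>x y. bar R (x + y) = bar R x + bar R y) \<and>
     (\<forall>x y. bar R (x * y) = bar R y * bar R x) \<and>
     bar R 1 = 1 \<and>
     (\<forall>x. bar R (bar R x) = lam R * x * bar R (lam R)) \<and>
     mu R = bar R (mu R) * lam R"

lemma lam_mult_bar_lam:
  assumes "hermitian_ring R"
  shows "lam R * bar R (lam R) = 1"
proof -
  have "bar R (bar R 1) = lam R * 1 * bar R (lam R)" and "bar R 1 = 1"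
    using assms unfolding hermitian_ring_def by blast+
  then show ?thesis by simp
qed

definition invol_invariant :: "'a hermitian \<Rightarrow> 'a set \<Rightarrow> bool" where
  "invol_invariant R A \<longleftrightarrow> (\<forall>x\<in>A. bar R x \<in> A)"

definition heis :: "'a::comm_ring_1 hermitian \<Rightarrow> ('a \<times> 'a) monoid" where
  "heis R = \<lparr>carrier = UNIV,
     mult = (\<lambda>(x1, y1) (x2, y2). (x1 + x2, y1 + y2 - bar R x1 * mu R * x2)),
     one = (0, 0)\<rparr>"

abbreviation hplus :: "'a::comm_ring_1 hermitian \<Rightarrow> 'a \<times> 'a \<Rightarrow> 'a \<times> 'a \<Rightarrow> 'a \<times> 'a" where
  "hplus R \<alpha> \<beta> \<equiv> \<alpha> \<otimes>\<^bsub>heis R\<^esub> \<beta>"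

abbreviation hminus :: "'a::comm_ring_1 hermitian \<Rightarrow> 'a \<times> 'a \<Rightarrow> 'a \<times> 'a \<Rightarrow> 'a \<times> 'a" where
  "hminus R \<alpha> \<beta> \<equiv> \<alpha> \<otimes>\<^bsub>heis R\<^esub> inv\<^bsub>heis R\<^esub> \<beta>"

definition circ :: "'a::comm_ring_1 hermitian \<Rightarrow> 'a \<times> 'a \<Rightarrow> 'a \<Rightarrow> 'a \<times> 'a" where
  "circ R = (\<lambda>(x, y) a. (x * a, bar R a * y * a))"

definition bullet_submodule :: "'a::comm_ring_1 hermitian \<Rightarrow> ('a \<times> 'a) set \<Rightarrow> bool" where
  "bullet_submodule R \<Omega> \<longleftrightarrow>
     subgroup \<Omega> (heis R) \<and> (\<forall>\<alpha>\<in>\<Omega>. \<forall>a. circ R \<alpha> a \<in> \<Omega>)"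

definition set_circ :: "'a::comm_ring_1 hermitian \<Rightarrow> ('a \<times> 'a) set \<Rightarrow> 'a set \<Rightarrow> ('a \<times> 'a) set" where
  "set_circ R A B = generate (heis R) {circ R \<alpha> b | \<alpha> b. \<alpha> \<in> A \<and> b \<in> B}"

definition Delta_min :: "'a::comm_ring_1 hermitian \<Rightarrow> ('a \<times> 'a) set" where
  "Delta_min R = {(0, x - bar R x * lam R) | x. True}"

definition Delta_max :: "'a::comm_ring_1 hermitian \<Rightarrow> ('a \<times> 'a) set" where
  "Delta_max R = {(x, y). bar R x * mu R * x + y + bar R y * lam R = 0}"

definition odd_form_parameter :: "'a::comm_ring_1 hermitian \<Rightarrow> ('a \<times> 'a) set \<Rightarrow> bool" where
  "odd_form_parameter R \<Delta> \<longleftrightarrow>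
     bullet_submodule R \<Delta> \<and> Delta_min R \<subseteq> \<Delta> \<and> \<Delta> \<subseteq> Delta_max R"

definition hermitian_form_ring :: "'a::comm_ring_1 hermitian \<Rightarrow> ('a \<times> 'a) set \<Rightarrow> bool" where
  "hermitian_form_ring R \<Delta> \<longleftrightarrow> hermitian_ring R \<and> odd_form_parameter R \<Delta>"

definition J_of :: "('a \<times> 'a) set \<Rightarrow> 'a set" where
  "J_of \<Delta> = {y. \<exists>z. (y, z) \<in> \<Delta>}"

definition tilde_ideal :: "'a::comm_ring_1 hermitian \<Rightarrow> ('a \<times> 'a) set \<Rightarrow> 'a set \<Rightarrow> 'a set" where
  "tilde_ideal R \<Delta> I = {x. \<forall>y\<in>J_of \<Delta>. bar R y * mu R * x \<in> I}"

definition Omega_min ::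
    "'a::comm_ring_1 hermitian \<Rightarrow> ('a \<times> 'a) set \<Rightarrow> 'a set \<Rightarrow> ('a \<times> 'a) set" where
  "Omega_min R \<Delta> I = {(0, x - bar R x * lam R) | x. x \<in> I} <#>\<^bsub>heis R\<^esub> set_circ R \<Delta> I"

definition Omega_max ::
    "'a::comm_ring_1 hermitian \<Rightarrow> ('a \<times> 'a) set \<Rightarrow> 'a set \<Rightarrow> ('a \<times> 'a) set" where
  "Omega_max R \<Delta> I = \<Delta> \<inter> (tilde_ideal R \<Delta> I \<times> I)"

definition odd_form_ideal ::
    "'a::comm_ring_1 hermitian \<Rightarrow> ('a \<times> 'a) set \<Rightarrow> 'a set \<times> ('a \<times> 'a) set \<Rightarrow> bool" where
  "odd_form_ideal R \<Delta> = (\<lambda>(I, \<Omega>).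
     ring_ideal I \<and> invol_invariant R I \<and> bullet_submodule R \<Omega> \<and>
     Omega_min R \<Delta> I \<subseteq> \<Omega> \<and> \<Omega> \<subseteq> Omega_max R \<Delta> I)"

text \<open>\<open>sgn_param R s \<Omega>\<close> is $\Omega^{s}$, for \<open>s\<close> equal to \<open>1\<close> or \<open>-1\<close>.\<close>

definition sgn_param :: "'a hermitian \<Rightarrow> int \<Rightarrow> ('a \<times> 'a) set \<Rightarrow> ('a \<times> 'a) set" where
  "sgn_param R s \<Omega> = (if s = 1 then \<Omega> else {(x, y). (x, bar R y) \<in> \<Omega>})"

definition form_ideal_mult ::
    "'a::comm_ring_1 hermitian \<Rightarrow> ('a \<times> 'a) set \<Rightarrow> 'a set \<times> ('a \<times> 'a) set \<Rightarrow> 'a set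
      \<Rightarrow> 'a set \<times> ('a \<times> 'a) set" where
  "form_ideal_mult R \<Delta> = (\<lambda>(J, \<Sigma>) K.
     (ideal_mult J K, Omega_min R \<Delta> (ideal_mult J K) <#>\<^bsub>heis R\<^esub> set_circ R \<Sigma> K))"


section \<open>The index set\<close>

text \<open>
  \<open>'n idx\<close> renders $\Theta = \{1,\dots,n,0,-n,\dots,-1\}$ with $n$ = \<open>CARD('n)\<close>: \<open>Plus\<close> and
  \<open>Minus\<close> enumerate $\Theta_+$ and $\Theta_-$. The order of the coordinates is only a
  convention for displaying matrices, so none is put on \<open>'n\<close>.
\<close>

datatype 'n idx = Plus 'n | Centre | Minus 'n

instantiation idx :: (type) "{zero, uminus}"
begin

definition zero_idx :: "'a idx" where
  "zero_idx = Centre"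

definition uminus_idx :: "'a idx \<Rightarrow> 'a idx" where
  "uminus_idx i = (case i of Plus k \<Rightarrow> Minus k | Centre \<Rightarrow> Centre | Minus k \<Rightarrow> Plus k)"

instance ..

end

lemma UNIV_idx: "(UNIV :: 'n idx set) = insert Centre (range Plus \<union> range Minus)"
proof (intro Set.set_eqI iffI)
  fix i :: "'n idx"
  show "i \<in> insert Centre (range Plus \<union> range Minus)"
    by (cases i) simp_all
qed simp

instance idx :: (finite) finite
proof
  show "finite (UNIV :: 'a idx set)"
    unfolding UNIV_idx by (intro finite.insertI finite_UnI finite_imageI finite)
qed

text \<open>The sign is only used at indices other than \<open>0\<close>.\<close>

definition eps :: "'n idx \<Rightarrow> int" where
  "eps i = (case i of Plus k \<Rightarrow> 1 | Centre \<Rightarrow> 0 | Minus k \<Rightarrow> -1)"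


section \<open>Odd-dimensional unitary groups\<close>

type_synonym ('a, 'n) column = "'a ^ 'n idx"
type_synonym ('a, 'n) matrix = "'a ^ 'n idx ^ 'n idx"

definition form_B ::
    "'a::comm_ring_1 hermitian \<Rightarrow> ('a, 'n::finite) column \<Rightarrow> ('a, 'n) column \<Rightarrow> 'a" where
  "form_B R u v =
     (\<Sum>i\<in>range Plus. bar R (u $ i) * v $ (- i)) + bar R (u $ 0) * mu R * v $ 0
     + (\<Sum>i\<in>range Minus. bar R (u $ i) * lam R * v $ (- i))"

definition form_Q ::
    "'a::comm_ring_1 hermitian \<Rightarrow> ('a, 'n::finite) column \<Rightarrow> 'a \<times> 'a" where
  "form_Q R u = (u $ 0, \<Sum>i\<in>range Plus. bar R (u $ i) * u $ (- i))"

definition GL :: "(('a::comm_ring_1, 'n::finite) matrix) monoid" where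
  "GL = \<lparr>carrier = {\<sigma>. invertible \<sigma>}, mult = (**), one = mat 1\<rparr>"

definition U_group ::
    "'a::comm_ring_1 hermitian \<Rightarrow> ('a \<times> 'a) set \<Rightarrow> (('a, 'n::finite) matrix) monoid" where
  "U_group R \<Delta> = GL\<lparr>carrier := {\<sigma> \<in> carrier GL. \<forall>u v.
     form_B R (\<sigma> *v u) (\<sigma> *v v) = form_B R u v \<and>
     hminus R (form_Q R (\<sigma> *v u)) (form_Q R u) \<in> \<Delta>}\<rparr>"


section \<open>Elementary subgroups\<close>

text \<open>
  Integer powers of $\lambda$, using $\lambda^{-1} = \bar\lambda$.
  \<open>axis i (axis j x)\<close> is the matrix $x e^{ij}$.
\<close>

definition lam_pow :: "'a::comm_ring_1 hermitian \<Rightarrow> int \<Rightarrow> 'a" where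
  "lam_pow R k = (if k \<ge> 0 then lam R ^ nat k else bar R (lam R) ^ nat (- k))"

definition T_short ::
    "'a::comm_ring_1 hermitian \<Rightarrow> 'n::finite idx \<Rightarrow> 'n idx \<Rightarrow> 'a \<Rightarrow> ('a, 'n) matrix" where
  "T_short R i j x = mat 1 + axis i (axis j x)
     - axis (- j) (axis (- i)
         (lam_pow R ((eps j - 1) div 2) * bar R x * lam_pow R ((1 - eps i) div 2)))"

definition T_extra ::
    "'a::comm_ring_1 hermitian \<Rightarrow> 'n::finite idx \<Rightarrow> 'a \<times> 'a \<Rightarrow> ('a, 'n) matrix" where
  "T_extra R i = (\<lambda>(x, y). mat 1 + axis 0 (axis (- i) x)
     - axis i (axis 0 (lam_pow R (- ((1 + eps i) div 2)) * bar R x * mu R))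
     + axis i (axis (- i) y))"

definition EU_ideal ::
    "'a::comm_ring_1 hermitian \<Rightarrow> ('a \<times> 'a) set \<Rightarrow> 'a set \<times> ('a \<times> 'a) set
      \<Rightarrow> (('a, 'n::finite) matrix) set" where
  "EU_ideal R \<Delta> = (\<lambda>(I, \<Omega>). generate (U_group R \<Delta>)
     ({T_short R i j x | i j x. i \<noteq> 0 \<and> j \<noteq> 0 \<and> i \<noteq> j \<and> i \<noteq> - j \<and> x \<in> I} \<union>
      {T_extra R i \<alpha> | i \<alpha>. i \<noteq> 0 \<and> \<alpha> \<in> sgn_param R (- eps i) \<Omega>}))"

definition EU ::
    "'a::comm_ring_1 hermitian \<Rightarrow> ('a \<times> 'a) set \<Rightarrow> (('a, 'n::finite) matrix) set" where
  "EU R \<Delta> = EU_ideal R \<Delta> (UNIV, \<Delta>)"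


section \<open>Congruence subgroups\<close>

definition U_ideal ::
    "'a::comm_ring_1 hermitian \<Rightarrow> ('a \<times> 'a) set \<Rightarrow> 'a set \<times> ('a \<times> 'a) set
      \<Rightarrow> (('a, 'n::finite) matrix) set" where
  "U_ideal R \<Delta> = (\<lambda>(I, \<Omega>). {\<sigma> \<in> carrier (U_group R \<Delta>).
     (\<forall>i j. i \<noteq> 0 \<longrightarrow> j \<noteq> 0 \<longrightarrow> \<sigma> $ i $ j - mat 1 $ i $ j \<in> I) \<and>
     (\<forall>u. u $ 0 \<in> J_of \<Delta> \<longrightarrow> hminus R (form_Q R (\<sigma> *v u)) (form_Q R u) \<in> \<Omega>)})"

definition NU_ideal ::
    "'a::comm_ring_1 hermitian \<Rightarrow> ('a \<times> 'a) set \<Rightarrow> 'a set \<times> ('a \<times> 'a) set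
      \<Rightarrow> (('a, 'n::finite) matrix) set" where
  "NU_ideal R \<Delta> L = normalizer (U_group R \<Delta>) (U_ideal R \<Delta> L)"

definition commutator :: "('g, 'b) monoid_scheme \<Rightarrow> 'g \<Rightarrow> 'g \<Rightarrow> 'g" where
  "commutator G g h = g \<otimes>\<^bsub>G\<^esub> h \<otimes>\<^bsub>G\<^esub> inv\<^bsub>G\<^esub> g \<otimes>\<^bsub>G\<^esub> inv\<^bsub>G\<^esub> h"

definition CU_ideal ::
    "'a::comm_ring_1 hermitian \<Rightarrow> ('a \<times> 'a) set \<Rightarrow> 'a set \<times> ('a \<times> 'a) set
      \<Rightarrow> (('a, 'n::finite) matrix) set" where
  "CU_ideal R \<Delta> L = {\<sigma> \<in> NU_ideal R \<Delta> L.
     generate (U_group R \<Delta>) {commutator (U_group R \<Delta>) \<sigma> \<tau> | \<tau>. \<tau> \<in> EU R \<Delta>} \<subseteq> U_ideal R \<Delta> L}"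


section \<open>The upper level of a subgroup\<close>

definition upper_Y ::
    "'a::comm_ring_1 hermitian \<Rightarrow> ('a \<times> 'a) set \<Rightarrow> (('a, 'n::finite) matrix) set \<Rightarrow> 'a set" where
  "upper_Y R \<Delta> H =
     (\<Union>\<sigma>\<in>H. \<Union>(i, j)\<in>{(i, j). i \<noteq> 0 \<and> j \<noteq> 0 \<and> i \<noteq> j}.
        {\<sigma> $ i $ j, \<sigma> $ i $ i - \<sigma> $ j $ j} \<union>
        {\<sigma> $ i $ 0 * y | y. y \<in> J_of \<Delta>} \<union>
        {bar R y * mu R * \<sigma> $ 0 $ j | y. y \<in> J_of \<Delta>} \<union>
        {bar R y * mu R * (\<sigma> $ 0 $ 0 - \<sigma> $ j $ j) * z | y z. y \<in> J_of \<Delta> \<and> z \<in> J_of \<Delta>})"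

definition upper_Z ::
    "'a::comm_ring_1 hermitian \<Rightarrow> ('a \<times> 'a) set \<Rightarrow> (('a, 'n::finite) matrix) set \<Rightarrow> ('a \<times> 'a) set"
  where
  "upper_Z R \<Delta> H =
     {form_Q R (column j \<sigma>) | \<sigma> j. \<sigma> \<in> H \<and> j \<noteq> 0} \<union>
     {hminus R
        (hplus R (circ R (hminus R (form_Q R (column 0 \<sigma>)) (1, 0)) y) (y, z))
        (circ R (y, z) (\<sigma> $ i $ i))
      | \<sigma> i y z. \<sigma> \<in> H \<and> i \<noteq> 0 \<and> (y, z) \<in> \<Delta>}"

definition upper_level ::
    "'a::comm_ring_1 hermitian \<Rightarrow> ('a \<times> 'a) set \<Rightarrow> (('a, 'n::finite) matrix) set
      \<Rightarrow> 'a set \<times> ('a \<times> 'a) set" where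
  "upper_level R \<Delta> H =
     (let J = ideal_gen (upper_Y R \<Delta> H \<union> bar R ` upper_Y R \<Delta> H)
      in (J, Omega_min R \<Delta> J <#>\<^bsub>heis R\<^esub> set_circ R (upper_Z R \<Delta> H) UNIV))"

end

theory Submission imports Defs "HOL-Algebra.Zassenhaus" begin

text \<open>
  Every matrix that occurs is handled through the transvections \<open>E e v z\<close>, where \<open>e\<close> is isotropic and
  \<open>v\<close> is orthogonal to \<open>e\<close>. An isometry \<open>g\<close> conjugates \<open>E e v z\<close> to \<open>E (g e) (g v) z\<close>
  (\<open>E_conj\<close>), transvections along the same vector multiply like elements of a Heisenberg group
  (\<open>E_mult\<close>), and the generators of the elementary subgroups are the transvections along basis
  vectors \<open>X p r x\<close> and \<open>Y p (x, z)\<close> (\<open>T_short_eq\<close>, \<open>T_extra_eq\<close>). Write \<open>(J, \<Sigma>)\<close> for the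
  upper level of \<open>H\<close>.

  \<^bold>\<open>Upper bound.\<close> The generators of \<open>J\<close> and \<open>\<Sigma>\<close> say that every \<open>\<sigma> \<in> H\<close> acts, modulo \<open>J\<close>,
  as a scalar \<open>c\<close> with \<open>c\<close> times its conjugate congruent to 1, and that \<open>Q (\<sigma> w)\<close> is determined
  modulo \<open>\<Sigma>\<close> by \<open>c\<close> and \<open>w\<close> (\<open>s_Q\<close>). Since transvections change \<open>Q\<close> in a controlled way (\<open>Q_E\<close>),
  it follows that \<open>\<sigma>\<close> normalises the congruence subgroup of level \<open>(J, \<Sigma>)\<close> and commutes with
  transvections modulo it (\<open>V_conj\<close>, \<open>s_commutator_gens\<close>).

  \<^bold>\<open>Lower bound.\<close> Let \<open>N\<close> be the normaliser of \<open>H\<close>. The ring elements \<open>a\<close> with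
  \<open>X p r (a w) \<in> H\<close> for all \<open>w\<close> in the \<open>m\<close>-th power of \<open>I\<close> form an ideal \<open>L m p r\<close>, and changing
  one of the indices costs one power of \<open>I\<close> (\<open>L_move1\<close>). The task is to show that the generators of
  \<open>J\<close> lie in all these ideals for \<open>m = 9\<close>.

  The source of elements of \<open>H\<close> is that \<open>\<sigma> \<tau> \<sigma>\<^sup>-\<^sup>1\<close> and \<open>\<tau>\<close> are congruent modulo \<open>H\<close> whenever
  \<open>\<sigma> \<in> H\<close> and \<open>\<tau> \<in> N\<close>. For a row of \<open>\<sigma>\<close>, say with index \<open>a\<close>, there are elementary
  transvections \<open>\<tau>\<close> over \<open>I\<close> along vectors that are orthogonal to this row. Then \<open>\<sigma> \<tau> \<sigma>\<^sup>-\<^sup>1\<close>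
  fixes the basis vector of index \<open>-a\<close>, although nothing else is known about it, whereas
  \<open>\<tau>\<close> moves this vector by explicit multiples of products of two entries of the row. A suitable double
  commutator is trivial for \<open>\<sigma> \<tau> \<sigma>\<^sup>-\<^sup>1\<close> but not for \<open>\<tau>\<close>, so that its value at \<open>\<tau>\<close> lies in \<open>H\<close>
  (\<open>transvection_extraction\<close>). Thus products of an entry of the row with the conjugate of
  another one lie in the ideals \<open>L m p r\<close>, and so does each off-diagonal entry itself, because the
  row is unimodular (\<open>off_diagonal_row\<close>). The remaining generators of \<open>J\<close> appear as off-diagonal entries
  after conjugation by elementary matrices (\<open>diag_LL\<close>, \<open>col0_LL\<close>, \<open>row0_LL\<close>, \<open>mid_LL\<close>).

  For \<open>\<Sigma>\<close> the same transvection \<open>\<tau>\<close> is used. Knowing that off-diagonal entries are negligible, it is congruent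
  to a single elementary matrix modulo \<open>H\<close>; conjugating one more elementary matrix by \<open>\<sigma> \<tau> \<sigma>\<^sup>-\<^sup>1\<close> and
  by this elementary matrix gives two transvections along the same basis vector, and their quotient is
  an element of \<open>H\<close> in which \<open>Q\<close> of a column of \<open>\<sigma>\<close> appears (\<open>column_transvection\<close>). The
  generators of \<open>\<Sigma>\<close> that involve the middle column come from the columns of a conjugate of \<open>\<sigma>\<close>
  (\<open>middle_extra_mult\<close>). Counting the commutators with matrices over \<open>I\<close> gives the exponent 10.
\<close>

section \<open>Sesquilinear forms and transvections\<close>

lemma uminus_idx_simps [simp]:
  "- Plus k = Minus k" "- Minus k = Plus k" "- Centre = Centre"
  by (simp_all add: uminus_idx_def)

lemma idx_zero_simps [simp]:
  "Plus k \<noteq> 0" "Minus k \<noteq> 0" "0 \<noteq> Plus k" "0 \<noteq> Minus k"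
  by (simp_all add: zero_idx_def)

lemma idx_cases [case_names Plus zero Minus, cases type: idx]:
  "(\<And>k. p = Plus k \<Longrightarrow> P) \<Longrightarrow> (p = 0 \<Longrightarrow> P) \<Longrightarrow> (\<And>k. p = Minus k \<Longrightarrow> P) \<Longrightarrow> P"
  by (cases p rule: idx.exhaust) (simp_all add: zero_idx_def)

lemma idx_minus_zero [simp]: "- 0 = (0 :: 'n idx)"
  unfolding zero_idx_def by (simp only: uminus_idx_simps)

lemma idx_minus_minus [simp]: "- (- p) = (p :: 'n idx)"
  by (cases p) simp_all

lemma idx_minus_eq_iff [simp]: "- p = - q \<longleftrightarrow> p = (q :: 'n idx)"
  by (metis idx_minus_minus)

lemma idx_minus_eq_zero_iff [simp]: "- p = 0 \<longleftrightarrow> p = (0 :: 'n idx)" "0 = - p \<longleftrightarrow> p = (0 :: 'n idx)"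
  by (cases p; simp)+

lemma idx_minus_eq_self_iff [simp]: "- p = p \<longleftrightarrow> p = (0 :: 'n idx)" "p = - p \<longleftrightarrow> p = (0 :: 'n idx)"
  by (cases p; simp)+

lemma idx_minus_swap: "- p = q \<longleftrightarrow> p = - (q :: 'n idx)"
  by (metis idx_minus_minus)

lemma axis_nth_if: "axis p x $ q = (if q = p then x else 0)"
  by (simp add: axis_def)

lemma axis_add: "axis p x + axis p y = axis p (x + y :: 'a::comm_ring_1)"
  by (vector axis_def)

lemma axis_minus: "- axis p x = axis p (- x :: 'a::comm_ring_1)"
  by (vector axis_def)

lemma axis_scale: "c *s axis p x = axis p (c * x :: 'a::comm_ring_1)"
  by (vector axis_def)

lemma axis_zero [simp]: "axis p (0::'a::comm_ring_1) = 0"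
  by (vector axis_def)

lemma sum_axis: "(\<Sum>p\<in>UNIV. axis p (u $ p)) = (u :: 'a::comm_ring_1 ^ 'm::finite)"
  by (simp add: vec_eq_iff sum_component axis_nth_if)

lemma mult_axis_column: "A *v axis j x = x *s column j (A :: 'a::comm_ring_1 ^ 'm ^ 'm::finite)"
  by (simp add: vec_eq_iff matrix_vector_mult_def column_def axis_nth_if mult.commute if_distrib[where f="\<lambda>y. _ * y"] cong: if_cong)

lemma mult_axis_nth: "((A :: 'a::comm_ring_1 ^ 'm ^ 'm::finite) *v axis j x) $ i = A $ i $ j * x"
  by (simp add: mult_axis_column column_def mult.commute)

lemma unit_entry_mult: "axis i (axis j x) *v w = axis i (x * (w :: 'a::comm_ring_1 ^ 'm::finite) $ j)"
proof -
  have "(\<Sum>j'\<in>UNIV. (if j' = j then x else 0) * w $ j') = x * w $ j"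
    by (simp add: if_distrib[where f="\<lambda>y. y * _"] cong: if_cong)
  then show ?thesis
    by (auto simp: vec_eq_iff matrix_vector_mult_def axis_nth_if)
qed

lemma matrix_eqI: "(\<And>w. A *v w = B *v w) \<Longrightarrow> A = (B :: 'a::comm_ring_1 ^ 'm ^ 'm::finite)"
  by (simp add: matrix_eq)

lemma mult_vec_scale: "A *v (c *s w) = c *s (A *v (w :: 'a::comm_ring_1 ^ 'm::finite))"
  by (simp add: vec_eq_iff matrix_vector_mult_def sum_distrib_left mult_ac)

lemmas entry_simps = axis_nth_if matrix_vector_right_distrib matrix_vector_mult_diff_distrib mult_axis_nth

locale herm =
  fixes R :: "'a::comm_ring_1 hermitian"
  assumes herm: "hermitian_ring R"
begin


abbreviation br where "br \<equiv> bar R"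
abbreviation lm where "lm \<equiv> lam R"
abbreviation lmi where "lmi \<equiv> bar R (lam R)"

lemma lm_lmi [simp]: "lm * lmi = 1" "lmi * lm = 1"
  using lam_mult_bar_lam[OF herm] by (simp_all add: mult.commute)

lemma lm_lmi_assoc [simp]: "lm * (lmi * x) = x" "lmi * (lm * x) = x"
  by (simp_all flip: mult.assoc)

lemma lm_lmi_far:
  "lm * (x * lmi) = x" "lm * (x * (lmi * y)) = x * y"
  "lm * (x * (y * lmi)) = x * y" "lm * (x * (y * (lmi * z))) = x * (y * z)"
  "lm * (x * (y * (z * lmi))) = x * (y * z)" "lm * (x * (y * (z * (lmi * w)))) = x * (y * (z * w))"
  "lm * (x * (y * (z * (w * lmi)))) = x * (y * (z * w))"
  by (simp_all only: mult.commute[of _ lmi] mult.left_commute[of _ lmi] lm_lmi_assoc)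

lemma br_add [simp]: "br (x + y) = br x + br y"
  and br_mult [simp]: "br (x * y) = br x * br y"
  and br_1 [simp]: "br 1 = 1"
  using herm unfolding hermitian_ring_def by (simp_all add: mult.commute)

lemma br_br [simp]: "br (br x) = x"
proof -
  have "br (br x) = lm * x * br lm"
    using herm unfolding hermitian_ring_def by blast
  then show ?thesis by (simp add: mult.commute mult.left_commute)
qed

lemma br_0 [simp]: "br 0 = 0"
  using br_add[of 0 0] by (metis add_cancel_left_left)

lemma br_minus [simp]: "br (- x) = - br x"
  using br_add[of x "- x"] by (simp add: eq_neg_iff_add_eq_0 add.commute)

lemma br_diff [simp]: "br (x - y) = br x - br y"
  using br_add[of x "- y"] by simp

lemma br_sum: "br (sum f A) = (\<Sum>i\<in>A. br (f i))"
  by (induction A rule: infinite_finite_induct) simp_all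

lemma br_mu: "br (mu R) = mu R * lmi"
proof -
  have e: "br (mu R) * lm = mu R"
    using herm unfolding hermitian_ring_def by (metis (no_types))
  have "mu R * lmi = br (mu R) * lm * lmi"
    by (simp only: e)
  then show ?thesis by (simp add: mult.assoc)
qed

text \<open>The value of \<open>B\<close> at the basis vectors of indices \<open>p\<close> and \<open>-p\<close>. Expressing all formulas by it
  avoids a distinction between positive and negative indices.\<close>

definition kap :: "'n idx \<Rightarrow> 'a" where
  "kap p = (case p of Minus k \<Rightarrow> lm | _ \<Rightarrow> 1)"

lemma kap_simps [simp]: "kap (Plus k) = 1" "kap (Minus k) = lm" "kap 0 = 1"
proof -
  show "kap 0 = 1"
    unfolding kap_def zero_idx_def by (simp only: idx.case)
qed (simp_all add: kap_def)

lemma kap_br [simp]: "kap p * br (kap p) = 1" "br (kap p) * kap p = 1"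
  by (cases p; simp)+

lemma kap_br_assoc [simp]: "kap p * (br (kap p) * x) = x" "br (kap p) * (kap p * x) = x"
  by (simp_all only: mult.assoc[symmetric] kap_br mult_1_left)

lemma kap_opp: "p \<noteq> 0 \<Longrightarrow> kap p * kap (- p) = lm"
  by (cases p) simp_all

text \<open>The second coordinate of \<open>Q u\<close> is \<open>h u u\<close>, and \<open>B\<close> is obtained from \<open>h\<close> by adding its
  \<open>\<lambda>\<close>-conjugate and the contribution of the middle coordinate (\<open>B_eq\<close>).\<close>

definition h :: "'a ^ 'n::finite idx \<Rightarrow> 'a ^ 'n idx \<Rightarrow> 'a" where
  "h u v = (\<Sum>i\<in>range Plus. br (u $ i) * v $ (- i))"

abbreviation q where "q u \<equiv> h u u"

abbreviation B :: "'a ^ 'n::finite idx \<Rightarrow> 'a ^ 'n idx \<Rightarrow> 'a" where "B \<equiv> form_B R"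

lemma h_linear [simp]:
  "h (u + v) w = h u w + h v w" "h u (v + w) = h u v + h u w"
  "h (c *s u) w = br c * h u w" "h u (c *s w) = c * h u w"
  "h 0 w = 0" "h u 0 = 0"
  "h (- u) w = - h u w" "h u (- w) = - h u w"
  "h (u - v) w = h u w - h v w" "h u (v - w) = h u v - h u w"
proof -
  show "h (u + v) w = h u w + h v w" "h u (v + w) = h u v + h u w"
    by (simp_all add: h_def distrib_left distrib_right sum.distrib)
  show "h (c *s u) w = br c * h u w" "h u (c *s w) = c * h u w"
    by (simp_all add: h_def sum_distrib_left mult_ac)
  show "h 0 w = 0" "h u 0 = 0" "h (- u) w = - h u w" "h u (- w) = - h u w"
    by (simp_all add: h_def sum_negf)
  show "h (u - v) w = h u w - h v w" "h u (v - w) = h u v - h u w"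
    by (simp_all add: h_def left_diff_distrib right_diff_distrib sum_subtractf)
qed

lemma h_axis_left: "h (axis p x) v = (if p \<in> range Plus then br x * v $ (- p) else 0)"
proof (cases "p \<in> range (Plus :: 'b \<Rightarrow> 'b idx)")
  case True
  have "h (axis p x) v = (\<Sum>i\<in>range Plus. if i = p then br x * v $ (- i) else 0)"
    unfolding h_def by (rule sum.cong) (auto simp: axis_nth_if)
  then show ?thesis using True by simp
next
  case False
  then show ?thesis
    by (auto simp: h_def axis_nth_if intro!: sum.neutral)
qed

lemma h_axis_right: "h v (axis p x) = (if p \<in> range Minus then br (v $ (- p)) * x else 0)"
proof (cases "p \<in> range (Minus :: 'b \<Rightarrow> 'b idx)")
  case True
  have "h v (axis p x) = (\<Sum>i\<in>range Plus. if i = - p then br (v $ i) * x else 0)"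
    unfolding h_def by (rule sum.cong) (auto simp: axis_nth_if idx_minus_swap)
  then show ?thesis using True by auto
next
  case False
  then show ?thesis
    by (auto simp: h_def axis_nth_if intro!: sum.neutral)
qed

lemma B_eq: "B u v = h u v + br (h v u) * lm + br (u $ 0) * mu R * v $ 0"
proof -
  have M: "range Minus = uminus ` range (Plus :: 'b \<Rightarrow> 'b idx)"
    by (auto simp: image_image)
  have inj: "inj_on uminus (range (Plus :: 'b \<Rightarrow> 'b idx))"
    by (simp add: inj_on_def)
  have "(\<Sum>i\<in>range Minus. br (u $ i) * lm * v $ (- i)) = br (h v u) * lm"
    unfolding M h_def by (subst sum.reindex[OF inj])
      (simp add: br_sum sum_distrib_left sum_distrib_right mult_ac)
  then show ?thesis by (simp add: form_B_def h_def)
qed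

lemma B_linear [simp]:
  "B (u + v) w = B u w + B v w" "B u (v + w) = B u v + B u w"
  "B (c *s u) w = br c * B u w" "B u (c *s w) = c * B u w"
  "B 0 w = 0" "B u 0 = 0"
  "B (- u) w = - B u w" "B u (- w) = - B u w"
  "B (u - v) w = B u w - B v w" "B u (v - w) = B u v - B u w"
  by (simp_all add: B_eq distrib_left distrib_right left_diff_distrib right_diff_distrib mult_ac add_ac)

lemma B_sum_right: "B w (sum f A) = (\<Sum>i\<in>A. B w (f i))"
  by (induction A rule: infinite_finite_induct) simp_all

lemma B_swap: "B v u = br (B u v) * lm"
  by (simp add: B_eq br_mu lm_lmi_far algebra_simps)

lemma B_axis_left: "p \<noteq> 0 \<Longrightarrow> B (axis p x) w = kap p * br x * w $ (- p)"
  by (cases p) (auto simp: B_eq h_axis_left h_axis_right axis_nth_if)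

lemma B_axis_right: "p \<noteq> 0 \<Longrightarrow> B w (axis p x) = br (w $ (- p)) * kap (- p) * x"
  by (cases p) (auto simp: B_eq h_axis_left h_axis_right axis_nth_if)

lemma B_axis0_left: "B (axis 0 x) w = br x * mu R * w $ 0"
  by (auto simp: B_eq h_axis_left h_axis_right axis_nth_if)

lemma B_axis0_right: "B w (axis 0 x) = br (w $ 0) * mu R * x"
  by (auto simp: B_eq h_axis_left h_axis_right axis_nth_if)

lemma B_axis_axis: "B (axis p x) (axis q' y) = (if p = 0 then if q' = 0 then br x * mu R * y else 0
    else if q' = - p then kap p * br x * y else 0)"
  by (auto simp: B_axis_left B_axis0_left axis_nth_if)

text \<open>The Siegel transvection along \<open>e\<close>, written out on basis vectors; \<open>E_apply\<close> is its usual formula.\<close>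

definition E :: "'a ^ 'n::finite idx \<Rightarrow> 'a ^ 'n idx \<Rightarrow> 'a \<Rightarrow> ('a, 'n) matrix" where
  "E e v z = (\<chi> i j. (axis j 1 + B e (axis j 1) *s v - (lmi * B v (axis j 1)) *s e
      + (z * B e (axis j 1)) *s e) $ i)"

lemma B_expand: "B u w = (\<Sum>j\<in>UNIV. B u (axis j 1) * w $ j)"
proof -
  have "B u w = B u (\<Sum>j\<in>UNIV. w $ j *s axis j 1)"
    by (simp add: axis_scale sum_axis)
  then show ?thesis
    unfolding B_sum_right by (simp add: mult.commute)
qed

lemma E_apply: "E e v z *v w = w + B e w *s v - (lmi * B v w) *s e + (z * B e w) *s e"
proof (simp only: vec_eq_iff, intro allI)
  fix i
  have "(E e v z *v w) $ i = (\<Sum>j\<in>UNIV. axis j 1 $ i * w $ j + B e (axis j 1) * w $ j * v $ i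
       - B v (axis j 1) * w $ j * (lmi * e $ i) + B e (axis j 1) * w $ j * (z * e $ i))"
    by (simp add: E_def matrix_vector_mult_def algebra_simps)
  also have "\<dots> = w $ i + B e w * v $ i - B v w * (lmi * e $ i) + B e w * (z * e $ i)"
    unfolding sum.distrib sum_subtractf sum_distrib_right[symmetric] B_expand[of _ w, symmetric]
    by (simp add: axis_nth_if if_distrib[where f="\<lambda>y. y * _"] cong: if_cong)
  finally show "(E e v z *v w) $ i = (w + B e w *s v - (lmi * B v w) *s e + (z * B e w) *s e) $ i"
    by (simp add: algebra_simps)
qed

definition isom :: "('a, 'n::finite) matrix \<Rightarrow> bool" where
  "isom g \<longleftrightarrow> (\<forall>u v. B (g *v u) (g *v v) = B u v)"

lemma E_conj: "isom g \<Longrightarrow> g ** E e v z = E (g *v e) (g *v v) z ** g"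
  by (intro matrix_eqI)
    (simp add: matrix_vector_mul_assoc[symmetric] E_apply isom_def matrix_vector_right_distrib
      matrix_vector_mult_diff_distrib mult_vec_scale)

lemma E_mult:
  assumes "B e e = 0" "B e v = 0" "B e v' = 0"
  shows "E e v z ** E e v' z' = E e (v + v') (z + z' - lmi * B v v')"
proof (rule matrix_eqI)
  fix w
  have 1: "B v e = 0" "B v' e = 0"
    using assms B_swap[of v e] B_swap[of v' e] by simp_all
  have 2: "B v (E e v' z' *v w) = B v w + B e w * B v v'"
    "B e (E e v' z' *v w) = B e w"
    using 1 assms by (simp_all add: E_apply)
  show "E e v z ** E e v' z' *v w = E e (v + v') (z + z' - lmi * B v v') *v w"
    unfolding matrix_vector_mul_assoc[symmetric]
    by (subst E_apply, unfold 2) (simp add: E_apply 1 assms vec_eq_iff algebra_simps)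
qed

lemma E_zero: "E e 0 0 = mat 1"
  by (rule matrix_eqI) (simp add: E_apply)

lemma E_inverse:
  assumes "B e e = 0" "B e v = 0"
  shows "E e v z ** E e (- v) (- z - lmi * B v v) = mat 1"
  using assms by (simp add: E_mult E_zero)

lemma E_scale: "E (c *s e) v z = E e (br c *s v) (c * br c * z)"
  by (rule matrix_eqI) (simp add: E_apply vec_eq_iff algebra_simps)

text \<open>Unlike the direction \<open>v\<close>, the vector \<open>e\<close> is not additive: the correction \<open>z\<close> reappears in the
  direction of the second factor. The commutators that change an index of an elementary matrix are instances of this.\<close>

lemma E_base_add:
  assumes "B e e = 0" "B e' e' = 0" "B e e' = 0" "B e' e = 0" "B e v = 0" "B e' v = 0"
    and z: "br z = - lm * z - B v v"
  shows "E (e + e') v z = E e' (v + z *s e) z ** E e v z"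
proof (rule matrix_eqI)
  fix w
  have 1: "B v e = 0" "B v e' = 0"
    using assms B_swap[of v e] B_swap[of v e'] by simp_all
  have 2: "B e' (E e v z *v w) = B e' w" "B v (E e v z *v w) = B v w + B e w * B v v"
    "B e (E e v z *v w) = B e w"
    using 1 assms by (simp_all add: E_apply)
  show "E (e + e') v z *v w = E e' (v + z *s e) z ** E e v z *v w"
    unfolding matrix_vector_mul_assoc[symmetric]
    by (subst (2) E_apply, simp only: 2 B_linear)
      (simp add: E_apply 1 assms vec_eq_iff z lm_lmi_far algebra_simps)
qed

end


section \<open>Heisenberg group and unitary group\<close>

lemma module_mult: "module ((*) :: 'a::comm_ring_1 \<Rightarrow> _)"
  by unfold_locales (simp_all add: algebra_simps)

lemma ring_idealI:
  "0 \<in> S \<Longrightarrow> (\<And>x y. x \<in> S \<Longrightarrow> y \<in> S \<Longrightarrow> x + y \<in> S) \<Longrightarrow> (\<And>c x. x \<in> S \<Longrightarrow> c * x \<in> S)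
    \<Longrightarrow> ring_ideal (S :: 'a::comm_ring_1 set)"
  by (simp add: module.subspace_def[OF module_mult])

context
  fixes S :: "'a::comm_ring_1 set"
  assumes S: "ring_ideal S"
begin

lemma ideal_0 [intro, simp]: "0 \<in> S"
  by (rule module.subspace_0[OF module_mult S])

lemma ideal_add: "x \<in> S \<Longrightarrow> y \<in> S \<Longrightarrow> x + y \<in> S"
  by (rule module.subspace_add[OF module_mult S])

lemma ideal_scale: "x \<in> S \<Longrightarrow> c * x \<in> S"
  by (rule module.subspace_scale[OF module_mult S])

lemma ideal_scale2: "x \<in> S \<Longrightarrow> x * c \<in> S"
  by (metis ideal_scale mult.commute)

lemma ideal_neg: "x \<in> S \<Longrightarrow> - x \<in> S"
  by (rule module.subspace_neg[OF module_mult S])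

lemma ideal_diff: "x \<in> S \<Longrightarrow> y \<in> S \<Longrightarrow> x - y \<in> S"
  by (rule module.subspace_diff[OF module_mult S])

lemma ideal_sum: "(\<And>i. i \<in> A \<Longrightarrow> f i \<in> S) \<Longrightarrow> sum f A \<in> S"
  by (rule module.subspace_sum[OF module_mult S])

end

context herm
begin

abbreviation hp (infixl "\<boxplus>" 65) where "\<alpha> \<boxplus> \<beta> \<equiv> hplus R \<alpha> \<beta>"
abbreviation hm (infixl "\<boxminus>" 65) where "\<alpha> \<boxminus> \<beta> \<equiv> hminus R \<alpha> \<beta>"
abbreviation ci (infixl "\<odot>" 70) where "\<alpha> \<odot> a \<equiv> circ R \<alpha> a"
abbreviation Q :: "'a ^ 'n::finite idx \<Rightarrow> 'a \<times> 'a" where "Q \<equiv> form_Q R"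

lemma hp_eq: "(x, y) \<boxplus> (x', y') = (x + x', y + y' - br x * mu R * x')"
  by (simp add: heis_def)

lemma heis_simps [simp]: "carrier (heis R) = UNIV" "\<one>\<^bsub>heis R\<^esub> = (0, 0)"
  by (simp_all add: heis_def)

lemma group_heis: "group (heis R)"
proof (rule groupI)
  fix x :: "'a \<times> 'a"
  show "\<exists>y\<in>carrier (heis R). y \<boxplus> x = \<one>\<^bsub>heis R\<^esub>"
    by (rule bexI[of _ "(- fst x, - snd x - br (fst x) * mu R * fst x)"])
      (cases x, simp_all add: hp_eq)
qed (auto simp: hp_eq algebra_simps)

lemma hinv_eq: "inv\<^bsub>heis R\<^esub> (x, y) = (- x, - y - br x * mu R * x)"
  by (rule group.inv_equality[OF group_heis]) (simp_all add: hp_eq)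

lemma hm_eq: "(x, y) \<boxminus> (x', y') = (x - x', y - y' + br (x - x') * mu R * x')"
  by (simp add: hinv_eq hp_eq algebra_simps)

lemma ci_eq: "(x, y) \<odot> a = (x * a, br a * y * a)"
  by (simp add: circ_def)

lemma ci_hp: "(\<alpha> \<boxplus> \<beta>) \<odot> a = \<alpha> \<odot> a \<boxplus> \<beta> \<odot> a"
  by (cases \<alpha>; cases \<beta>) (simp add: hp_eq ci_eq algebra_simps)

lemma ci_hm: "(\<alpha> \<boxminus> \<beta>) \<odot> a = \<alpha> \<odot> a \<boxminus> \<beta> \<odot> a"
  by (cases \<alpha>; cases \<beta>) (simp add: hm_eq ci_eq algebra_simps)

lemma ci_inv: "(inv\<^bsub>heis R\<^esub> \<alpha>) \<odot> a = inv\<^bsub>heis R\<^esub> (\<alpha> \<odot> a)"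
  by (cases \<alpha>) (simp add: hinv_eq ci_eq algebra_simps)

lemma ci_ci: "\<alpha> \<odot> a \<odot> b = \<alpha> \<odot> (a * b)"
  by (cases \<alpha>) (simp add: ci_eq algebra_simps)

text \<open>The pairs \<open>(0, zz z)\<close> form the minimal odd form parameter.\<close>

definition zz :: "'a \<Rightarrow> 'a" where "zz z = z - br z * lm"

lemma zz_simps: "zz (x + y) = zz x + zz y" "zz (- x) = - zz x" "zz (x - y) = zz x - zz y"
  "br a * zz x * a = zz (br a * x * a)" "zz 0 = 0"
  by (simp_all add: zz_def algebra_simps)

text \<open>The action of the ring on the Heisenberg group is additive up to the minimal form parameter, because
  the first coordinate of an element of \<open>Delta_max\<close> determines the symmetrisation of the second one.\<close>

lemma ci_add:
  assumes "(x, z) \<in> Delta_max R"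
  shows "(x, z) \<odot> (a + b) = (x, z) \<odot> a \<boxplus> (x, z) \<odot> b \<boxplus> (0, zz (br b * z * a))"
proof -
  have "br x * mu R * x = - z - br z * lm"
    using assms by (auto simp: Delta_max_def algebra_simps eq_neg_iff_add_eq_0)
  then have "br a * b * (br x * mu R * x) = br a * b * (- z - br z * lm)"
    by (simp only:)
  then have "br a * br x * mu R * x * b = br a * b * (- z - br z * lm)"
    by (simp only: mult_ac)
  then show ?thesis
    by (simp add: hp_eq ci_eq zz_def algebra_simps)
qed

lemma Q_eq: "Q u = (u $ 0, q u)"
  by (simp add: form_Q_def h_def)

lemma Q_scale: "Q (c *s u) = Q u \<odot> c"
  by (simp add: Q_eq ci_eq algebra_simps)

lemma Q_add: "Q (u + v) = Q u \<boxplus> Q v \<boxplus> (0, B u v + zz (h v u))"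
  by (simp add: Q_eq hp_eq B_eq zz_def algebra_simps)

text \<open>The displacement of \<open>Q\<close> under a transvection is a multiple of the vector that defines the
  transvection, up to an element of the minimal form parameter.\<close>

lemma Q_E:
  assumes e: "e $ 0 = 0" "q e = 0" and v: "B e v = 0"
  shows "Q (E e v z *v x) = Q x \<boxplus> (v $ 0, q v + lm * z) \<odot> B e x
    \<boxplus> (0, zz (h (E e v z *v x - x) x
          + br (B e x) * (z * B e x - lmi * B v x) * h v e - br (B e x) * B v x))"
proof -
  define \<beta> where "\<beta> = B e x"
  define \<gamma> where "\<gamma> = z * \<beta> - lmi * B v x"
  define d where "d = \<beta> *s v + \<gamma> *s e"
  have Ex: "E e v z *v x = x + d"
    by (simp add: E_apply d_def \<beta>_def \<gamma>_def vec_eq_iff algebra_simps)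
  have hev: "h e v = - br (h v e) * lm"
    using v e by (simp add: B_eq eq_neg_iff_add_eq_0)
  have qd: "q d = br \<beta> * \<beta> * q v + zz (br \<beta> * \<gamma> * h v e)"
    by (simp add: d_def e hev zz_def algebra_simps)
  have d0: "d $ 0 = \<beta> * v $ 0"
    by (simp add: d_def e)
  have Bxe: "B x e = br \<beta> * lm"
    using B_swap[of x e] by (simp add: \<beta>_def)
  have Bxv: "B x v = br (B v x) * lm"
    by (rule B_swap)
  have Bxd: "B x d = lm * z * br \<beta> * \<beta> - zz (br \<beta> * B v x)"
    by (simp add: d_def Bxe Bxv \<gamma>_def zz_def lm_lmi_far algebra_simps)
  have "h x d = B x d - br (h d x) * lm - br (x $ 0) * mu R * (\<beta> * v $ 0)"
    by (simp add: B_eq d0)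
  then have "q (x + d) = q x + br \<beta> * \<beta> * (q v + lm * z) - br (x $ 0) * mu R * (\<beta> * v $ 0)
      + zz (h d x + br \<beta> * \<gamma> * h v e - br \<beta> * B v x)"
    by (simp add: qd Bxd zz_def algebra_simps)
  then show ?thesis
    unfolding Ex \<beta>_def[symmetric] \<gamma>_def[symmetric]
    by (simp add: Q_eq hp_eq ci_eq d0 algebra_simps)
qed

text \<open>The elementary matrices as transvections along basis vectors, for all nonzero indices at once. For
  \<open>r = p\<close> the matrix \<open>X p r x\<close> is a long root element and equal to some \<open>Y p (0, z)\<close> (\<open>X_long\<close>).\<close>

definition X :: "'n::finite idx \<Rightarrow> 'n idx \<Rightarrow> 'a \<Rightarrow> ('a, 'n) matrix" where
  "X p r x = E (axis p 1) (axis r x) 0"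

definition Y :: "'n::finite idx \<Rightarrow> 'a \<times> 'a \<Rightarrow> ('a, 'n) matrix" where
  "Y p \<alpha> = E (axis p 1) (axis 0 (fst \<alpha>)) (br (snd \<alpha>))"

lemma X_apply:
  assumes "p \<noteq> 0" "r \<noteq> 0"
  shows "X p r x *v w = w + axis r (x * kap p * w $ (- p)) - axis p (lmi * kap r * br x * w $ (- r))"
  using assms by (simp add: X_def E_apply B_axis_left axis_scale mult_ac)

lemma Y_apply:
  assumes "p \<noteq> 0"
  shows "Y p (x, z) *v w = w + axis 0 (x * kap p * w $ (- p)) - axis p (lmi * br x * mu R * w $ 0)
    + axis p (br z * kap p * w $ (- p))"
  using assms by (simp add: Y_def E_apply B_axis_left B_axis0_left axis_scale mult_ac)

lemma X_swap:
  assumes "p \<noteq> 0" "r \<noteq> 0"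
  shows "X p r x = X r p (- lmi * br x)"
  using assms by (intro matrix_eqI)
    (simp add: X_apply axis_minus[symmetric] lm_lmi_far mult_ac)

lemma h_axis_self [simp]: "p \<noteq> 0 \<Longrightarrow> h (axis p x) (axis p y) = 0"
  by (simp add: h_axis_left axis_nth_if)

lemma X_add:
  assumes "p \<noteq> 0" "r \<noteq> 0" "r \<noteq> - p"
  shows "X p r x ** X p r y = X p r (x + y)"
  unfolding X_def using assms by (subst E_mult) (simp_all add: B_axis_axis axis_add)

lemma E_axis_axis: "E (axis p s) (axis r x) 0 = X p r (br s * x)"
proof -
  have "E (axis p s) (axis r x) 0 = E (s *s axis p 1) (axis r x) 0"
    by (simp add: axis_scale)
  then show ?thesis
    unfolding E_scale by (simp add: X_def axis_scale)
qed

lemma X_0: "X p r 0 = mat 1"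
  by (simp add: X_def E_zero)

lemma Y_hp: "p \<noteq> 0 \<Longrightarrow> Y p \<alpha> ** Y p \<beta> = Y p (\<beta> \<boxplus> \<alpha>)"
  unfolding Y_def by (subst E_mult)
    (cases \<alpha>; cases \<beta>; simp add: B_axis_axis axis_add hp_eq br_mu lm_lmi_far mult_ac algebra_simps)+

lemma Y_0: "Y p (0, 0) = mat 1"
  by (simp add: Y_def E_zero)

lemma X_long: "p \<noteq> 0 \<Longrightarrow> X p p x = Y p (0, zz (br x))"
  by (intro matrix_eqI) (simp add: X_apply Y_apply zz_def axis_add axis_minus mult_ac algebra_simps)

lemma T_short_eq:
  assumes "i \<noteq> 0" "j \<noteq> 0"
  shows "T_short R i j x = X (- j) i (x * br (kap (- j)))"
proof (rule matrix_eqI)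
  fix w :: "'a ^ 'b idx"
  have "lam_pow R ((eps j - 1) div 2) * br x * lam_pow R ((1 - eps i) div 2)
      = lmi * kap i * br (x * br (kap (- j)))"
    using assms by (cases i; cases j; simp add: lam_pow_def eps_def lm_lmi_far mult_ac)
  then show "T_short R i j x *v w = X (- j) i (x * br (kap (- j))) *v w"
    using assms unfolding T_short_def
    by (simp add: X_apply unit_entry_mult matrix_vector_mult_diff_rdistrib
        matrix_vector_mult_add_rdistrib mult_ac)
qed

lemma T_extra_eq:
  assumes "i \<noteq> 0"
  shows "T_extra R i (x, y) = Y i (br (kap i) * x, kap i * br y)"
proof (rule matrix_eqI)
  fix w :: "'a ^ 'b idx"
  have "lam_pow R (- ((1 + eps i) div 2)) * br x * mu R = lmi * (kap i * br x) * mu R"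
    using assms by (cases i; simp add: lam_pow_def eps_def)
  then show "T_extra R i (x, y) *v w = Y i (br (kap i) * x, kap i * br y) *v w"
    using assms unfolding T_extra_def
    by (simp add: Y_apply unit_entry_mult matrix_vector_mult_diff_rdistrib
        matrix_vector_mult_add_rdistrib mult_ac)
qed

end

locale bullet = herm R for R :: "'a::comm_ring_1 hermitian" +
  fixes S
  assumes bullet: "bullet_submodule R S"
begin

lemma zero_mem: "(0, 0) \<in> S"
  and hp_mem: "\<alpha> \<in> S \<Longrightarrow> \<beta> \<in> S \<Longrightarrow> \<alpha> \<boxplus> \<beta> \<in> S"
  and hinv_mem: "\<alpha> \<in> S \<Longrightarrow> inv\<^bsub>heis R\<^esub> \<alpha> \<in> S"
  and ci_mem: "\<alpha> \<in> S \<Longrightarrow> \<alpha> \<odot> a \<in> S"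
  using bullet unfolding bullet_submodule_def
  by (auto dest: subgroup.one_closed subgroup.m_closed subgroup.m_inv_closed)

lemma hm_mem: "\<alpha> \<in> S \<Longrightarrow> \<beta> \<in> S \<Longrightarrow> \<alpha> \<boxminus> \<beta> \<in> S"
  by (intro hp_mem hinv_mem)

lemma hp_iff: "\<beta> \<in> S \<Longrightarrow> \<alpha> \<boxplus> \<beta> \<in> S \<longleftrightarrow> \<alpha> \<in> S"
  using hm_mem[of "\<alpha> \<boxplus> \<beta>" \<beta>] hp_mem[of \<alpha> \<beta>]
  by (metis UNIV_I group.inv_solve_right heis_simps(1) group_heis)

text \<open>Elements of \<open>Delta_max\<close> satisfy \<open>br y * lm = - y - br x * mu R * x\<close>, and the right-hand side is the second
  coordinate of an inverse. Because of this the sign conventions for extra short root elements of positive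
  and negative index agree up to a unit.\<close>

lemma flip_mem:
  assumes "(x, y) \<in> S" "S \<subseteq> Delta_max R"
  shows "(x, br y * lm) \<in> S"
proof -
  have "br y * lm = - y - br x * mu R * x"
    using assms by (force simp: Delta_max_def algebra_simps eq_neg_iff_add_eq_0)
  moreover have "inv\<^bsub>heis R\<^esub> (x, y) \<odot> (- 1) \<in> S"
    using assms by (intro ci_mem hinv_mem)
  moreover have "inv\<^bsub>heis R\<^esub> (x, y) \<odot> (- 1) = (x, - y - br x * mu R * x)"
    by (simp add: hinv_eq ci_eq)
  ultimately show ?thesis
    by simp
qed

end

locale form_ring = herm R for R :: "'a::comm_ring_1 hermitian" +
  fixes \<Delta>
  assumes odd_form: "odd_form_parameter R \<Delta>"
begin

sublocale D: bullet R \<Delta>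
  using odd_form by unfold_locales (simp add: odd_form_parameter_def)

lemma Delta_max: "\<Delta> \<subseteq> Delta_max R"
  using odd_form by (simp add: odd_form_parameter_def)

lemma Delta_maxD: "(x, y) \<in> \<Delta> \<Longrightarrow> br x * mu R * x + y + br y * lm = 0"
  using Delta_max by (auto simp: Delta_max_def)

lemma zz_Delta: "(0, zz x) \<in> \<Delta>"
  using odd_form by (auto simp: odd_form_parameter_def Delta_min_def zz_def)

abbreviation Jd where "Jd \<equiv> J_of \<Delta>"

lemma Jd_I: "(x, y) \<in> \<Delta> \<Longrightarrow> x \<in> Jd"
  by (auto simp: J_of_def)

lemma ring_ideal_Jd: "ring_ideal Jd"
proof (rule ring_idealI)
  show "0 \<in> Jd"
    using D.zero_mem by (rule Jd_I)
  show "x + y \<in> Jd" if xy: "x \<in> Jd" "y \<in> Jd" for x y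
  proof -
    obtain x' y' where "(x, x') \<in> \<Delta>" "(y, y') \<in> \<Delta>"
      using xy by (auto simp: J_of_def)
    from D.hp_mem[OF this] show ?thesis
      by (auto simp: hp_eq intro: Jd_I)
  qed
  show "c * x \<in> Jd" if x: "x \<in> Jd" for c x
  proof -
    obtain x' where "(x, x') \<in> \<Delta>"
      using x by (auto simp: J_of_def)
    from D.ci_mem[OF this, of c] show ?thesis
      by (auto simp: ci_eq mult.commute intro: Jd_I)
  qed
qed

abbreviation G :: "('a, 'n::finite) matrix monoid" where "G \<equiv> U_group R \<Delta>"

lemma mult_G [simp]: "\<sigma> \<otimes>\<^bsub>G\<^esub> \<tau> = \<sigma> ** \<tau>" and one_G [simp]: "\<one>\<^bsub>G\<^esub> = mat 1"
  by (simp_all add: U_group_def GL_def)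

lemma G_iff: "\<sigma> \<in> carrier G \<longleftrightarrow> invertible \<sigma> \<and> isom \<sigma> \<and> (\<forall>u. Q (\<sigma> *v u) \<boxminus> Q u \<in> \<Delta>)"
  by (auto simp: U_group_def GL_def isom_def)

lemma G_isom: "\<sigma> \<in> carrier G \<Longrightarrow> B (\<sigma> *v u) (\<sigma> *v v) = B u v"
  by (simp add: G_iff isom_def)

lemma G_Q: "\<sigma> \<in> carrier G \<Longrightarrow> Q (\<sigma> *v u) \<boxminus> Q u \<in> \<Delta>"
  by (simp add: G_iff)

lemma hm_trans: "(\<alpha> \<boxminus> \<beta>) \<boxplus> (\<beta> \<boxminus> \<gamma>) = \<alpha> \<boxminus> \<gamma>"
  by (cases \<alpha>; cases \<beta>; cases \<gamma>) (simp add: hm_eq hp_eq algebra_simps)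

lemma hm_inv: "inv\<^bsub>heis R\<^esub> (\<alpha> \<boxminus> \<beta>) = \<beta> \<boxminus> \<alpha>"
  by (cases \<alpha>; cases \<beta>) (simp add: hp_eq hinv_eq algebra_simps)

lemma group_G: "group (G :: ('a, 'n::finite) matrix monoid)"
proof (rule groupI)
  fix \<sigma> \<tau> :: "('a, 'n) matrix"
  assume st: "\<sigma> \<in> carrier G" "\<tau> \<in> carrier G"
  have "Q (\<sigma> *v (\<tau> *v u)) \<boxminus> Q u \<in> \<Delta>" for u
    using D.hp_mem[OF G_Q[OF st(1)] G_Q[OF st(2)], of "\<tau> *v u" u] by (simp add: hm_trans)
  with st show "\<sigma> \<otimes>\<^bsub>G\<^esub> \<tau> \<in> carrier G"
    by (simp add: G_iff isom_def invertible_mult flip: matrix_vector_mul_assoc)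
next
  show "\<one>\<^bsub>G\<^esub> \<in> carrier (G :: ('a, 'n) matrix monoid)"
    using D.zero_mem by (auto simp: G_iff isom_def invertible_def Q_eq hm_eq intro!: exI[of _ "mat 1"])
next
  fix \<sigma> :: "('a, 'n) matrix"
  assume s: "\<sigma> \<in> carrier G"
  then obtain \<tau> where t: "\<sigma> ** \<tau> = mat 1" "\<tau> ** \<sigma> = mat 1"
    by (auto simp: G_iff invertible_def)
  have st: "\<sigma> *v (\<tau> *v u) = u" for u
    by (simp add: matrix_vector_mul_assoc t)
  have "invertible \<tau>"
    using t by (auto simp: invertible_def)
  moreover have "isom \<tau>"
    unfolding isom_def using G_isom[OF s] st by metis
  moreover have "Q (\<tau> *v u) \<boxminus> Q u \<in> \<Delta>" for u
    using D.hinv_mem[OF G_Q[OF s, of "\<tau> *v u"]] by (simp add: st hm_inv del: hinv_eq)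
  ultimately show "\<exists>\<tau>\<in>carrier G. \<tau> \<otimes>\<^bsub>G\<^esub> \<sigma> = \<one>\<^bsub>G\<^esub>"
    using t by (intro bexI[of _ \<tau>]) (simp_all add: G_iff)
qed (simp_all add: matrix_mul_assoc)

lemma inv_G:
  fixes \<sigma> :: "('a, 'n::finite) matrix"
  assumes "\<sigma> \<in> carrier G"
  shows "inv\<^bsub>G\<^esub> \<sigma> \<in> carrier G" "inv\<^bsub>G\<^esub> \<sigma> ** \<sigma> = mat 1" "\<sigma> ** inv\<^bsub>G\<^esub> \<sigma> = mat 1"
  using group.inv_closed[OF group_G assms] group.l_inv[OF group_G assms] group.r_inv[OF group_G assms]
  by simp_all

lemma inv_G_apply:
  fixes \<sigma> :: "('a, 'n::finite) matrix"
  assumes "\<sigma> \<in> carrier G"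
  shows "inv\<^bsub>G\<^esub> \<sigma> *v (\<sigma> *v w) = w" "\<sigma> *v (inv\<^bsub>G\<^esub> \<sigma> *v w) = w"
  using inv_G[OF assms] by (simp_all add: matrix_vector_mul_assoc)

lemma inv_G_eqI:
  fixes \<sigma> :: "('a, 'n::finite) matrix"
  assumes "\<sigma> \<in> carrier G" "\<sigma> ** \<tau> = mat 1"
  shows "inv\<^bsub>G\<^esub> \<sigma> = \<tau>"
  by (metis assms inv_G(2) matrix_mul_assoc matrix_mul_lid matrix_mul_rid)

lemma G_B_inv:
  fixes \<sigma> :: "('a, 'n::finite) matrix"
  assumes "\<sigma> \<in> carrier G"
  shows "B (\<sigma> *v u) v = B u (inv\<^bsub>G\<^esub> \<sigma> *v v)" "B u (\<sigma> *v v) = B (inv\<^bsub>G\<^esub> \<sigma> *v u) v"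
  using G_isom[OF assms] inv_G_apply[OF assms] by metis+

lemma G_E_conj:
  fixes \<sigma> :: "('a, 'n::finite) matrix"
  assumes "\<sigma> \<in> carrier G"
  shows "\<sigma> ** E e v z ** inv\<^bsub>G\<^esub> \<sigma> = E (\<sigma> *v e) (\<sigma> *v v) z"
  using E_conj[of \<sigma> e v z] assms inv_G[OF assms]
  by (simp add: G_iff flip: matrix_mul_assoc)

text \<open>By \<open>Q_E\<close> the value of \<open>Q\<close> changes by a multiple of \<open>(v $ 0, q v + lm * z)\<close> up to an element of the minimal
  form parameter, hence by an element of \<open>\<Delta>\<close>.\<close>

lemma E_in_G:
  fixes e :: "'a ^ 'n::finite idx"
  assumes e: "e $ 0 = 0" "q e = 0" and v: "B e v = 0" and D: "(v $ 0, q v + lm * z) \<in> \<Delta>"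
  shows "E e v z \<in> carrier G"
proof -
  have Bee: "B e e = 0"
    using e by (simp add: B_eq)
  have z: "br z = - lm * z - B v v"
    using Delta_maxD[OF D] by (simp add: B_eq lm_lmi_far algebra_simps eq_neg_iff_add_eq_0)
  have Bve: "B v e = 0"
    using v B_swap[of v e] by simp
  have "E e v z ** E e (- v) (- z - lmi * B v v) = mat 1"
    "E e (- v) (- z - lmi * B v v) ** E e v z = mat 1"
    using E_inverse[OF Bee v, of z] E_inverse[of e "- v" "- z - lmi * B v v"] Bee v by simp_all
  then have "invertible (E e v z)"
    by (auto simp: invertible_def)
  moreover have "isom (E e v z)"
    unfolding isom_def
  proof (intro allI)
    fix x y
    show "B (E e v z *v x) (E e v z *v y) = B x y"
      unfolding E_apply by (simp add: Bee v Bve B_swap[of x v] B_swap[of x e] z lm_lmi_far algebra_simps)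
  qed
  moreover have "Q (E e v z *v x) \<boxminus> Q x \<in> \<Delta>" for x
  proof -
    define t where "t = h (E e v z *v x - x) x
          + br (B e x) * (z * B e x - lmi * B v x) * h v e - br (B e x) * B v x"
    have "Q (E e v z *v x) \<boxminus> Q x = (v $ 0, q v + lm * z) \<odot> B e x
        \<boxplus> (0, zz (t + br (v $ 0 * B e x) * mu R * x $ 0))"
      unfolding Q_E[OF e v] t_def[symmetric]
      by (simp add: Q_eq hp_eq hm_eq ci_eq zz_def br_mu lm_lmi_far algebra_simps)
    then show ?thesis
      by (simp only:) (intro D.hp_mem D.ci_mem D zz_Delta)
  qed
  ultimately show ?thesis
    by (simp add: G_iff)
qed

lemma X_in_G: "p \<noteq> 0 \<Longrightarrow> r \<noteq> 0 \<Longrightarrow> r \<noteq> - p \<Longrightarrow> X p r x \<in> carrier G"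
  unfolding X_def by (rule E_in_G) (use D.zero_mem in \<open>auto simp: axis_nth_if B_axis_axis\<close>)

lemma Y_in_G: "p \<noteq> 0 \<Longrightarrow> \<alpha> \<in> \<Delta> \<Longrightarrow> Y p \<alpha> \<in> carrier G"
  unfolding Y_def using D.flip_mem[of "fst \<alpha>" "snd \<alpha>"] Delta_max
  by (intro E_in_G) (auto simp: axis_nth_if B_axis_axis h_axis_left mult.commute)

lemma sgn_param_mem:
  assumes "bullet_submodule R S" "S \<subseteq> Delta_max R" "i \<noteq> 0" "(x, y) \<in> sgn_param R (- eps i) S"
  shows "(br (kap i) * x, kap i * br y) \<in> S"
proof -
  interpret S: bullet R S
    using assms(1) by unfold_locales
  show ?thesis
  proof (cases i)
    case (Minus k)
    then have "(x, y) \<in> S"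
      using assms(4) by (simp add: sgn_param_def eps_def)
    from S.ci_mem[OF S.flip_mem[OF this assms(2)], of lmi] show ?thesis
      using Minus by (simp add: ci_eq lm_lmi_far mult_ac)
  qed (use assms in \<open>auto simp: sgn_param_def eps_def\<close>)
qed

lemma Y_eq_T_extra:
  assumes "bullet_submodule R S" "S \<subseteq> Delta_max R" "i \<noteq> 0" "\<alpha> \<in> S"
  shows "\<exists>\<beta>\<in>sgn_param R (- eps i) S. Y i \<alpha> = T_extra R i \<beta>"
proof -
  interpret S: bullet R S
    using assms(1) by unfold_locales
  obtain u z where \<alpha>: "\<alpha> = (u, z)"
    by (cases \<alpha>)
  have "(kap i * u, kap i * br z) \<in> sgn_param R (- eps i) S"
  proof (cases i)
    case (Minus k)
    from S.ci_mem[OF S.flip_mem[OF assms(4)[unfolded \<alpha>] assms(2)], of lm] show ?thesis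
      using Minus by (simp add: ci_eq sgn_param_def eps_def lm_lmi_far mult_ac)
  qed (use assms \<alpha> in \<open>auto simp: sgn_param_def eps_def\<close>)
  moreover have "Y i \<alpha> = T_extra R i (kap i * u, kap i * br z)"
    using assms(3) by (simp add: T_extra_eq \<alpha>)
  ultimately show ?thesis by blast
qed

end


section \<open>Congruence subgroups and matrices that are central modulo an odd form ideal\<close>

context group
begin

lemma normalizer_conj:
  assumes "g \<in> normalizer G K" "k \<in> K" "K \<subseteq> carrier G"
  shows "g \<otimes> k \<otimes> inv g \<in> K"
proof -
  have "(g <# K) #> inv g = K"
    using assms by (simp add: normalizer_def stabilizer_def restrict_def split: if_splits)
  moreover have "g \<otimes> k \<otimes> inv g \<in> (g <# K) #> inv g"
    using assms(2) by (auto simp: l_coset_def r_coset_def)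
  ultimately show ?thesis by simp
qed

lemma normalizerI:
  assumes g: "g \<in> carrier G" and K: "K \<subseteq> carrier G"
    and "\<And>k. k \<in> K \<Longrightarrow> g \<otimes> k \<otimes> inv g \<in> K" "\<And>k. k \<in> K \<Longrightarrow> inv g \<otimes> k \<otimes> g \<in> K"
  shows "g \<in> normalizer G K"
proof -
  have "k \<in> (g <# K) #> inv g" if k: "k \<in> K" for k
  proof -
    have "g \<otimes> (inv g \<otimes> k \<otimes> g) \<otimes> inv g = k"
      using g k K by (simp add: m_assoc subset_iff) (simp add: m_assoc[symmetric] subset_iff)
    then show ?thesis
      using assms(4)[OF k] by (force simp: l_coset_def r_coset_def)
  qed
  then have "(g <# K) #> inv g = K"
    using assms(3) by (auto simp: l_coset_def r_coset_def)
  then show ?thesis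
    using g K by (simp add: normalizer_def stabilizer_def)
qed

end

context form_ring
begin

abbreviation MD :: "'a ^ 'n::finite idx \<Rightarrow> bool" where "MD u \<equiv> u $ 0 \<in> Jd"

lemma MD_G: "\<sigma> \<in> carrier G \<Longrightarrow> MD u \<Longrightarrow> MD (\<sigma> *v u)"
  using G_Q[of \<sigma> u] ideal_add[OF ring_ideal_Jd, of "(\<sigma> *v u) $ 0 - u $ 0" "u $ 0"]
  by (auto simp: Q_eq hm_eq dest: Jd_I)

lemma MD_simps [simp]: "p \<noteq> 0 \<Longrightarrow> MD (axis p x)" "y \<in> Jd \<Longrightarrow> MD (axis 0 y)"
  by (simp_all add: axis_nth_if ideal_0[OF ring_ideal_Jd])

text \<open>Elementary transvections: the generators of the elementary subgroup and their inverses.\<close>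

definition gens :: "('a, 'n::finite) matrix set" where
  "gens = {X p r x | p r x. p \<noteq> 0 \<and> r \<noteq> 0 \<and> r \<noteq> p \<and> r \<noteq> - p} \<union> {Y p \<alpha> | p \<alpha>. p \<noteq> 0 \<and> \<alpha> \<in> \<Delta>}"

lemma zero_notin_range [simp]: "0 \<notin> range Plus" "0 \<notin> range Minus"
  by auto

lemma gens_X: "p \<noteq> 0 \<Longrightarrow> r \<noteq> 0 \<Longrightarrow> r \<noteq> p \<Longrightarrow> r \<noteq> - p \<Longrightarrow> X p r x \<in> gens"
  unfolding gens_def by blast

lemma gens_Y: "p \<noteq> 0 \<Longrightarrow> \<alpha> \<in> \<Delta> \<Longrightarrow> Y p \<alpha> \<in> gens"
  unfolding gens_def by blast

lemma inv_X:
  assumes "p \<noteq> 0" "r \<noteq> 0" "r \<noteq> - p"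
  shows "inv\<^bsub>G\<^esub> (X p r x) = X p r (- x)"
  using assms by (intro inv_G_eqI X_in_G) (simp_all add: X_add X_0)

lemma inv_Y:
  assumes "p \<noteq> 0" "\<alpha> \<in> \<Delta>"
  shows "inv\<^bsub>G\<^esub> (Y p \<alpha>) = Y p (inv\<^bsub>heis R\<^esub> \<alpha>)"
  using assms group.l_inv[OF group_heis, of \<alpha>]
  by (intro inv_G_eqI Y_in_G) (simp_all add: Y_hp Y_0)

lemma gens_cases:
  assumes "\<tau> \<in> gens"
  obtains (X) p r x where "\<tau> = X p r x" "p \<noteq> 0" "r \<noteq> 0" "r \<noteq> p" "r \<noteq> - p"
    | (Y) p \<alpha> where "\<tau> = Y p \<alpha>" "p \<noteq> 0" "\<alpha> \<in> \<Delta>"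
  using assms unfolding gens_def by blast

lemma gens_inv: "\<tau> \<in> gens \<Longrightarrow> inv\<^bsub>G\<^esub> \<tau> \<in> gens"
  by (erule gens_cases) (simp_all add: inv_X inv_Y gens_X gens_Y D.hinv_mem)

lemma gens_E:
  assumes "\<tau> \<in> gens"
  obtains e v z where "\<tau> = E e v z" "e $ 0 = 0" "q e = 0" "B e v = 0" "(v $ 0, q v + lm * z) \<in> \<Delta>"
  using assms
proof (cases rule: gens_cases)
  case (X p r x)
  then show ?thesis
    using D.zero_mem by (intro that[of "axis p 1" "axis r x" 0]) (auto simp: X_def axis_nth_if B_axis_axis)
next
  case (Y p \<alpha>)
  then show ?thesis
    using D.flip_mem[of "fst \<alpha>" "snd \<alpha>"] Delta_max
    by (intro that[of "axis p 1" "axis 0 (fst \<alpha>)" "br (snd \<alpha>)"])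
      (auto simp: Y_def axis_nth_if B_axis_axis h_axis_left mult.commute)
qed

lemma gens_G: "gens \<subseteq> carrier G"
  by (auto elim!: gens_cases intro: X_in_G Y_in_G)

lemma EU_subset_generate: "EU R \<Delta> \<subseteq> generate G gens"
  unfolding EU_def EU_ideal_def prod.case
proof (rule group.mono_generate[OF group_G], intro Un_least subsetI)
  fix \<tau> :: "('a, 'b) matrix"
  assume "\<tau> \<in> {T_short R i j x | i j x. i \<noteq> 0 \<and> j \<noteq> 0 \<and> i \<noteq> j \<and> i \<noteq> - j \<and> x \<in> UNIV}"
  then show "\<tau> \<in> gens"
    by (force simp: T_short_eq intro: gens_X)
next
  fix \<tau> :: "('a, 'b) matrix"
  assume "\<tau> \<in> {T_extra R i \<alpha> |i \<alpha>. i \<noteq> 0 \<and> \<alpha> \<in> sgn_param R (- eps i) \<Delta>}"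
  then show "\<tau> \<in> gens"
    using odd_form by (auto simp: T_extra_eq odd_form_parameter_def intro!: sgn_param_mem gens_Y)
qed

end

text \<open>The closure properties of an odd form ideal on which congruences modulo it rest.\<close>

locale odd_ideal = form_ring R \<Delta> for R :: "'a::comm_ring_1 hermitian" and \<Delta> +
  fixes J \<Sigma>
  assumes J: "ring_ideal J"
    and J_br: "x \<in> J \<Longrightarrow> br x \<in> J"
    and bullet_S: "bullet_submodule R \<Sigma>"
    and zz_S: "x \<in> J \<Longrightarrow> (0, zz x) \<in> \<Sigma>"
    and Delta_S: "\<alpha> \<in> \<Delta> \<Longrightarrow> a \<in> J \<Longrightarrow> \<alpha> \<odot> a \<in> \<Sigma>"
    and S_Delta: "\<Sigma> \<subseteq> \<Delta>"
    and S_tilde: "(x, y) \<in> \<Sigma> \<Longrightarrow> w \<in> Jd \<Longrightarrow> br w * mu R * x \<in> J"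
begin

sublocale S: bullet R \<Sigma>
  by unfold_locales (rule bullet_S)

lemmas J_rules = ideal_0[OF J] ideal_add[OF J] ideal_diff[OF J] ideal_neg[OF J]
  ideal_scale[OF J] ideal_scale2[OF J] J_br

definition jc (infix "\<approx>\<^sub>J" 50) where "x \<approx>\<^sub>J y \<longleftrightarrow> x - y \<in> J"

lemma jc_refl [simp]: "x \<approx>\<^sub>J x"
  by (simp add: jc_def J_rules)

lemma jc_trans: "x \<approx>\<^sub>J y \<Longrightarrow> y \<approx>\<^sub>J z \<Longrightarrow> x \<approx>\<^sub>J z"
  unfolding jc_def by (drule (1) J_rules(2)) simp

lemma jc_add: "x \<approx>\<^sub>J x' \<Longrightarrow> y \<approx>\<^sub>J y' \<Longrightarrow> x + y \<approx>\<^sub>J x' + y'"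
  unfolding jc_def by (drule (1) J_rules(2)) (simp add: algebra_simps)

lemma jc_diff: "x \<approx>\<^sub>J x' \<Longrightarrow> y \<approx>\<^sub>J y' \<Longrightarrow> x - y \<approx>\<^sub>J x' - y'"
  unfolding jc_def by (drule (1) J_rules(3)) (simp add: algebra_simps)

lemma jc_mult:
  assumes "x \<approx>\<^sub>J x'" "y \<approx>\<^sub>J y'"
  shows "x * y \<approx>\<^sub>J x' * y'"
proof -
  have "x * y - x' * y' = y * (x - x') + x' * (y - y')"
    by (simp add: algebra_simps)
  then show ?thesis
    using assms by (simp add: jc_def J_rules)
qed

lemma jc_br: "x \<approx>\<^sub>J y \<Longrightarrow> br x \<approx>\<^sub>J br y"
  unfolding jc_def by (drule J_br) simp

lemma jc_0: "x \<in> J \<Longrightarrow> x \<approx>\<^sub>J 0" "x \<in> J \<Longrightarrow> 0 \<approx>\<^sub>J x"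
  by (simp_all add: jc_def J_rules)

lemmas jc_rules = jc_add jc_diff jc_mult jc_br jc_refl

text \<open>Vectors that are small modulo the ideal. Testing by the form makes smallness invariant under isometries.\<close>

definition sv :: "'a ^ 'n::finite idx \<Rightarrow> bool" where
  "sv d \<longleftrightarrow> (\<forall>u. MD u \<longrightarrow> B u d \<in> J)"

lemma sv_B: "sv d \<Longrightarrow> MD u \<Longrightarrow> B u d \<in> J"
  by (simp add: sv_def)

lemma sv_B2: "sv d \<Longrightarrow> MD u \<Longrightarrow> B d u \<in> J"
  using sv_B[of d u] B_swap[of d u] by (simp add: J_rules)

lemma sv_nth:
  assumes "sv d" "i \<noteq> 0"
  shows "d $ i \<in> J"
proof -
  have "br (kap (- i)) * B (axis (- i) 1) d \<in> J"
    using assms by (intro J_rules sv_B) auto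
  then show ?thesis
    using assms by (simp add: B_axis_left)
qed

lemma h_J: "(\<And>i. i \<noteq> 0 \<Longrightarrow> d $ i \<in> J) \<Longrightarrow> h d u \<in> J" "(\<And>i. i \<noteq> 0 \<Longrightarrow> d $ i \<in> J) \<Longrightarrow> h u d \<in> J"
  unfolding h_def by (intro ideal_sum[OF J] J_rules; auto)+

lemma svI:
  assumes "\<And>i. i \<noteq> 0 \<Longrightarrow> d $ i \<in> J" "\<And>w. w \<in> Jd \<Longrightarrow> br w * mu R * d $ 0 \<in> J"
  shows "sv d"
  unfolding sv_def B_eq
  by (intro allI impI J_rules h_J assms) auto

lemma sv_add: "sv d \<Longrightarrow> sv d' \<Longrightarrow> sv (d + d')"
  and sv_diff: "sv d \<Longrightarrow> sv d' \<Longrightarrow> sv (d - d')"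
  and sv_scale: "sv d \<Longrightarrow> sv (c *s d)"
  by (simp_all add: sv_def J_rules)

lemma sv_minus: "sv d \<Longrightarrow> sv (- d)"
  by (simp add: sv_def J_rules)

lemma sv_sum: "(\<And>i. i \<in> A \<Longrightarrow> sv (f i)) \<Longrightarrow> sv (sum f A)"
  by (simp add: sv_def B_sum_right ideal_sum[OF J])

lemma sv_G:
  fixes \<sigma> :: "('a, 'n::finite) matrix"
  assumes "\<sigma> \<in> carrier G" "sv d"
  shows "sv (\<sigma> *v d)"
  using assms MD_G[OF inv_G(1)[OF assms(1)]] by (simp add: sv_def G_B_inv)

text \<open>The entries in row and column 0 are only controlled after multiplication by elements of \<open>J(\<Delta>)\<close>.\<close>

definition small :: "('a, 'n::finite) matrix \<Rightarrow> bool" where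
  "small C \<longleftrightarrow> (\<forall>u. MD u \<longrightarrow> sv (C *v u))"

lemma smallD: "small C \<Longrightarrow> MD u \<Longrightarrow> sv (C *v u)"
  by (simp add: small_def)

lemma small_columnsI:
  assumes "\<And>j. j \<noteq> 0 \<Longrightarrow> sv (column j C)" "\<And>y. y \<in> Jd \<Longrightarrow> sv (y *s column 0 C)"
  shows "small C"
  unfolding small_def
proof (intro allI impI)
  fix u :: "'a ^ 'b idx"
  assume u: "MD u"
  have "C *v u = (\<Sum>p\<in>UNIV. u $ p *s column p C)"
    by (simp add: vec_eq_iff matrix_vector_mult_def column_def mult.commute)
  also have "sv \<dots>"
    using assms u by (intro sv_sum) (metis sv_scale)
  finally show "sv (C *v u)" .
qed

lemma small_G:
  "small C \<Longrightarrow> \<sigma> \<in> carrier G \<Longrightarrow> small (C ** \<sigma>)"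
  "small C \<Longrightarrow> \<sigma> \<in> carrier G \<Longrightarrow> small (\<sigma> ** C)"
  by (simp_all add: small_def MD_G sv_G flip: matrix_vector_mul_assoc)

definition cg (infix "\<approx>" 50) where "\<alpha> \<approx> \<beta> \<longleftrightarrow> \<alpha> \<boxminus> \<beta> \<in> \<Sigma>"

lemma cg_refl [simp]: "\<alpha> \<approx> \<alpha>"
  using S.zero_mem by (cases \<alpha>) (simp add: cg_def hm_eq)

lemma cg_sym: "\<alpha> \<approx> \<beta> \<Longrightarrow> \<beta> \<approx> \<alpha>"
  unfolding cg_def by (drule S.hinv_mem) (simp only: hm_inv)

lemma cg_trans [trans]: "\<alpha> \<approx> \<beta> \<Longrightarrow> \<beta> \<approx> \<gamma> \<Longrightarrow> \<alpha> \<approx> \<gamma>"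
  unfolding cg_def by (drule (1) S.hp_mem) (simp only: hm_trans)

lemma cg_0: "\<alpha> \<approx> (0, 0) \<longleftrightarrow> \<alpha> \<in> \<Sigma>"
  by (cases \<alpha>) (simp add: cg_def hm_eq)

lemma cg_right: "\<alpha> \<boxplus> \<gamma> \<approx> \<beta> \<boxplus> \<gamma> \<longleftrightarrow> \<alpha> \<approx> \<beta>"
proof -
  have "(\<alpha> \<boxplus> \<gamma>) \<boxminus> (\<beta> \<boxplus> \<gamma>) = \<alpha> \<boxminus> \<beta>"
    by (cases \<alpha>; cases \<beta>; cases \<gamma>) (simp add: hp_eq hm_eq hinv_eq algebra_simps)
  then show ?thesis by (simp add: cg_def)
qed

lemma zz_cg: "t \<in> J \<Longrightarrow> (x, y + zz t) \<in> \<Sigma> \<longleftrightarrow> (x, y) \<in> \<Sigma>"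
  using S.hp_iff[OF zz_S, of t "(x, y)"] by (simp add: hp_eq)

text \<open>The Heisenberg group is not commutative, but the commutator of \<open>\<gamma>\<close> with an element \<open>(x, y)\<close> of \<open>\<Sigma>\<close> is
  \<open>(0, zz t)\<close> with \<open>t = br (fst \<gamma>) * mu R * x\<close>, which lies in \<open>J\<close>.\<close>

lemma cg_left:
  assumes "fst \<gamma> \<in> Jd"
  shows "\<gamma> \<boxplus> \<alpha> \<approx> \<gamma> \<boxplus> \<beta> \<longleftrightarrow> \<alpha> \<approx> \<beta>"
proof -
  obtain x y where xy: "\<alpha> \<boxminus> \<beta> = (x, y)"
    by (cases "\<alpha> \<boxminus> \<beta>")
  define t where "t = br (fst \<gamma>) * mu R * x"
  have x: "x = fst \<alpha> - fst \<beta>"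
    using xy by (cases \<alpha>; cases \<beta>) (simp add: hm_eq)
  have e: "(\<gamma> \<boxplus> \<alpha>) \<boxminus> (\<gamma> \<boxplus> \<beta>) = (x, y - zz t)"
    using xy by (cases \<alpha>; cases \<beta>; cases \<gamma>)
      (auto simp: hp_eq hm_eq t_def zz_def br_mu lm_lmi_far algebra_simps)
  show ?thesis
  proof
    assume "\<gamma> \<boxplus> \<alpha> \<approx> \<gamma> \<boxplus> \<beta>"
    then have m: "(x, y - zz t) \<in> \<Sigma>"
      by (simp only: cg_def e)
    then have "t \<in> J"
      unfolding t_def using assms S_tilde by blast
    then show "\<alpha> \<approx> \<beta>"
      using zz_cg[of t x "y - zz t"] m by (simp only: cg_def xy) simp
  next
    assume "\<alpha> \<approx> \<beta>"
    then have m: "(x, y) \<in> \<Sigma>"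
      by (simp only: cg_def xy)
    then have "t \<in> J"
      unfolding t_def using assms S_tilde by blast
    then show "\<gamma> \<boxplus> \<alpha> \<approx> \<gamma> \<boxplus> \<beta>"
      using zz_cg[of t x "y - zz t"] m by (simp only: cg_def e) simp
  qed
qed

lemma cg_hp: "\<alpha> \<approx> \<alpha>' \<Longrightarrow> \<beta> \<approx> \<beta>' \<Longrightarrow> fst \<alpha> \<in> Jd \<Longrightarrow> \<alpha> \<boxplus> \<beta> \<approx> \<alpha>' \<boxplus> \<beta>'"
  using cg_left cg_right cg_trans by blast

lemma cg_zz:
  assumes "t - t' \<in> J"
  shows "\<alpha> \<boxplus> (0, z + zz t) \<approx> \<alpha> \<boxplus> (0, z + zz t')"
proof -
  have "(\<alpha> \<boxplus> (0, z + zz t)) \<boxminus> (\<alpha> \<boxplus> (0, z + zz t')) = (0, zz (t - t'))"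
    by (cases \<alpha>) (simp add: hp_eq hm_eq zz_simps)
  then show ?thesis
    using zz_S[OF assms] by (simp add: cg_def)
qed

lemma cg_ci_add:
  assumes "\<nu> \<in> \<Delta>" "j \<in> J"
  shows "\<nu> \<odot> (a + j) \<approx> \<nu> \<odot> a"
proof -
  obtain x y where \<nu>: "\<nu> = (x, y)"
    by (cases \<nu>)
  have "\<nu> \<odot> (a + j) = \<nu> \<odot> j \<boxplus> \<nu> \<odot> a \<boxplus> (0, zz (br a * y * j))"
    using ci_add[of x y j a] Delta_max assms(1) by (auto simp: \<nu> add.commute)
  also have "\<dots> \<approx> \<nu> \<odot> j \<boxplus> \<nu> \<odot> a"
    using cg_zz[of "br a * y * j" 0 "\<nu> \<odot> j \<boxplus> \<nu> \<odot> a" 0] assms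
    by (cases "\<nu> \<odot> j \<boxplus> \<nu> \<odot> a") (simp add: J_rules zz_simps hp_eq)
  also have "\<dots> \<approx> (0, 0) \<boxplus> \<nu> \<odot> a"
    using Delta_S[OF assms] by (simp only: cg_right cg_0)
  finally show ?thesis
    by (cases "\<nu> \<odot> a") (simp add: hp_eq)
qed

abbreviation V :: "('a, 'n::finite) matrix set" where "V \<equiv> U_ideal R \<Delta> (J, \<Sigma>)"

text \<open>The definition of the congruence subgroup restricts only the hyperbolic entries and \<open>Q\<close>. The condition on
  \<open>Q\<close> bounds the row 0 of \<open>\<tau> - 1\<close>, and invariance of \<open>B\<close> then bounds its column 0.\<close>

lemma V_small:
  fixes \<tau> :: "('a, 'n::finite) matrix"
  assumes "\<tau> \<in> V"
  shows "small (\<tau> - mat 1)"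
proof -
  have G: "\<tau> \<in> carrier G" and hb: "\<And>i j. i \<noteq> 0 \<Longrightarrow> j \<noteq> 0 \<Longrightarrow> \<tau> $ i $ j - mat 1 $ i $ j \<in> J"
    and Q: "\<And>u. MD u \<Longrightarrow> Q (\<tau> *v u) \<approx> Q u"
    using assms by (auto simp: U_ideal_def cg_def)
  have d0: "br w * mu R * (\<tau> *v u - u) $ 0 \<in> J" if "MD u" "w \<in> Jd" for u w
    using Q[OF that(1)] S_tilde[OF _ that(2)] by (auto simp: cg_def Q_eq hm_eq)
  have f: "sv (\<tau> *v axis j 1 - axis j 1)" if j: "j \<noteq> 0" for j
  proof (rule svI)
    show "(\<tau> *v axis j 1 - axis j 1) $ i \<in> J" if "i \<noteq> 0" for i
      using hb[OF that j] by (simp add: mult_axis_nth axis_nth_if mat_def split: if_splits)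
  qed (use d0 j in auto)
  show ?thesis
    unfolding small_def
  proof (intro allI impI)
    fix u :: "'a ^ 'n idx"
    assume u: "MD u"
    show "sv ((\<tau> - mat 1) *v u)"
    proof (rule svI)
      fix i :: "'n idx"
      assume i: "i \<noteq> 0"
      have "kap (- i) * (\<tau> *v u - u) $ i = B (axis (- i) 1) (\<tau> *v u) - B (axis (- i) 1) u"
        using i by (simp add: B_axis_left algebra_simps)
      also have "\<dots> = - B (\<tau> *v axis (- i) 1 - axis (- i) 1) (\<tau> *v u)"
        using G_isom[OF G] by simp
      also have "\<dots> \<in> J"
        using i u G by (intro J_rules sv_B2 f MD_G) auto
      finally have "br (kap (- i)) * (kap (- i) * (\<tau> *v u - u) $ i) \<in> J"
        by (rule J_rules)
      then show "((\<tau> - mat 1) *v u) $ i \<in> J"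
        by (simp add: matrix_vector_mult_diff_rdistrib)
    qed (use d0 u in \<open>simp add: matrix_vector_mult_diff_rdistrib\<close>)
  qed
qed

lemma V_iff: "\<tau> \<in> V \<longleftrightarrow> \<tau> \<in> carrier G \<and> small (\<tau> - mat 1) \<and> (\<forall>u. MD u \<longrightarrow> Q (\<tau> *v u) \<approx> Q u)"
proof
  assume "\<tau> \<in> V"
  then show "\<tau> \<in> carrier G \<and> small (\<tau> - mat 1) \<and> (\<forall>u. MD u \<longrightarrow> Q (\<tau> *v u) \<approx> Q u)"
    using V_small by (auto simp: U_ideal_def cg_def)
next
  assume a: "\<tau> \<in> carrier G \<and> small (\<tau> - mat 1) \<and> (\<forall>u. MD u \<longrightarrow> Q (\<tau> *v u) \<approx> Q u)"
  have "\<tau> $ i $ j - mat 1 $ i $ j \<in> J" if "i \<noteq> 0" "j \<noteq> 0" for i j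
    using sv_nth[OF smallD, of "\<tau> - mat 1" "axis j 1" i] a that by (simp add: mult_axis_nth)
  with a show "\<tau> \<in> V"
    by (simp add: U_ideal_def cg_def)
qed

lemma subgroup_V: "subgroup (V :: ('a, 'n::finite) matrix set) G"
proof (rule subgroup.intro)
  show "V \<subseteq> carrier (G :: ('a, 'n) matrix monoid)"
    by (auto simp: V_iff)
  show "\<one>\<^bsub>G\<^esub> \<in> (V :: ('a, 'n) matrix set)"
    using group.is_monoid[OF group_G, THEN monoid.one_closed]
    by (simp add: V_iff small_def sv_def J_rules)
next
  fix \<sigma> \<tau> :: "('a, 'n) matrix"
  assume st: "\<sigma> \<in> V" "\<tau> \<in> V"
  then have G: "\<sigma> \<in> carrier G" "\<tau> \<in> carrier G"
    by (simp_all add: V_iff)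
  have "(\<sigma> ** \<tau> - mat 1) *v u = ((\<sigma> - mat 1) *v (\<tau> *v u)) + (\<tau> - mat 1) *v u" for u
    by (simp add: matrix_vector_mult_diff_rdistrib flip: matrix_vector_mul_assoc)
  then have "small (\<sigma> ** \<tau> - mat 1)"
    using st G unfolding small_def by (auto simp: V_iff MD_G intro!: sv_add smallD)
  moreover have "Q (\<sigma> *v (\<tau> *v u)) \<approx> Q u" if "MD u" for u
    using st G that MD_G cg_trans unfolding V_iff by blast
  ultimately show "\<sigma> \<otimes>\<^bsub>G\<^esub> \<tau> \<in> V"
    using monoid.m_closed[OF group.is_monoid[OF group_G] G]
    by (simp add: V_iff flip: matrix_vector_mul_assoc)
next
  fix \<sigma> :: "('a, 'n) matrix"
  assume s: "\<sigma> \<in> V"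
  then have G: "\<sigma> \<in> carrier G"
    by (simp add: V_iff)
  note G' = inv_G[OF G]
  have e: "(inv\<^bsub>G\<^esub> \<sigma> - mat 1) *v u = - (inv\<^bsub>G\<^esub> \<sigma> *v ((\<sigma> - mat 1) *v u))" for u
    by (simp add: matrix_vector_mult_diff_rdistrib matrix_vector_mult_diff_distrib inv_G_apply[OF G])
  have "small (inv\<^bsub>G\<^esub> \<sigma> - mat 1)"
    unfolding small_def e using G' by (intro allI impI sv_minus sv_G smallD V_small s) auto
  moreover have "Q (inv\<^bsub>G\<^esub> \<sigma> *v u) \<approx> Q u" if u: "MD u" for u
  proof -
    have "Q (\<sigma> *v (inv\<^bsub>G\<^esub> \<sigma> *v u)) \<approx> Q (inv\<^bsub>G\<^esub> \<sigma> *v u)"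
      using s MD_G[OF G'(1) u] by (simp add: V_iff)
    then show ?thesis
      by (simp add: inv_G_apply[OF G] cg_sym)
  qed
  ultimately show "inv\<^bsub>G\<^esub> \<sigma> \<in> V"
    using G' by (simp add: V_iff)
qed

text \<open>The condition under which a unitary matrix conjugates the congruence subgroup into itself.\<close>

definition Npres :: "('a, 'n::finite) matrix \<Rightarrow> bool" where
  "Npres \<sigma> \<longleftrightarrow> (\<forall>w z. (\<forall>i. i \<noteq> 0 \<longrightarrow> w $ i \<in> J) \<longrightarrow> (w $ 0, z) \<in> \<Sigma> \<longrightarrow> Q (\<sigma> *v w) \<approx> Q w)"

lemma hp_assoc: "\<alpha> \<boxplus> \<beta> \<boxplus> \<gamma> = \<alpha> \<boxplus> (\<beta> \<boxplus> \<gamma>)"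
  by (cases \<alpha>; cases \<beta>; cases \<gamma>) (simp add: hp_eq algebra_simps)

text \<open>Write \<open>\<tau> v = v + w\<close>. That \<open>\<tau>\<close> preserves \<open>Q\<close> modulo \<open>\<Sigma>\<close> means that \<open>Q w\<close> and \<open>(0, B v w)\<close> cancel up
  to an element \<open>(0, zz t)\<close>, and this is inherited by \<open>\<sigma> v\<close> and \<open>\<sigma> w\<close> as soon as \<open>Q (\<sigma> w) \<approx> Q w\<close>.\<close>

lemma V_conj:
  fixes \<sigma> :: "('a, 'n::finite) matrix"
  assumes G: "\<sigma> \<in> carrier G" and N: "Npres \<sigma>" and t: "\<tau> \<in> V"
  shows "\<sigma> ** \<tau> ** inv\<^bsub>G\<^esub> \<sigma> \<in> V"
proof -
  note G' = inv_G[OF G]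
  have tG: "\<tau> \<in> carrier G"
    using t by (simp add: V_iff)
  have "\<sigma> ** (\<tau> - mat 1) ** inv\<^bsub>G\<^esub> \<sigma> = \<sigma> ** \<tau> ** inv\<^bsub>G\<^esub> \<sigma> - mat 1"
    by (rule matrix_eqI) (simp add: matrix_vector_mult_diff_rdistrib matrix_vector_mult_diff_distrib
        inv_G_apply[OF G] flip: matrix_vector_mul_assoc)
  then have "small (\<sigma> ** \<tau> ** inv\<^bsub>G\<^esub> \<sigma> - mat 1)"
    using small_G G G' V_small[OF t] by metis
  moreover have "Q (\<sigma> *v (\<tau> *v (inv\<^bsub>G\<^esub> \<sigma> *v u))) \<approx> Q u" if u: "MD u" for u
  proof -
    define v where "v = inv\<^bsub>G\<^esub> \<sigma> *v u"
    define w where "w = \<tau> *v v - v"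
    have v: "MD v" "\<sigma> *v v = u"
      using MD_G[OF G'(1) u] by (simp_all add: v_def inv_G_apply[OF G])
    have w: "sv w"
      using smallD[OF V_small[OF t] v(1)] by (simp add: w_def matrix_vector_mult_diff_rdistrib)
    have "Q v \<boxplus> (Q w \<boxplus> (0, B v w + zz (h w v))) = Q (v + w)"
      by (simp only: Q_add hp_assoc)
    also have "\<dots> \<approx> Q v \<boxplus> (0, 0)"
      using t v by (simp add: V_iff w_def Q_eq hp_eq)
    finally have "Q w \<boxplus> (0, B v w + zz (h w v)) \<in> \<Sigma>"
      using v(1) by (subst (asm) cg_left) (simp_all add: cg_0 Q_eq)
    then have s: "(w $ 0, q w + B v w) \<in> \<Sigma>"
      using zz_cg[OF h_J(1)[of w v]] sv_nth[OF w] by (simp add: Q_eq hp_eq flip: add.assoc)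
    have "Q (\<sigma> *v w) \<approx> Q w"
      using N s sv_nth[OF w] by (auto simp: Npres_def)
    then have "Q (\<sigma> *v w) \<boxplus> (0, B v w) \<approx> Q w \<boxplus> (0, B v w)"
      by (simp only: cg_right)
    also have "\<dots> \<approx> (0, 0)"
      using s by (simp add: cg_0 Q_eq hp_eq)
    finally have s': "((\<sigma> *v w) $ 0, q (\<sigma> *v w) + B v w) \<in> \<Sigma>"
      by (simp add: cg_0 Q_eq hp_eq)
    have "Q (\<sigma> *v (v + w)) = Q u \<boxplus> (Q (\<sigma> *v w) \<boxplus> (0, B v w + zz (h (\<sigma> *v w) u)))"
      by (simp only: matrix_vector_right_distrib v(2) Q_add hp_assoc G_isom[OF G, of v w, unfolded v(2)])
    also have "\<dots> \<approx> Q u \<boxplus> (0, 0)"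
      using u s' zz_cg[OF h_J(1)[of "\<sigma> *v w" u]] sv_nth[OF sv_G[OF G w]]
      by (subst cg_left) (simp_all add: cg_0 Q_eq hp_eq add.assoc[symmetric])
    finally show ?thesis
      by (simp add: w_def v_def[symmetric] Q_eq hp_eq)
  qed
  ultimately show ?thesis
    using monoid.m_closed[OF group.is_monoid[OF group_G] monoid.m_closed[OF group.is_monoid[OF group_G] G tG] G'(1)]
    by (simp add: V_iff flip: matrix_vector_mul_assoc)
qed

text \<open>By \<open>Q_E\<close> the change of \<open>Q\<close> is a multiple of \<open>B e w\<close>, which lies in \<open>J\<close>.\<close>

lemma gens_Npres:
  fixes \<tau> :: "('a, 'n::finite) matrix"
  assumes "\<tau> \<in> gens"
  shows "Npres \<tau>"
  unfolding Npres_def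
proof (intro allI impI)
  fix w :: "'a ^ 'n idx" and z
  assume w: "\<forall>i. i \<noteq> 0 \<longrightarrow> w $ i \<in> J" and wz: "(w $ 0, z) \<in> \<Sigma>"
  obtain e v x where t: "\<tau> = E e v x" "e $ 0 = 0" "q e = 0" "B e v = 0" "(v $ 0, q v + lm * x) \<in> \<Delta>"
    using gens_E[OF assms] by blast
  have sw: "sv w"
    using w S_tilde[OF wz] by (intro svI) auto
  have \<beta>: "B e w \<in> J"
    using sw t(2) by (intro sv_B) (auto simp: ideal_0[OF ring_ideal_Jd])
  have vw: "B v w \<in> J"
    using sw Jd_I[OF t(5)] by (intro sv_B)
  have t0: "h (E e v x *v w - w) w + br (B e w) * (x * B e w - lmi * B v w) * h v e
      - br (B e w) * B v w - 0 \<in> J"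
    unfolding diff_zero using \<beta> vw w by (intro J_rules h_J(2)) auto
  have "Q (\<tau> *v w) \<approx> Q w \<boxplus> (v $ 0, q v + lm * x) \<odot> B e w \<boxplus> (0, 0)"
    unfolding t(1) Q_E[OF t(2-4)] using cg_zz[OF t0, of _ 0] by (simp only: zz_simps(5) add_0_left)
  also have "\<dots> \<approx> Q w \<boxplus> (0, 0) \<boxplus> (0, 0)"
    unfolding cg_right using wz S_Delta Delta_S[OF t(5) \<beta>]
    by (subst cg_left) (auto simp: cg_0 Q_eq intro: Jd_I)
  finally show "Q (\<tau> *v w) \<approx> Q w"
    by (simp add: Q_eq hp_eq)
qed

end


text \<open>A unitary matrix that is a scalar \<open>c\<close> modulo \<open>J\<close>, and whose columns satisfy the
  corresponding conditions modulo \<open>\<Sigma>\<close>.\<close>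

locale central_mod = odd_ideal R \<Delta> J \<Sigma> for R :: "'a::comm_ring_1 hermitian" and \<Delta> J \<Sigma> +
  fixes \<sigma> :: "('a, 'n::finite) matrix" and c :: 'a
  assumes s_G: "\<sigma> \<in> carrier G"
    and s_sv: "MD u \<Longrightarrow> sv (\<sigma> *v u - c *s u)"
    and Z1: "j \<noteq> 0 \<Longrightarrow> Q (\<sigma> *v axis j 1) \<in> \<Sigma>"
    and Z2: "(y, z) \<in> \<Delta> \<Longrightarrow> ((Q (\<sigma> *v axis 0 1) \<boxminus> (1, 0)) \<odot> y \<boxplus> (y, z)) \<boxminus> (y, z) \<odot> c \<in> \<Sigma>"
begin

lemma s_B: "MD u \<Longrightarrow> MD w \<Longrightarrow> B u (\<sigma> *v w) \<approx>\<^sub>J c * B u w"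
  using sv_B[OF s_sv, of w u] by (simp add: jc_def)

text \<open>Evaluate \<open>B\<close> on the images of a hyperbolic pair, which are \<open>c\<close> times the pair modulo \<open>J\<close>.\<close>

lemma cc: "br c * c \<approx>\<^sub>J 1"
proof -
  define j :: "'n idx" where "j = Plus undefined"
  have j: "j \<noteq> 0" by (simp add: j_def)
  define d where "d = \<sigma> *v axis j 1 - c *s axis j 1"
  have d: "sv d" "\<sigma> *v axis j 1 = c *s axis j 1 + d"
    using s_sv[of "axis j 1"] j by (simp_all add: d_def)
  have "kap j = B (\<sigma> *v axis j 1) (\<sigma> *v axis (- j) 1)"
    using j by (simp add: G_isom[OF s_G] B_axis_axis)
  also have "\<dots> = br c * B (axis j 1) (\<sigma> *v axis (- j) 1) + B d (\<sigma> *v axis (- j) 1)"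
    by (simp add: d(2))
  also have "\<dots> \<approx>\<^sub>J br c * (c * B (axis j 1) (axis (- j) 1)) + 0"
    using j d by (intro jc_rules s_B jc_0 sv_B2 MD_G s_G) auto
  finally have "br (kap j) * kap j \<approx>\<^sub>J br (kap j) * (br c * c * kap j)"
    using j by (intro jc_rules) (simp add: B_axis_axis mult.assoc)
  then have "1 \<approx>\<^sub>J br c * c * (br (kap j) * kap j)"
    by (simp add: mult_ac)
  then show ?thesis
    using J_rules(4)[of "1 - br c * c"] by (simp add: jc_def)
qed

lemma s_h: 
  assumes "MD u" "MD v"
  shows "h (\<sigma> *v u) (\<sigma> *v v) \<approx>\<^sub>J h u v"
proof -
  have *: "sv (\<sigma> *v u - c *s u)" "sv (\<sigma> *v v - c *s v)"
    using s_sv assms by auto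
  have "h (\<sigma> *v u) (\<sigma> *v v) = h (c *s u) (c *s v) + h (c *s u) (\<sigma> *v v - c *s v)
      + h (\<sigma> *v u - c *s u) (\<sigma> *v v)"
    by (simp add: algebra_simps)
  also have "\<dots> \<approx>\<^sub>J h (c *s u) (c *s v) + 0 + 0"
    using sv_nth[OF *(1)] sv_nth[OF *(2)] by (intro jc_rules jc_0 h_J) auto
  also have "h (c *s u) (c *s v) + 0 + 0 = br c * c * h u v"
    by simp
  finally show ?thesis
    using jc_mult[OF cc jc_refl, of "h u v"] jc_trans by simp
qed

lemma s_Q_hb:
  assumes "finite A" "0 \<notin> A"
  shows "Q (\<sigma> *v (\<Sum>j\<in>A. axis j (w $ j))) \<approx> (0, q (\<Sum>j\<in>A. axis j (w $ j)))"
  using assms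
proof (induction A rule: finite_induct)
  case empty
  show ?case by (simp add: Q_eq)
next
  case (insert j A)
  define u where "u = (\<Sum>j\<in>A. axis j (w $ j))"
  define v where "v = axis j (w $ j)"
  have j: "j \<noteq> 0" and A: "0 \<notin> A"
    using insert.prems by auto
  have u0: "u $ 0 = 0"
    using A by (auto simp: u_def axis_nth_if intro!: sum.neutral)
  have MDs: "MD u" "MD v"
    using j by (simp_all add: u0 v_def ideal_0[OF ring_ideal_Jd])
  have qB: "q (u + v) = q u + B u v + zz (h v u)"
  proof -
    have "q v = 0"
      using j by (simp add: v_def)
    then show ?thesis
      by (simp add: B_eq u0 zz_def)
  qed
  have "Q (\<sigma> *v v) = Q (\<sigma> *v axis j 1) \<odot> (w $ j)"
    by (simp add: v_def flip: Q_scale mult_vec_scale) (simp add: axis_scale)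
  then have v: "Q (\<sigma> *v v) \<approx> (0, 0)"
    using Z1[OF j] S.ci_mem by (simp add: cg_0)
  have u: "Q (\<sigma> *v u) \<approx> (0, q u)"
    using insert.IH A by (simp add: u_def)
  have "Q (\<sigma> *v (u + v)) = Q (\<sigma> *v u) \<boxplus> Q (\<sigma> *v v) \<boxplus> (0, B u v + zz (h (\<sigma> *v v) (\<sigma> *v u)))"
    by (simp only: matrix_vector_right_distrib Q_add G_isom[OF s_G])
  also have "\<dots> \<approx> Q (\<sigma> *v u) \<boxplus> Q (\<sigma> *v v) \<boxplus> (0, B u v + zz (h v u))"
    using s_h[of v u] MDs by (intro cg_zz) (simp add: jc_def)
  also have "\<dots> \<approx> (0, q u) \<boxplus> (0, 0) \<boxplus> (0, B u v + zz (h v u))"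
    unfolding cg_right using MDs MD_G[OF s_G] by (intro cg_hp u v) (simp add: Q_eq)
  also have "\<dots> = (0, q (u + v))"
    unfolding qB by (simp add: hp_eq)
  finally show ?case
    using insert.hyps by (simp add: u_def v_def add.commute)
qed

text \<open>The hyperbolic part of \<open>w\<close> contributes as if \<open>\<sigma>\<close> were the identity, since the columns satisfy
  \<open>Q (\<sigma> e\<^sub>j) \<approx> 0\<close> and \<open>h\<close> is multiplied by the norm of \<open>c\<close>; the middle coordinate is scaled by \<open>c\<close>.\<close>

lemma s_Q:
  assumes u: "(w $ 0, z) \<in> \<Delta>"
  shows "Q (\<sigma> *v w) \<approx> (w $ 0, z) \<odot> c \<boxplus> (0, q w - z)"
proof -
  define y where "y = w $ 0"
  define u where "u = (\<Sum>j\<in>-{0}. axis j (w $ j))"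
  have w: "w = axis 0 y + u"
    unfolding u_def y_def by (subst sum_axis[symmetric], subst sum.remove[of _ 0]) (auto simp: Compl_eq_Diff_UNIV)
  have u0: "u $ 0 = 0"
    by (auto simp: u_def axis_nth_if intro!: sum.neutral)
  have MDs: "MD u" "MD (axis 0 y)"
    using assms by (auto simp: u0 ideal_0[OF ring_ideal_Jd] y_def intro: Jd_I)
  have qw: "q w = q u"
    by (simp add: w h_axis_left h_axis_right)
  have "Q (\<sigma> *v axis 0 y) = Q (\<sigma> *v axis 0 1) \<odot> y"
    by (simp flip: Q_scale mult_vec_scale) (simp add: axis_scale)
  moreover have "(Q (\<sigma> *v axis 0 1) \<boxminus> (1, 0)) \<odot> y \<boxplus> (y, z) = Q (\<sigma> *v axis 0 1) \<odot> y \<boxplus> (0, z)"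
    by (cases "Q (\<sigma> *v axis 0 1)") (simp add: hp_eq hm_eq ci_eq algebra_simps)
  ultimately have "Q (\<sigma> *v axis 0 y) \<boxplus> (0, z) \<approx> (y, z) \<odot> c"
    using Z2[OF u] by (simp add: cg_def y_def)
  then have "Q (\<sigma> *v axis 0 y) \<boxplus> (0, z) \<boxplus> (0, - z) \<approx> (y, z) \<odot> c \<boxplus> (0, - z)"
    by (simp only: cg_right)
  then have 1: "Q (\<sigma> *v axis 0 y) \<approx> (y, z) \<odot> c \<boxplus> (0, - z)"
    by (simp add: Q_eq hp_eq)
  have 2: "Q (\<sigma> *v u) \<approx> (0, q u)"
    unfolding u_def by (rule s_Q_hb) auto
  have "Q (\<sigma> *v w) = Q (\<sigma> *v axis 0 y) \<boxplus> Q (\<sigma> *v u)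
      \<boxplus> (0, B (axis 0 y) u + zz (h (\<sigma> *v u) (\<sigma> *v axis 0 y)))"
    by (simp only: w matrix_vector_right_distrib Q_add G_isom[OF s_G])
  also have "\<dots> \<approx> Q (\<sigma> *v axis 0 y) \<boxplus> Q (\<sigma> *v u) \<boxplus> (0, B (axis 0 y) u + zz (h u (axis 0 y)))"
    using s_h[of u "axis 0 y"] MDs by (intro cg_zz) (simp add: jc_def)
  also have "\<dots> \<approx> (y, z) \<odot> c \<boxplus> (0, - z) \<boxplus> (0, q u) \<boxplus> (0, B (axis 0 y) u + zz (h u (axis 0 y)))"
    unfolding cg_right using MDs MD_G[OF s_G] by (intro cg_hp 1 2) (simp add: Q_eq)
  also have "\<dots> = (y, z) \<odot> c \<boxplus> (0, q w - z)"
    by (simp add: hp_eq ci_eq B_axis0_left u0 h_axis_right zz_simps qw)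
  finally show ?thesis
    by (simp add: y_def)
qed

lemma s_Npres: "Npres \<sigma>"
  unfolding Npres_def
proof (intro allI impI)
  fix w :: "'a ^ 'n idx" and z
  assume z: "(w $ 0, z) \<in> \<Sigma>"
  have "Q (\<sigma> *v w) \<approx> (w $ 0, z) \<odot> c \<boxplus> (0, q w - z)"
    using z S_Delta by (intro s_Q) auto
  also have "\<dots> \<approx> (0, 0) \<boxplus> (0, q w - z)"
    using S.ci_mem[OF z] by (simp only: cg_right cg_0)
  also have "\<dots> \<approx> (w $ 0, z) \<boxplus> (0, q w - z)"
    using z by (simp only: cg_right) (simp only: cg_0 cg_sym)
  also have "\<dots> = Q w"
    by (simp add: hp_eq Q_eq)
  finally show "Q (\<sigma> *v w) \<approx> Q w" .
qed

text \<open>For the entries it suffices that \<open>\<sigma> - c\<close> is small. For \<open>Q\<close> one compares \<open>Q (\<sigma> (\<tau> w))\<close>, computed by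
  \<open>s_Q\<close>, with \<open>Q (\<tau> (\<sigma> w))\<close>, computed by \<open>Q_E\<close>: the two displacements agree modulo \<open>\<Sigma>\<close>, as \<open>\<sigma>\<close> acts
  on their ingredients as the scalar \<open>c\<close> of norm 1.\<close>

lemma s_commutator_gens:
  assumes "\<tau> \<in> gens"
  shows "commutator G \<sigma> \<tau> \<in> V"
proof -
  obtain e v x where t: "\<tau> = E e v x" "e $ 0 = 0" "q e = 0" "B e v = 0" "(v $ 0, q v + lm * x) \<in> \<Delta>"
    using gens_E[OF assms] by blast
  have tG: "\<tau> \<in> carrier G"
    using assms gens_G by auto
  note sG' = inv_G(1)[OF s_G] and tG' = inv_G(1)[OF tG]
  interpret G: group "G :: ('a, 'n) matrix monoid"
    by (rule group_G)
  define g where "g = commutator G \<sigma> \<tau>"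
  have gG: "g \<in> carrier G"
    unfolding g_def commutator_def by (intro G.m_closed sG' tG' s_G tG)
  have g: "g *v (\<tau> *v (\<sigma> *v w)) = \<sigma> *v (\<tau> *v w)" for w
    by (simp add: g_def commutator_def inv_G_apply[OF s_G] inv_G_apply[OF tG] flip: matrix_vector_mul_assoc)
  have w: "\<exists>w. u = \<tau> *v (\<sigma> *v w) \<and> MD w" if "MD u" for u
    by (rule exI[of _ "inv\<^bsub>G\<^esub> \<sigma> *v (inv\<^bsub>G\<^esub> \<tau> *v u)"])
      (simp add: inv_G_apply[OF s_G] inv_G_apply[OF tG] that MD_G[OF sG'] MD_G[OF tG'])
  have MDe: "MD e" "MD v"
    using t Jd_I ideal_0[OF ring_ideal_Jd] by auto
  have "small (g - mat 1)"
    unfolding small_def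
  proof (intro allI impI)
    fix u :: "'a ^ 'n idx"
    assume "MD u"
    from w[OF this] obtain w where w: "u = \<tau> *v (\<sigma> *v w)" "MD w" by blast
    have "(g - mat 1) *v u = (\<sigma> *v (\<tau> *v w) - c *s (\<tau> *v w)) - \<tau> *v (\<sigma> *v w - c *s w)"
      by (simp add: matrix_vector_mult_diff_rdistrib w(1) g matrix_vector_mult_diff_distrib mult_vec_scale)
    then show "sv ((g - mat 1) *v u)"
      using w tG by (simp add: sv_diff s_sv sv_G MD_G)
  qed
  moreover have "Q (g *v u) \<approx> Q u" if "MD u" for u
  proof -
    from w[OF that] obtain w where w: "u = \<tau> *v (\<sigma> *v w)" "MD w" by blast
    obtain z where z: "(w $ 0, z) \<in> \<Delta>"
      using w by (auto simp: J_of_def)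
    define \<nu> where "\<nu> = (v $ 0, q v + lm * x)"
    have nu: "\<nu> \<in> \<Delta>" using t by (simp add: \<nu>_def)
    define T where "T y = h (E e v x *v y - y) y
          + br (B e y) * (x * B e y - lmi * B v y) * h v e - br (B e y) * B v y" for y
    have Q_tau: "Q (\<tau> *v y) = Q y \<boxplus> \<nu> \<odot> B e y \<boxplus> (0, zz (T y))" for y
      unfolding t(1) T_def \<nu>_def by (rule Q_E[OF t(2-4)])
    have T_s: "T (\<sigma> *v w) \<approx>\<^sub>J T w"
    proof -
      have \<beta>: "B e (\<sigma> *v w) \<approx>\<^sub>J c * B e w" and \<gamma>: "B v (\<sigma> *v w) \<approx>\<^sub>J c * B v w"
        using s_B MDe w by auto
      have hv: "h y (\<sigma> *v w) \<approx>\<^sub>J c * h y w" for y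
        using h_J(2)[OF sv_nth[OF s_sv[OF w(2)]], of y] by (simp add: jc_def)
      have E: "E e v x *v y - y = B e y *s v + (x * B e y - lmi * B v y) *s e" for y
        by (simp add: E_apply vec_eq_iff algebra_simps)
      have T: "T y = br (B e y) * h v y + br (x * B e y - lmi * B v y) * h e y
          + br (B e y) * (x * B e y - lmi * B v y) * h v e - br (B e y) * B v y" for y
        unfolding T_def E by simp
      have "T (\<sigma> *v w) \<approx>\<^sub>J br (c * B e w) * (c * h v w)
          + br (x * (c * B e w) - lmi * (c * B v w)) * (c * h e w)
          + br (c * B e w) * (x * (c * B e w) - lmi * (c * B v w)) * h v e - br (c * B e w) * (c * B v w)"
        unfolding T by (intro jc_rules \<beta> \<gamma> hv)
      also have "\<dots> = br c * c * T w"
        unfolding T by (simp add: algebra_simps)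
      finally show ?thesis
        using jc_mult[OF cc jc_refl, of "T w"] jc_trans by simp
    qed
    have q\<tau>: "q (\<tau> *v w) - snd ((w $ 0, z) \<boxplus> \<nu> \<odot> B e w) = q w - z + zz (T w)"
      using arg_cong[OF Q_tau[of w], of snd] by (simp add: Q_eq hp_eq \<nu>_def ci_eq)
    have fst: "(\<tau> *v w) $ 0 = fst ((w $ 0, z) \<boxplus> \<nu> \<odot> B e w)"
      using arg_cong[OF Q_tau[of w], of fst] by (simp add: Q_eq hp_eq \<nu>_def ci_eq)
    have "Q (\<sigma> *v (\<tau> *v w)) \<approx> ((w $ 0, z) \<boxplus> \<nu> \<odot> B e w) \<odot> c \<boxplus> (0, q w - z + zz (T w))"
      using s_Q[of "\<tau> *v w" "snd ((w $ 0, z) \<boxplus> \<nu> \<odot> B e w)"] D.hp_mem[OF z D.ci_mem[OF nu]]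
      by (simp only: fst prod.collapse q\<tau> simp_thms)
    also have "\<dots> = (w $ 0, z) \<odot> c \<boxplus> (0, q w - z) \<boxplus> \<nu> \<odot> (c * B e w) \<boxplus> (0, zz (T w))"
      by (simp add: \<nu>_def hp_eq ci_eq algebra_simps)
    also have "\<dots> \<approx> Q (\<sigma> *v w) \<boxplus> \<nu> \<odot> B e (\<sigma> *v w) \<boxplus> (0, zz (T w))"
      unfolding cg_right
    proof (rule cg_sym, rule cg_hp)
      show "Q (\<sigma> *v w) \<approx> (w $ 0, z) \<odot> c \<boxplus> (0, q w - z)"
        by (rule s_Q[OF z])
      show "\<nu> \<odot> B e (\<sigma> *v w) \<approx> \<nu> \<odot> (c * B e w)"
        using cg_ci_add[OF nu, of "B e (\<sigma> *v w) - c * B e w" "c * B e w"] s_B[OF MDe(1) w(2)]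
        by (simp add: jc_def)
      show "fst (Q (\<sigma> *v w)) \<in> Jd"
        using MD_G[OF s_G w(2)] by (simp add: Q_eq)
    qed
    also have "\<dots> \<approx> Q (\<sigma> *v w) \<boxplus> \<nu> \<odot> B e (\<sigma> *v w) \<boxplus> (0, zz (T (\<sigma> *v w)))"
      using cg_sym[OF cg_zz[OF T_s[unfolded jc_def], of _ 0]] by simp
    also have "\<dots> = Q (\<tau> *v (\<sigma> *v w))"
      by (rule Q_tau[symmetric])
    finally show ?thesis
      by (simp add: w(1) g)
  qed
  ultimately show ?thesis
    using gG by (simp add: V_iff g_def[symmetric])
qed

lemma s_commutator_EU:
  assumes "\<tau> \<in> EU R \<Delta>"
  shows "commutator G \<sigma> \<tau> \<in> V"
proof -
  interpret G: group "G :: ('a, 'n) matrix monoid"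
    by (rule group_G)
  interpret V: subgroup "V :: ('a, 'n) matrix set" G
    by (rule subgroup_V)
  have gc: "\<tau> \<in> carrier G \<and> commutator G \<sigma> \<tau> \<in> V \<and> (\<forall>k\<in>V. \<tau> \<otimes>\<^bsub>G\<^esub> k \<otimes>\<^bsub>G\<^esub> inv\<^bsub>G\<^esub> \<tau> \<in> V)"
    if "\<tau> \<in> gens" for \<tau>
    unfolding mult_G
    by (intro conjI ballI V_conj subsetD[OF gens_G that] gens_Npres[OF that] s_commutator_gens[OF that])
  have "\<tau> \<in> generate G gens"
    by (rule subsetD[OF EU_subset_generate assms])
  then have "\<tau> \<in> carrier G \<and> commutator G \<sigma> \<tau> \<in> V \<and> (\<forall>k\<in>V. \<tau> \<otimes>\<^bsub>G\<^esub> k \<otimes>\<^bsub>G\<^esub> inv\<^bsub>G\<^esub> \<tau> \<in> V)"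
  proof (induction rule: generate.induct)
    case one
    have "commutator G \<sigma> \<one>\<^bsub>G\<^esub> = (\<one>\<^bsub>G\<^esub> :: ('a, 'n) matrix)"
      unfolding commutator_def by (simp only: G.inv_one G.r_one G.r_inv G.inv_closed s_G G.one_closed G.m_closed)
    moreover have "\<one>\<^bsub>G\<^esub> \<otimes>\<^bsub>G\<^esub> k \<otimes>\<^bsub>G\<^esub> inv\<^bsub>G\<^esub> \<one>\<^bsub>G\<^esub> = k"
      if "k \<in> V" for k :: "('a, 'n) matrix"
      by (simp only: G.inv_one G.r_one G.l_one subsetD[OF V.subset that])
    ultimately show ?case
      by (intro conjI ballI) (simp_all only: V.one_closed G.one_closed)
  next
    case (incl \<tau>)
    then show ?case by (rule gc)
  next
    case (inv \<tau>)
    then show ?case by (intro gc gens_inv)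
  next
    case (eng \<tau> \<rho>)
    then have \<tau>: "\<tau> \<in> carrier G" and \<rho>: "\<rho> \<in> carrier G" by auto
    have *: "inv\<^bsub>G\<^esub> \<alpha> \<otimes>\<^bsub>G\<^esub> (\<alpha> \<otimes>\<^bsub>G\<^esub> x) = x" if "\<alpha> \<in> carrier G" "x \<in> carrier G" for \<alpha> x :: "('a, 'n) matrix"
      by (simp only: G.m_assoc[symmetric] G.inv_closed that G.l_inv G.l_one)
    have 1: "commutator G \<sigma> (\<tau> \<otimes>\<^bsub>G\<^esub> \<rho>)
        = commutator G \<sigma> \<tau> \<otimes>\<^bsub>G\<^esub> (\<tau> \<otimes>\<^bsub>G\<^esub> commutator G \<sigma> \<rho> \<otimes>\<^bsub>G\<^esub> inv\<^bsub>G\<^esub> \<tau>)"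
      unfolding commutator_def
      by (simp only: G.m_assoc G.inv_mult_group G.m_closed G.inv_closed \<tau> \<rho> s_G *)
    have 2: "\<tau> \<otimes>\<^bsub>G\<^esub> \<rho> \<otimes>\<^bsub>G\<^esub> k \<otimes>\<^bsub>G\<^esub> inv\<^bsub>G\<^esub> (\<tau> \<otimes>\<^bsub>G\<^esub> \<rho>)
        = \<tau> \<otimes>\<^bsub>G\<^esub> (\<rho> \<otimes>\<^bsub>G\<^esub> k \<otimes>\<^bsub>G\<^esub> inv\<^bsub>G\<^esub> \<rho>) \<otimes>\<^bsub>G\<^esub> inv\<^bsub>G\<^esub> \<tau>" if "k \<in> V" for k
      by (simp only: G.m_assoc G.inv_mult_group G.m_closed G.inv_closed \<tau> \<rho> subsetD[OF V.subset that])
    show ?case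
    proof (intro conjI ballI)
      show "commutator G \<sigma> (\<tau> \<otimes>\<^bsub>G\<^esub> \<rho>) \<in> V"
        unfolding 1 by (rule V.m_closed) (use eng.IH in blast)+
      show "\<tau> \<otimes>\<^bsub>G\<^esub> \<rho> \<otimes>\<^bsub>G\<^esub> k \<otimes>\<^bsub>G\<^esub> inv\<^bsub>G\<^esub> (\<tau> \<otimes>\<^bsub>G\<^esub> \<rho>) \<in> V" if "k \<in> V" for k
        using 2[OF that] eng.IH that by (simp only:)
    qed (rule G.m_closed[OF \<tau> \<rho>])
  qed
  then show ?thesis by simp
qed

end


section \<open>Upper level\<close>

context herm
begin

lemma subgroup_heisI:
  "(0, 0) \<in> S \<Longrightarrow> (\<And>\<alpha> \<beta>. \<alpha> \<in> S \<Longrightarrow> \<beta> \<in> S \<Longrightarrow> \<alpha> \<boxplus> \<beta> \<in> S)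
    \<Longrightarrow> (\<And>\<alpha>. \<alpha> \<in> S \<Longrightarrow> inv\<^bsub>heis R\<^esub> \<alpha> \<in> S) \<Longrightarrow> subgroup S (heis R)"
  by (rule subgroup.intro) auto

lemma subgroup_generate_heis: "subgroup (generate (heis R) S) (heis R)"
  by (rule group.generate_is_subgroup[OF group_heis]) simp

lemma generate_heis_subset: "subgroup S (heis R) \<Longrightarrow> T \<subseteq> S \<Longrightarrow> generate (heis R) T \<subseteq> S"
  by (rule group.generate_subgroup_incl[OF group_heis])

lemma generate_circ:
  assumes "\<And>\<alpha>. \<alpha> \<in> S \<Longrightarrow> \<alpha> \<odot> a \<in> generate (heis R) S" "\<beta> \<in> generate (heis R) S"
  shows "\<beta> \<odot> a \<in> generate (heis R) S"
proof -
  interpret S: subgroup "generate (heis R) S" "heis R"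
    by (rule subgroup_generate_heis)
  have "subgroup {\<beta>. \<beta> \<odot> a \<in> generate (heis R) S} (heis R)"
    by (rule subgroup_heisI) (use S.one_closed S.m_closed S.m_inv_closed in \<open>auto simp: ci_hp ci_inv ci_eq\<close>)
  from generate_heis_subset[OF this, of S] show ?thesis
    using assms by blast
qed

text \<open>The three subgroups commute with each other modulo the first one: a commutator involving an element
  of \<open>A\<close> is \<open>(0, zz t)\<close> with \<open>t\<close> a multiple of its first coordinate.\<close>

lemma bullet_product:
  assumes J: "ring_ideal J" and "bullet_submodule R A" "bullet_submodule R T"
    and A_J: "\<And>x y. (x, y) \<in> A \<Longrightarrow> x \<in> J"
  shows "bullet_submodule R ({(0, zz x) | x. x \<in> J} <#>\<^bsub>heis R\<^esub> A <#>\<^bsub>heis R\<^esub> T)" (is "bullet_submodule R ?P")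
proof -
  interpret A: bullet R A by unfold_locales fact
  interpret T: bullet R T by unfold_locales fact
  have P: "\<alpha> \<in> ?P \<longleftrightarrow> (\<exists>x\<in>J. \<exists>\<beta>\<in>A. \<exists>\<gamma>\<in>T. \<alpha> = (0, zz x) \<boxplus> \<beta> \<boxplus> \<gamma>)" for \<alpha>
    unfolding set_mult_def by blast
  have mid: "((0, zz x) \<boxplus> \<beta> \<boxplus> \<gamma>) \<boxplus> ((0, zz x') \<boxplus> \<beta>' \<boxplus> \<gamma>')
      = (0, zz (x + x' + br (fst \<beta>') * mu R * fst \<gamma>)) \<boxplus> (\<beta> \<boxplus> \<beta>') \<boxplus> (\<gamma> \<boxplus> \<gamma>')" for x x' \<beta> \<beta>' \<gamma> \<gamma>'
    by (cases \<beta>; cases \<gamma>; cases \<beta>'; cases \<gamma>') (simp add: hp_eq zz_def br_mu lm_lmi_far algebra_simps)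
  have inv: "inv\<^bsub>heis R\<^esub> ((0, zz x) \<boxplus> \<beta> \<boxplus> \<gamma>)
      = (0, zz (- x + br (fst \<beta>) * mu R * fst \<gamma>)) \<boxplus> inv\<^bsub>heis R\<^esub> \<beta> \<boxplus> inv\<^bsub>heis R\<^esub> \<gamma>" for x \<beta> \<gamma>
    by (cases \<beta>; cases \<gamma>) (simp add: hp_eq hinv_eq zz_def br_mu lm_lmi_far algebra_simps)
  have ci: "((0, zz x) \<boxplus> \<beta> \<boxplus> \<gamma>) \<odot> a = (0, zz (br a * x * a)) \<boxplus> \<beta> \<odot> a \<boxplus> \<gamma> \<odot> a" for x \<beta> \<gamma> a
    by (simp add: ci_hp ci_eq zz_simps)
  have AJ: "fst \<beta> \<in> J" if "\<beta> \<in> A" for \<beta>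
    using that A_J by (cases \<beta>) auto
  have brAJ: "br (fst \<beta>) * mu R * fst \<gamma> \<in> {x. \<exists>z\<in>J. zz x = zz z}" if "\<beta> \<in> A" for \<beta> \<gamma>
  proof -
    have "zz (br (fst \<beta>) * mu R * fst \<gamma>) = zz (- br (fst \<gamma>) * mu R * fst \<beta>)"
      by (simp add: zz_def br_mu lm_lmi_far algebra_simps)
    moreover have "- br (fst \<gamma>) * mu R * fst \<beta> \<in> J"
      by (rule ideal_scale[OF J AJ[OF that]])
    ultimately show ?thesis by blast
  qed
  have "subgroup ?P (heis R)"
  proof (rule subgroup_heisI)
    show "(0, 0) \<in> ?P"
      unfolding P using A.zero_mem T.zero_mem ideal_0[OF J]
      by (intro bexI[of _ 0] bexI[of _ "(0, 0)"]) (simp_all add: hp_eq zz_simps)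
  next
    fix \<alpha> \<alpha>' assume "\<alpha> \<in> ?P" "\<alpha>' \<in> ?P"
    then obtain x \<beta> \<gamma> x' \<beta>' \<gamma>' where *: "x \<in> J" "\<beta> \<in> A" "\<gamma> \<in> T" "x' \<in> J" "\<beta>' \<in> A" "\<gamma>' \<in> T"
      "\<alpha> = (0, zz x) \<boxplus> \<beta> \<boxplus> \<gamma>" "\<alpha>' = (0, zz x') \<boxplus> \<beta>' \<boxplus> \<gamma>'"
      unfolding P by blast
    obtain z where z: "z \<in> J" "zz (br (fst \<beta>') * mu R * fst \<gamma>) = zz z"
      using brAJ[OF *(5)] by blast
    then have "\<alpha> \<boxplus> \<alpha>' = (0, zz (x + x' + z)) \<boxplus> (\<beta> \<boxplus> \<beta>') \<boxplus> (\<gamma> \<boxplus> \<gamma>')"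
      unfolding * mid by (simp only: zz_simps)
    then show "\<alpha> \<boxplus> \<alpha>' \<in> ?P"
      unfolding P by (intro bexI[of _ "x + x' + z"] bexI[of _ "\<beta> \<boxplus> \<beta>'"] bexI[of _ "\<gamma> \<boxplus> \<gamma>'"]
        A.hp_mem T.hp_mem ideal_add[OF J] * z)
  next
    fix \<alpha> assume "\<alpha> \<in> ?P"
    then obtain x \<beta> \<gamma> where *: "x \<in> J" "\<beta> \<in> A" "\<gamma> \<in> T" "\<alpha> = (0, zz x) \<boxplus> \<beta> \<boxplus> \<gamma>"
      unfolding P by blast
    obtain z where z: "z \<in> J" "zz (br (fst \<beta>) * mu R * fst \<gamma>) = zz z"
      using brAJ[OF *(2)] by blast
    then have "inv\<^bsub>heis R\<^esub> \<alpha> = (0, zz (- x + z)) \<boxplus> inv\<^bsub>heis R\<^esub> \<beta> \<boxplus> inv\<^bsub>heis R\<^esub> \<gamma>"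
      unfolding * inv by (simp only: zz_simps)
    then show "inv\<^bsub>heis R\<^esub> \<alpha> \<in> ?P"
      unfolding P by (intro bexI[of _ "- x + z"] bexI[of _ "inv\<^bsub>heis R\<^esub> \<beta>"] bexI[of _ "inv\<^bsub>heis R\<^esub> \<gamma>"]
        A.hinv_mem T.hinv_mem ideal_add[OF J] ideal_neg[OF J] * z)
  qed
  moreover have "\<alpha> \<odot> a \<in> ?P" if \<alpha>: "\<alpha> \<in> ?P" for \<alpha> a
  proof -
    obtain x \<beta> \<gamma> where *: "x \<in> J" "\<beta> \<in> A" "\<gamma> \<in> T" "\<alpha> = (0, zz x) \<boxplus> \<beta> \<boxplus> \<gamma>"
      using \<alpha> unfolding P by blast
    show ?thesis
      unfolding P *(4) ci
      by (intro bexI[of _ "br a * x * a"] bexI[of _ "\<beta> \<odot> a"] bexI[of _ "\<gamma> \<odot> a"] refl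
          A.ci_mem T.ci_mem * ideal_scale2[OF J] ideal_scale[OF J])
  qed
  ultimately show ?thesis
    by (simp add: bullet_submodule_def)
qed

end

locale unitary_subgroup = form_ring R \<Delta> for R :: "'a::comm_ring_1 hermitian" and \<Delta> +
  fixes H :: "('a, 'n::finite) matrix set"
  assumes H: "subgroup H G"
begin

definition JH :: "'a set" where
  "JH = ideal_gen (upper_Y R \<Delta> H \<union> br ` upper_Y R \<Delta> H)"

definition SH :: "('a \<times> 'a) set" where
  "SH = Omega_min R \<Delta> JH <#>\<^bsub>heis R\<^esub> set_circ R (upper_Z R \<Delta> H) UNIV"

lemma upper_level_eq: "upper_level R \<Delta> H = (JH, SH)"
  by (simp add: upper_level_def JH_def SH_def Let_def)

lemma H_G: "\<sigma> \<in> H \<Longrightarrow> \<sigma> \<in> carrier G"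
  using subgroup.subset[OF H] by auto

lemma ring_ideal_JH: "ring_ideal JH"
  unfolding JH_def by (rule module.subspace_span[OF module_mult])

lemma Y_JH: "y \<in> upper_Y R \<Delta> H \<Longrightarrow> y \<in> JH"
  unfolding JH_def by (rule module.span_base[OF module_mult]) simp

lemma JH_subset:
  assumes "ring_ideal S" "\<And>y. y \<in> upper_Y R \<Delta> H \<Longrightarrow> y \<in> S" "\<And>y. y \<in> upper_Y R \<Delta> H \<Longrightarrow> br y \<in> S"
  shows "JH \<subseteq> S"
  unfolding JH_def using assms by (intro module.span_minimal[OF module_mult]) auto

lemma JH_br: "x \<in> JH \<Longrightarrow> br x \<in> JH"
proof -
  have "JH \<subseteq> {x. br x \<in> JH}"
  proof (rule JH_subset)
    show "ring_ideal {x. br x \<in> JH}"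
      using ring_ideal_JH by (intro ring_idealI) (auto intro: ideal_add ideal_scale)
    show "y \<in> {x. br x \<in> JH}" if "y \<in> upper_Y R \<Delta> H" for y
      using that unfolding JH_def by (auto intro: module.span_base[OF module_mult])
  qed (simp add: Y_JH)
  then show "x \<in> JH \<Longrightarrow> br x \<in> JH" by auto
qed

lemma upper_Y_mem:
  assumes "\<sigma> \<in> H"
  shows "i \<noteq> 0 \<Longrightarrow> j \<noteq> 0 \<Longrightarrow> i \<noteq> j \<Longrightarrow> \<sigma> $ i $ j \<in> upper_Y R \<Delta> H"
    "i \<noteq> 0 \<Longrightarrow> j \<noteq> 0 \<Longrightarrow> i \<noteq> j \<Longrightarrow> \<sigma> $ i $ i - \<sigma> $ j $ j \<in> upper_Y R \<Delta> H"
    "i \<noteq> 0 \<Longrightarrow> y \<in> Jd \<Longrightarrow> \<sigma> $ i $ 0 * y \<in> upper_Y R \<Delta> H"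
    "j \<noteq> 0 \<Longrightarrow> y \<in> Jd \<Longrightarrow> br y * mu R * \<sigma> $ 0 $ j \<in> upper_Y R \<Delta> H"
    "j \<noteq> 0 \<Longrightarrow> y \<in> Jd \<Longrightarrow> w \<in> Jd \<Longrightarrow> br y * mu R * (\<sigma> $ 0 $ 0 - \<sigma> $ j $ j) * w \<in> upper_Y R \<Delta> H"
  unfolding upper_Y_def
  subgoal by (rule UN_I[OF assms], rule UN_I[of "(i, j)"]) auto
  subgoal by (rule UN_I[OF assms], rule UN_I[of "(i, j)"]) auto
  subgoal by (rule UN_I[OF assms], rule UN_I[of "(i, - i)"]) auto
  subgoal by (rule UN_I[OF assms], rule UN_I[of "(- j, j)"]) auto
  subgoal by (rule UN_I[OF assms], rule UN_I[of "(- j, j)"]) auto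
  done

lemma upper_Z_cases:
  assumes "\<zeta> \<in> upper_Z R \<Delta> H"
  obtains (col) \<sigma> j where "\<sigma> \<in> H" "j \<noteq> 0" "\<zeta> = Q (\<sigma> *v axis j 1)"
    | (mid) \<sigma> i y z where "\<sigma> \<in> H" "i \<noteq> 0" "(y, z) \<in> \<Delta>"
      "\<zeta> = ((Q (\<sigma> *v axis 0 1) \<boxminus> (1, 0)) \<odot> y \<boxplus> (y, z)) \<boxminus> (y, z) \<odot> (\<sigma> $ i $ i)"
  using assms unfolding upper_Z_def by (auto simp: mult_axis_column)

lemma upper_Z_Delta: "\<zeta> \<in> upper_Z R \<Delta> H \<Longrightarrow> \<zeta> \<in> \<Delta>"
proof (erule upper_Z_cases)
  fix \<sigma> j assume "\<sigma> \<in> H" "j \<noteq> 0" "\<zeta> = Q (\<sigma> *v axis j 1)"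
  then show "\<zeta> \<in> \<Delta>"
    using G_Q[OF H_G, of \<sigma> "axis j 1"] by (simp add: Q_eq hm_eq axis_nth_if)
next
  fix \<sigma> i y z
  assume *: "\<sigma> \<in> H" "(y, z) \<in> \<Delta>"
    "\<zeta> = ((Q (\<sigma> *v axis 0 1) \<boxminus> (1, 0)) \<odot> y \<boxplus> (y, z)) \<boxminus> (y, z) \<odot> (\<sigma> $ i $ i)"
  have "Q (axis 0 1 :: 'a ^ 'n idx) = (1, 0)"
    by (simp add: Q_eq h_axis_left)
  then have "Q (\<sigma> *v axis 0 1) \<boxminus> (1, 0) \<in> \<Delta>"
    using G_Q[OF H_G[OF *(1)], of "axis 0 1"] by (simp only:)
  then show "\<zeta> \<in> \<Delta>"
    unfolding *(3) by (intro D.hm_mem[OF D.hp_mem[OF D.ci_mem *(2)] D.ci_mem[OF *(2)]])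
qed

lemma SH_eq: "SH = {(0, zz x) | x. x \<in> JH} <#>\<^bsub>heis R\<^esub> set_circ R \<Delta> JH
    <#>\<^bsub>heis R\<^esub> set_circ R (upper_Z R \<Delta> H) UNIV"
  by (simp add: SH_def Omega_min_def zz_def)

lemma set_circ_base: "\<alpha> \<in> A \<Longrightarrow> b \<in> T \<Longrightarrow> \<alpha> \<odot> b \<in> set_circ R A T"
  unfolding set_circ_def by (intro generate.incl) blast

lemma set_circ_bullet:
  assumes "\<And>b a. b \<in> T \<Longrightarrow> b * a \<in> T"
  shows "bullet_submodule R (set_circ R A T)"
  unfolding bullet_submodule_def
proof (intro conjI ballI allI)
  fix \<alpha> a assume "\<alpha> \<in> set_circ R A T"
  then show "\<alpha> \<odot> a \<in> set_circ R A T"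
    unfolding set_circ_def
  proof (rule generate_circ[rotated])
    fix \<beta> assume "\<beta> \<in> {\<alpha> \<odot> b |\<alpha> b. \<alpha> \<in> A \<and> b \<in> T}"
    then obtain \<alpha> b where "\<beta> = \<alpha> \<odot> b" "\<alpha> \<in> A" "b \<in> T"
      by blast
    then have "\<beta> \<odot> a = \<alpha> \<odot> (b * a)" "\<alpha> \<in> A" "b * a \<in> T"
      using assms by (simp_all add: ci_ci)
    then show "\<beta> \<odot> a \<in> generate (heis R) {\<alpha> \<odot> b |\<alpha> b. \<alpha> \<in> A \<and> b \<in> T}"
      by (intro generate.incl) blast
  qed
qed (simp add: set_circ_def subgroup_generate_heis)

lemma set_circ_subset:
  "subgroup S (heis R) \<Longrightarrow> (\<And>\<alpha> b. \<alpha> \<in> A \<Longrightarrow> b \<in> T \<Longrightarrow> \<alpha> \<odot> b \<in> S) \<Longrightarrow> set_circ R A T \<subseteq> S"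
  unfolding set_circ_def by (rule generate_heis_subset) auto

lemma SH_subset:
  assumes "bullet_submodule R S" "\<And>x. x \<in> JH \<Longrightarrow> (0, zz x) \<in> S"
    "\<And>\<alpha> a. \<alpha> \<in> \<Delta> \<Longrightarrow> a \<in> JH \<Longrightarrow> \<alpha> \<odot> a \<in> S" "\<And>\<zeta>. \<zeta> \<in> upper_Z R \<Delta> H \<Longrightarrow> \<zeta> \<in> S"
  shows "SH \<subseteq> S"
proof -
  interpret S: bullet R S by unfold_locales fact
  have S: "subgroup S (heis R)"
    using assms(1) by (simp add: bullet_submodule_def)
  have "set_circ R \<Delta> JH \<subseteq> S" "set_circ R (upper_Z R \<Delta> H) UNIV \<subseteq> S"
    by (rule set_circ_subset[OF S]; use assms S.ci_mem in blast)+
  then show ?thesis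
    unfolding SH_eq set_mult_def using assms(2) S.hp_mem by blast
qed

lemma SH_tilde:
  assumes w: "w \<in> Jd"
  shows "SH \<subseteq> {\<alpha>. br w * mu R * fst \<alpha> \<in> JH}" (is "_ \<subseteq> ?S")
proof -
  note J = ideal_add[OF ring_ideal_JH] ideal_neg[OF ring_ideal_JH] ideal_0[OF ring_ideal_JH]
    ideal_scale[OF ring_ideal_JH] ideal_scale2[OF ring_ideal_JH]
  have "subgroup ?S (heis R)"
    by (rule subgroup_heisI) (auto simp: hp_eq hinv_eq distrib_left J)
  moreover have "br w * mu R * fst (\<alpha> \<odot> a) = (br w * mu R * fst \<alpha>) * a" for \<alpha> a
    by (cases \<alpha>) (simp add: ci_eq mult.assoc)
  ultimately have S: "bullet_submodule R ?S"
    by (simp add: bullet_submodule_def J)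
  have Z: "\<zeta> \<in> ?S" if \<zeta>: "\<zeta> \<in> upper_Z R \<Delta> H" for \<zeta>
    using \<zeta>
  proof (cases rule: upper_Z_cases)
    case (col \<sigma> j)
    then show ?thesis
      using Y_JH[OF upper_Y_mem(4)[OF col(1,2) w]] by (simp add: Q_eq mult_axis_nth)
  next
    case (mid \<sigma> i y z)
    have "br w * mu R * (\<sigma> $ 0 $ 0 - \<sigma> $ i $ i) * y \<in> JH"
      by (intro Y_JH upper_Y_mem(5) mid w Jd_I[OF mid(3)])
    then show ?thesis
      by (simp add: mid Q_eq hm_eq hp_eq ci_eq mult_axis_nth algebra_simps)
  qed
  show ?thesis
  proof (rule SH_subset[OF S _ _ Z])
    show "\<alpha> \<odot> a \<in> ?S" if "a \<in> JH" for \<alpha> a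
      using that by (cases \<alpha>) (simp add: ci_eq J)
  qed (simp add: J)
qed

text \<open>In this form the upper level enters the congruence arguments; the only property that is not formal
  is \<open>SH_tilde\<close>.\<close>

sublocale L: odd_ideal R \<Delta> JH SH
proof
  have fst_J: "set_circ R \<Delta> JH \<subseteq> {(x, y). x \<in> JH}"
    by (rule set_circ_subset, rule subgroup_heisI)
      (auto simp: hp_eq hinv_eq ci_eq intro: ideal_add[OF ring_ideal_JH] ideal_neg[OF ring_ideal_JH]
        ideal_scale[OF ring_ideal_JH] ideal_0[OF ring_ideal_JH])
  show bul: "bullet_submodule R SH"
    unfolding SH_eq by (rule bullet_product[OF ring_ideal_JH])
      (use fst_J ideal_scale2[OF ring_ideal_JH] in \<open>auto intro!: set_circ_bullet\<close>)
  interpret A: bullet R "set_circ R \<Delta> JH"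
    by unfold_locales (intro set_circ_bullet ideal_scale2[OF ring_ideal_JH])
  interpret Z: bullet R "set_circ R (upper_Z R \<Delta> H) UNIV"
    by unfold_locales (intro set_circ_bullet UNIV_I)
  show "(0, zz x) \<in> SH" if "x \<in> JH" for x
  proof -
    have "(0, zz x) = (0, zz x) \<boxplus> (0, 0) \<boxplus> (0, 0)"
      by (simp add: hp_eq)
    then show ?thesis
      unfolding SH_eq set_mult_def using that A.zero_mem Z.zero_mem by blast
  qed
  show "\<alpha> \<odot> a \<in> SH" if "\<alpha> \<in> \<Delta>" "a \<in> JH" for \<alpha> a
  proof -
    have "\<alpha> \<odot> a = (0, zz 0) \<boxplus> \<alpha> \<odot> a \<boxplus> (0, 0)"
      by (cases \<alpha>) (simp add: hp_eq ci_eq zz_simps)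
    then show ?thesis
      unfolding SH_eq set_mult_def using that set_circ_base[of \<alpha> \<Delta> a JH] Z.zero_mem ideal_0[OF ring_ideal_JH] by blast
  qed
  show "SH \<subseteq> \<Delta>"
    using odd_form zz_Delta D.ci_mem upper_Z_Delta by (intro SH_subset) (auto simp: odd_form_parameter_def)
  show "br w * mu R * x \<in> JH" if "(x, y) \<in> SH" "w \<in> Jd" for x y w
    using SH_tilde[OF that(2)] that(1) by auto
qed (rule ring_ideal_JH, rule JH_br)

lemma upper_Z_SH: "\<zeta> \<in> upper_Z R \<Delta> H \<Longrightarrow> \<zeta> \<in> SH"
proof -
  assume "\<zeta> \<in> upper_Z R \<Delta> H"
  then have "\<zeta> \<odot> 1 \<in> set_circ R (upper_Z R \<Delta> H) UNIV"
    by (intro set_circ_base) auto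
  moreover have "(0, 0) \<in> set_circ R \<Delta> JH"
    using set_circ_bullet[of JH \<Delta>] ideal_scale2[OF ring_ideal_JH] bullet.zero_mem bullet.intro
      bullet_axioms_def herm_axioms by blast
  moreover have "\<zeta> = (0, zz 0) \<boxplus> (0, 0) \<boxplus> \<zeta> \<odot> 1"
    by (cases \<zeta>) (simp add: hp_eq ci_eq zz_simps)
  ultimately show "\<zeta> \<in> SH"
    unfolding SH_eq set_mult_def using ideal_0[OF ring_ideal_JH] by blast
qed

text \<open>The generators of the upper level are chosen such that exactly this holds.\<close>

lemma H_central_mod:
  assumes s: "\<sigma> \<in> H" and j0: "j0 \<noteq> 0"
  shows "central_mod R \<Delta> JH SH \<sigma> (\<sigma> $ j0 $ j0)"
proof unfold_locales
  note Y = upper_Y_mem[OF s, THEN Y_JH]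
  show "\<sigma> \<in> carrier G"
    by (rule H_G[OF s])
  have "L.small (\<sigma> - mat (\<sigma> $ j0 $ j0))"
  proof (rule L.small_columnsI; rule L.svI)
    fix i j :: "'n idx" and w
    assume ij: "j \<noteq> 0"
    show "column j (\<sigma> - mat (\<sigma> $ j0 $ j0)) $ i \<in> JH" if "i \<noteq> 0"
      using ij that Y(1)[of i j] Y(2)[of j j0] j0 by (cases "i = j"; cases "j = j0") (auto simp: column_def mat_def L.J_rules)
    show "br w * mu R * column j (\<sigma> - mat (\<sigma> $ j0 $ j0)) $ 0 \<in> JH" if "w \<in> Jd"
      using ij that Y(4)[of j w] by (simp add: column_def mat_def)
  next
    fix i :: "'n idx" and y w
    assume y: "y \<in> Jd"
    show "(y *s column 0 (\<sigma> - mat (\<sigma> $ j0 $ j0))) $ i \<in> JH" if "i \<noteq> 0"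
      using y that Y(3)[of i y] by (simp add: column_def mat_def mult.commute)
    show "br w * mu R * (y *s column 0 (\<sigma> - mat (\<sigma> $ j0 $ j0))) $ 0 \<in> JH" if "w \<in> Jd"
      using y that Y(5)[of j0 w y] j0 by (simp add: column_def mat_def mult_ac)
  qed
  moreover have "(\<sigma> - mat c) *v u = \<sigma> *v u - c *s u" for c u
    by (simp add: matrix_vector_mult_diff_rdistrib) (simp add: vec_eq_iff matrix_vector_mult_def mat_def if_distrib[where f = "\<lambda>y. y * _"] cong: if_cong)
  ultimately show "L.sv (\<sigma> *v u - \<sigma> $ j0 $ j0 *s u)" if "MD u" for u
    using that by (auto simp: L.small_def)
  show "Q (\<sigma> *v axis j 1) \<in> SH" if "j \<noteq> 0" for j
    using s that by (intro upper_Z_SH) (auto simp: upper_Z_def mult_axis_column)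
  show "((Q (\<sigma> *v axis 0 1) \<boxminus> (1, 0)) \<odot> y \<boxplus> (y, z)) \<boxminus> (y, z) \<odot> \<sigma> $ j0 $ j0 \<in> SH" if "(y, z) \<in> \<Delta>" for y z
    by (rule upper_Z_SH, unfold upper_Z_def, rule UnI2, rule CollectI, rule exI[of _ \<sigma>],
        rule exI[of _ j0], rule exI[of _ y], rule exI[of _ z]) (simp add: s that j0 mult_axis_column)
qed

theorem H_subset_CU: "H \<subseteq> CU_ideal R \<Delta> (upper_level R \<Delta> H)"
proof
  fix \<sigma> assume s: "\<sigma> \<in> H"
  define j0 :: "'n idx" where "j0 = Plus undefined"
  have j0: "j0 \<noteq> 0" by (simp add: j0_def)
  interpret G: group "G :: ('a, 'n) matrix monoid" by (rule group_G)
  have V: "L.V \<subseteq> carrier (G :: ('a, 'n) matrix monoid)"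
    by (rule subgroup.subset[OF L.subgroup_V])
  have conj: "\<tau> \<otimes>\<^bsub>G\<^esub> k \<otimes>\<^bsub>G\<^esub> inv\<^bsub>G\<^esub> \<tau> \<in> L.V" if "\<tau> \<in> H" "k \<in> L.V" for \<tau> k
    unfolding mult_G
    by (rule L.V_conj[OF H_G[OF that(1)] central_mod.s_Npres[OF H_central_mod[OF that(1) j0]] that(2)])
  have "\<sigma> \<in> NU_ideal R \<Delta> (JH, SH)"
    unfolding NU_ideal_def
  proof (rule G.normalizerI[OF H_G[OF s] V])
    fix k :: "('a, 'n) matrix" assume k: "k \<in> L.V"
    show "\<sigma> \<otimes>\<^bsub>G\<^esub> k \<otimes>\<^bsub>G\<^esub> inv\<^bsub>G\<^esub> \<sigma> \<in> L.V"
      by (rule conj[OF s k])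
    show "inv\<^bsub>G\<^esub> \<sigma> \<otimes>\<^bsub>G\<^esub> k \<otimes>\<^bsub>G\<^esub> \<sigma> \<in> L.V"
      using conj[OF subgroup.m_inv_closed[OF H s] k] by (simp only: G.inv_inv H_G[OF s])
  qed
  moreover have "generate G {commutator G \<sigma> \<tau> | \<tau>. \<tau> \<in> EU R \<Delta>} \<subseteq> L.V"
    using central_mod.s_commutator_EU[OF H_central_mod[OF s j0]]
    by (intro G.generate_subgroup_incl L.subgroup_V) auto
  ultimately show "\<sigma> \<in> CU_ideal R \<Delta> (upper_level R \<Delta> H)"
    by (simp add: CU_ideal_def upper_level_eq)
qed

end


section \<open>Elementary matrices in a normalised subgroup\<close>

text \<open>General position: \<open>X p r x\<close> is then a short root element.\<close>

definition gp :: "'n idx \<Rightarrow> 'n idx \<Rightarrow> bool" where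
  "gp p r \<longleftrightarrow> p \<noteq> 0 \<and> r \<noteq> 0 \<and> r \<noteq> p \<and> r \<noteq> - p"

lemma gp_sym: "gp p r \<longleftrightarrow> gp r p"
  by (auto simp: gp_def idx_minus_swap)

lemma gp_minus [simp]: "gp (- p) r \<longleftrightarrow> gp p r" "gp p (- r) \<longleftrightarrow> gp p r"
  by (auto simp: gp_def idx_minus_swap)

lemma gpD:
  assumes "gp p r"
  shows "p \<noteq> 0" "r \<noteq> 0" "r \<noteq> p" "p \<noteq> r" "r \<noteq> - p" "- r \<noteq> p" "- p \<noteq> r" "p \<noteq> - r"
  using assms by (auto simp: gp_def idx_minus_swap)

lemma gp_exists:
  fixes a b c :: "'n::finite idx"
  assumes "CARD('n) \<ge> 4" and nz: "a \<noteq> 0" "b \<noteq> 0" "c \<noteq> 0"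
  shows "\<exists>k. gp k a \<and> gp k b \<and> gp k c"
proof -
  define cls where "cls i = {k. i = Plus k \<or> i = Minus (k :: 'n)}" for i
  have cls: "card (cls i) \<le> 1" for i
    by (cases i) (auto simp: cls_def)
  have "card (cls a \<union> cls b \<union> cls c) \<le> 3"
    using card_Un_le[of "cls a \<union> cls b" "cls c"] card_Un_le[of "cls a" "cls b"] cls[of a] cls[of b] cls[of c]
    by linarith
  then have "cls a \<union> cls b \<union> cls c \<noteq> UNIV"
    using assms by auto
  then obtain k where k: "k \<notin> cls a" "k \<notin> cls b" "k \<notin> cls c"
    by auto
  have "gp (Plus k) i" if "i \<noteq> 0" "k \<notin> cls i" for i
    using that by (auto simp: gp_def cls_def)
  with k nz show ?thesis by blast
qed

context group
begin

text \<open>Modulo a subgroup \<open>H\<close> the elements of \<open>H\<close> become trivial, so that conjugating by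
  \<open>\<sigma> \<in> H\<close> changes nothing inside the normaliser.\<close>

lemma normalizer_hom:
  assumes H: "subgroup H G"
  defines "K \<equiv> G\<lparr>carrier := normalizer G H\<rparr> Mod H"
    and "\<phi> \<equiv> \<lambda>g. H #>\<^bsub>G\<lparr>carrier := normalizer G H\<rparr>\<^esub> g"
  shows "Group.group K"
    and "g \<in> normalizer G H \<Longrightarrow> \<phi> g \<in> carrier K"
    and "g \<in> normalizer G H \<Longrightarrow> k \<in> normalizer G H \<Longrightarrow> \<phi> (g \<otimes> k) = \<phi> g \<otimes>\<^bsub>K\<^esub> \<phi> k"
    and "g \<in> normalizer G H \<Longrightarrow> \<phi> (inv g) = inv\<^bsub>K\<^esub> \<phi> g"
    and "g \<in> normalizer G H \<Longrightarrow> \<phi> g = \<one>\<^bsub>K\<^esub> \<longleftrightarrow> g \<in> H"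
proof -
  let ?N = "G\<lparr>carrier := normalizer G H\<rparr>"
  have N: "subgroup (normalizer G H) G"
    by (rule normalizer_imp_subgroup[OF subgroup.subset[OF H]])
  interpret n: normal H ?N
    by (rule subgroup_in_normalizer[OF H])
  show "Group.group K"
    unfolding K_def by (rule n.factorgroup_is_group)
  then have h: "group_hom ?N K \<phi>"
    unfolding K_def \<phi>_def by (intro group_hom.intro group_hom_axioms.intro n.r_coset_hom_Mod n.is_group)
  {
    assume g: "g \<in> normalizer G H"
    then have g': "g \<in> carrier ?N" by simp
    show "\<phi> g \<in> carrier K"
      by (rule group_hom.hom_closed[OF h g'])
    have "inv\<^bsub>?N\<^esub> g = inv g"
      by (rule m_inv_consistent[OF N g])
    then show "\<phi> (inv g) = inv\<^bsub>K\<^esub> \<phi> g"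
      using group_hom.hom_inv[OF h g'] by (simp only:)
    show "\<phi> g = \<one>\<^bsub>K\<^esub> \<longleftrightarrow> g \<in> H"
      unfolding K_def \<phi>_def one_FactGroup
      using n.coset_join1[OF _ g' n.subgroup_axioms] n.coset_join2[OF g' n.subgroup_axioms] by blast
    assume "k \<in> normalizer G H"
    then have "k \<in> carrier ?N" by simp
    from group_hom.hom_mult[OF h g' this] show "\<phi> (g \<otimes> k) = \<phi> g \<otimes>\<^bsub>K\<^esub> \<phi> k"
      by simp
  }
qed

lemma commutator_closed: "g \<in> carrier G \<Longrightarrow> k \<in> carrier G \<Longrightarrow> commutator G g k \<in> carrier G"
  by (simp add: commutator_def)

lemma commutator_H:
  assumes H: "subgroup H G" and "r \<in> normalizer G H" "g \<in> H"
  shows "commutator G r g \<in> H" "commutator G g r \<in> H"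
proof -
  have r: "r \<in> carrier G"
    using assms(2) by (auto simp: normalizer_def stabilizer_def)
  have rg: "r \<otimes> g \<otimes> inv r \<in> H"
    by (rule normalizer_conj[OF assms(2,3) subgroup.subset[OF H]])
  then show "commutator G r g \<in> H"
    unfolding commutator_def by (rule subgroup.m_closed[OF H _ subgroup.m_inv_closed[OF H assms(3)]])
  have "commutator G g r = g \<otimes> inv (r \<otimes> g \<otimes> inv r)"
    using r subgroup.mem_carrier[OF H assms(3)] by (simp add: commutator_def m_assoc inv_mult_group)
  then show "commutator G g r \<in> H"
    using rg by (simp add: assms subgroup.m_closed[OF H] subgroup.m_inv_closed[OF H])
qed

lemma commutator_eqI:
  "g \<in> carrier G \<Longrightarrow> k \<in> carrier G \<Longrightarrow> c \<in> carrier G \<Longrightarrow> g \<otimes> k \<otimes> inv g = c \<otimes> k \<Longrightarrow> commutator G g k = c"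
  by (simp add: commutator_def m_assoc)

text \<open>The projection to the quotient of the normaliser by \<open>H\<close>, through the properties that
  are used to compare words in a conjugate \<open>\<sigma> \<tau> \<sigma>\<^sup>-\<^sup>1\<close> with the same words in \<open>\<tau>\<close>.\<close>

lemma normalizer_mod:
  assumes H: "subgroup H G"
  obtains \<phi> :: "'a \<Rightarrow> 'a set" where
    "\<And>g. g \<in> normalizer G H \<Longrightarrow> \<phi> g = \<phi> \<one> \<longleftrightarrow> g \<in> H"
    "\<And>\<sigma> g. \<sigma> \<in> H \<Longrightarrow> g \<in> normalizer G H \<Longrightarrow> \<phi> (\<sigma> \<otimes> g \<otimes> inv \<sigma>) = \<phi> g"
    "\<And>g k g' k'. g \<in> normalizer G H \<Longrightarrow> k \<in> normalizer G H \<Longrightarrow> g' \<in> normalizer G H \<Longrightarrow> k' \<in> normalizer G H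
      \<Longrightarrow> \<phi> g = \<phi> g' \<Longrightarrow> \<phi> k = \<phi> k' \<Longrightarrow> \<phi> (g \<otimes> k) = \<phi> (g' \<otimes> k')"
    "\<And>g g'. g \<in> normalizer G H \<Longrightarrow> g' \<in> normalizer G H \<Longrightarrow> \<phi> g = \<phi> g' \<Longrightarrow> \<phi> (inv g) = \<phi> (inv g')"
    "\<And>g g'. g \<in> normalizer G H \<Longrightarrow> g' \<in> normalizer G H \<Longrightarrow> \<phi> g = \<phi> g' \<longleftrightarrow> g \<otimes> inv g' \<in> H"
proof -
  define K where "K = G\<lparr>carrier := normalizer G H\<rparr> Mod H"
  define \<phi> where "\<phi> = (\<lambda>g. H #>\<^bsub>G\<lparr>carrier := normalizer G H\<rparr>\<^esub> g)"
  note K = normalizer_hom(1)[OF H, folded K_def]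
    and \<phi> = normalizer_hom(2-)[OF H, folded K_def \<phi>_def]
  interpret K: group K by (rule K)
  have N': "subgroup (normalizer G H) G"
    by (rule normalizer_imp_subgroup[OF subgroup.subset[OF H]])
  note Nc = subgroup.m_closed[OF N'] subgroup.m_inv_closed[OF N'] subgroup.one_closed[OF N']
  have HN: "\<sigma> \<in> normalizer G H" if "\<sigma> \<in> H" for \<sigma>
    using that normal_imp_subgroup[OF subgroup_in_normalizer[OF H], THEN subgroup.subset] by auto
  have one: "\<phi> \<one> = \<one>\<^bsub>K\<^esub>"
    unfolding \<phi>(4)[OF Nc(3)] by (rule subgroup.one_closed[OF H])
  show thesis
  proof (rule that[of \<phi>])
    fix g assume g: "g \<in> normalizer G H"
    show "\<phi> g = \<phi> \<one> \<longleftrightarrow> g \<in> H"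
      unfolding one by (rule \<phi>(4)[OF g])
    fix g' assume g': "g' \<in> normalizer G H"
    have "\<phi> (g \<otimes> inv g') = \<phi> g \<otimes>\<^bsub>K\<^esub> inv\<^bsub>K\<^esub> \<phi> g'"
      by (simp only: \<phi>(2,3) Nc g g')
    moreover have "\<phi> g \<otimes>\<^bsub>K\<^esub> inv\<^bsub>K\<^esub> \<phi> g' = \<one>\<^bsub>K\<^esub> \<longleftrightarrow> \<phi> g = \<phi> g'"
    proof
      assume "\<phi> g \<otimes>\<^bsub>K\<^esub> inv\<^bsub>K\<^esub> \<phi> g' = \<one>\<^bsub>K\<^esub>"
      then have "inv\<^bsub>K\<^esub> (inv\<^bsub>K\<^esub> \<phi> g') = \<phi> g"
        by (rule K.inv_equality) (intro K.inv_closed \<phi>(1) g g')+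
      then show "\<phi> g = \<phi> g'"
        by (simp only: K.inv_inv[OF \<phi>(1)[OF g']])
    next
      assume "\<phi> g = \<phi> g'"
      then show "\<phi> g \<otimes>\<^bsub>K\<^esub> inv\<^bsub>K\<^esub> \<phi> g' = \<one>\<^bsub>K\<^esub>"
        by (simp only: K.r_inv[OF \<phi>(1)[OF g']])
    qed
    ultimately show "\<phi> g = \<phi> g' \<longleftrightarrow> g \<otimes> inv g' \<in> H"
      unfolding \<phi>(4)[OF Nc(1)[OF g Nc(2)[OF g']], symmetric] by (simp only:)
  next
    fix \<sigma> g assume s: "\<sigma> \<in> H" and g: "g \<in> normalizer G H"
    have s1: "\<phi> \<sigma> = \<one>\<^bsub>K\<^esub>"
      unfolding \<phi>(4)[OF HN[OF s]] by (rule s)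
    have "\<phi> (\<sigma> \<otimes> g \<otimes> inv \<sigma>) = \<phi> \<sigma> \<otimes>\<^bsub>K\<^esub> \<phi> g \<otimes>\<^bsub>K\<^esub> inv\<^bsub>K\<^esub> \<phi> \<sigma>"
      by (simp only: \<phi>(2,3) Nc HN[OF s] g)
    then show "\<phi> (\<sigma> \<otimes> g \<otimes> inv \<sigma>) = \<phi> g"
      unfolding s1 by (simp only: K.inv_one K.l_one K.r_one \<phi>(1)[OF g])
  next
    fix g k g' k'
    assume N: "g \<in> normalizer G H" "k \<in> normalizer G H" "g' \<in> normalizer G H" "k' \<in> normalizer G H"
      and e: "\<phi> g = \<phi> g'" "\<phi> k = \<phi> k'"
    show "\<phi> (g \<otimes> k) = \<phi> (g' \<otimes> k')"
      unfolding \<phi>(2)[OF N(1,2)] \<phi>(2)[OF N(3,4)] e ..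
  next
    fix g g' assume N: "g \<in> normalizer G H" "g' \<in> normalizer G H" and e: "\<phi> g = \<phi> g'"
    show "\<phi> (inv g) = \<phi> (inv g')"
      unfolding \<phi>(3)[OF N(1)] \<phi>(3)[OF N(2)] e ..
  qed
qed

text \<open>The two double commutators are congruent modulo \<open>H\<close>, as \<open>\<sigma> \<tau> \<sigma>\<^sup>-\<^sup>1\<close> and \<open>\<tau>\<close> are.\<close>

lemma double_commutator_in:
  assumes H: "subgroup H G" and s: "\<sigma> \<in> H"
    and N: "\<tau> \<in> normalizer G H" "t \<in> normalizer G H" "t' \<in> normalizer G H" "r \<in> normalizer G H"
    and r: "commutator G r (commutator G t' ((\<sigma> \<otimes> \<tau> \<otimes> inv \<sigma>) \<otimes> t \<otimes> inv (\<sigma> \<otimes> \<tau> \<otimes> inv \<sigma>))) = \<one>"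
  shows "commutator G r (commutator G t' (\<tau> \<otimes> t \<otimes> inv \<tau>)) \<in> H"
proof (rule normalizer_mod[OF H])
  fix \<phi> :: "'a \<Rightarrow> 'a set"
  assume \<phi>: "\<And>g. g \<in> normalizer G H \<Longrightarrow> \<phi> g = \<phi> \<one> \<longleftrightarrow> g \<in> H"
    "\<And>\<sigma> g. \<sigma> \<in> H \<Longrightarrow> g \<in> normalizer G H \<Longrightarrow> \<phi> (\<sigma> \<otimes> g \<otimes> inv \<sigma>) = \<phi> g"
    "\<And>g k g' k'. g \<in> normalizer G H \<Longrightarrow> k \<in> normalizer G H \<Longrightarrow> g' \<in> normalizer G H \<Longrightarrow> k' \<in> normalizer G H
      \<Longrightarrow> \<phi> g = \<phi> g' \<Longrightarrow> \<phi> k = \<phi> k' \<Longrightarrow> \<phi> (g \<otimes> k) = \<phi> (g' \<otimes> k')"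
    "\<And>g g'. g \<in> normalizer G H \<Longrightarrow> g' \<in> normalizer G H \<Longrightarrow> \<phi> g = \<phi> g' \<Longrightarrow> \<phi> (inv g) = \<phi> (inv g')"
  have N': "subgroup (normalizer G H) G"
    by (rule normalizer_imp_subgroup[OF subgroup.subset[OF H]])
  note Nc = subgroup.m_closed[OF N'] subgroup.m_inv_closed[OF N']
  have sN: "\<sigma> \<in> normalizer G H"
    using s normal_imp_subgroup[OF subgroup_in_normalizer[OF H], THEN subgroup.subset] by auto
  define \<xi> where "\<xi> = \<sigma> \<otimes> \<tau> \<otimes> inv \<sigma>"
  have \<xi>: "\<xi> \<in> normalizer G H" "\<phi> \<tau> = \<phi> \<xi>"
    unfolding \<xi>_def using \<phi>(2)[OF s N(1)] by (auto intro: Nc sN N)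
  have "\<phi> (commutator G r (commutator G t' (\<tau> \<otimes> t \<otimes> inv \<tau>)))
      = \<phi> (commutator G r (commutator G t' (\<xi> \<otimes> t \<otimes> inv \<xi>)))"
    unfolding commutator_def by (intro \<phi>(3,4) Nc N \<xi> refl)
  also have "\<dots> = \<phi> \<one>"
    using r by (simp only: \<xi>_def)
  finally show ?thesis
    by (subst (asm) \<phi>(1)) (unfold commutator_def, intro Nc N)
qed

lemma conj_compare:
  assumes H: "subgroup H G" and s: "\<sigma> \<in> H"
    and N: "\<tau> \<in> normalizer G H" "t \<in> normalizer G H" "g \<in> normalizer G H" and g: "\<tau> \<otimes> inv g \<in> H"
  shows "((\<sigma> \<otimes> \<tau> \<otimes> inv \<sigma>) \<otimes> t \<otimes> inv (\<sigma> \<otimes> \<tau> \<otimes> inv \<sigma>)) \<otimes> inv (g \<otimes> t \<otimes> inv g) \<in> H"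
proof (rule normalizer_mod[OF H])
  fix \<phi> :: "'a \<Rightarrow> 'a set"
  assume \<phi>: "\<And>\<sigma> g. \<sigma> \<in> H \<Longrightarrow> g \<in> normalizer G H \<Longrightarrow> \<phi> (\<sigma> \<otimes> g \<otimes> inv \<sigma>) = \<phi> g"
    "\<And>g k g' k'. g \<in> normalizer G H \<Longrightarrow> k \<in> normalizer G H \<Longrightarrow> g' \<in> normalizer G H \<Longrightarrow> k' \<in> normalizer G H
      \<Longrightarrow> \<phi> g = \<phi> g' \<Longrightarrow> \<phi> k = \<phi> k' \<Longrightarrow> \<phi> (g \<otimes> k) = \<phi> (g' \<otimes> k')"
    "\<And>g g'. g \<in> normalizer G H \<Longrightarrow> g' \<in> normalizer G H \<Longrightarrow> \<phi> g = \<phi> g' \<Longrightarrow> \<phi> (inv g) = \<phi> (inv g')"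
    "\<And>g g'. g \<in> normalizer G H \<Longrightarrow> g' \<in> normalizer G H \<Longrightarrow> \<phi> g = \<phi> g' \<longleftrightarrow> g \<otimes> inv g' \<in> H"
  have N': "subgroup (normalizer G H) G"
    by (rule normalizer_imp_subgroup[OF subgroup.subset[OF H]])
  note Nc = subgroup.m_closed[OF N'] subgroup.m_inv_closed[OF N']
  have sN: "\<sigma> \<in> normalizer G H"
    using s normal_imp_subgroup[OF subgroup_in_normalizer[OF H], THEN subgroup.subset] by auto
  define \<xi> where "\<xi> = \<sigma> \<otimes> \<tau> \<otimes> inv \<sigma>"
  have \<xi>N: "\<xi> \<in> normalizer G H"
    unfolding \<xi>_def by (intro Nc sN N)
  have \<xi>: "\<phi> \<xi> = \<phi> g"
    unfolding \<xi>_def \<phi>(1)[OF s N(1)] \<phi>(4)[OF N(1,3)] by (rule g)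
  have "\<phi> (\<xi> \<otimes> t \<otimes> inv \<xi>) = \<phi> (g \<otimes> t \<otimes> inv g)"
    by (intro \<phi>(2,3) Nc N \<xi>N \<xi> refl)
  then show ?thesis
    unfolding \<xi>_def by (subst (asm) \<phi>(4)) (intro Nc N sN)+
qed

end

lemma ideal_gen_additive_induct [consumes 2, case_names mult zero add]:
  assumes "x \<in> ideal_mult I K" and I: "ring_ideal I"
    and m: "\<And>a b. a \<in> I \<Longrightarrow> b \<in> K \<Longrightarrow> P (a * b)" and "P 0" "\<And>x y. P x \<Longrightarrow> P y \<Longrightarrow> P (x + y)"
  shows "P x"
proof -
  have "\<forall>c. P (c * x)"
    using assms(1) unfolding ideal_mult_def
  proof (induction rule: module.span_induct_alt[OF module_mult, consumes 1, case_names base step])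
    case (step c x y)
    then obtain a b where ab: "x = a * b" "a \<in> I" "b \<in> K" by blast
    show ?case
    proof
      fix d
      have e: "d * (c * x + y) = (d * c * a) * b + d * y"
        by (simp add: ab(1) algebra_simps)
      show "P (d * (c * x + y))"
        unfolding e using step by (intro assms(5)[OF m[OF ideal_scale[OF I ab(2)] ab(3)]]) blast
    qed
  qed (simp add: assms(4))
  from spec[OF this, of 1] show ?thesis by simp
qed

lemma ring_ideal_mult: "ring_ideal (ideal_mult I K)"
  unfolding ideal_mult_def by (rule module.subspace_span[OF module_mult])

lemma ideal_mult_base: "a \<in> I \<Longrightarrow> b \<in> K \<Longrightarrow> a * b \<in> ideal_mult I K"
  unfolding ideal_mult_def by (rule module.span_base[OF module_mult]) blast

lemma ring_ideal_power: "ring_ideal (ideal_power I k)"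
  by (cases k) (simp_all add: ideal_power_def ring_ideal_mult ring_idealI)

lemma ideal_power_Suc: "ideal_power I (Suc k) = ideal_mult I (ideal_power I k)"
  by (simp add: ideal_power_def)

context herm
begin

lemma X_comm:
  fixes p :: "'n::finite idx" and y :: 'a
  assumes "gp p p'" "gp p r" "r \<noteq> - p'" "p' \<noteq> 0"
  defines "s \<equiv> kap (- p) * y"
  shows "X (- p) p' y *v axis p 1 = axis p 1 + s *s axis p' 1" "X (- p) p' y *v axis r x = axis r x"
    "E (axis p 1 + s *s axis p' 1) (axis r x) 0 = X p' r (br s * x) ** X p r x"
proof -
  note gpD[OF assms(1)] gpD[OF assms(2)]
  note ne = this
  show "X (- p) p' y *v axis p 1 = axis p 1 + s *s axis p' 1" "X (- p) p' y *v axis r x = axis r x"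
    using ne assms(3,4) by (simp_all add: X_def E_apply B_axis_axis axis_scale s_def mult_ac)
  have "E (axis p 1 + s *s axis p' 1) (axis r x) 0 = E (s *s axis p' 1) (axis r x) 0 ** E (axis p 1) (axis r x) 0"
    using ne assms(3,4) by (subst E_base_add) (simp_all add: B_axis_axis)
  then show "E (axis p 1 + s *s axis p' 1) (axis r x) 0 = X p' r (br s * x) ** X p r x"
    unfolding X_def E_scale by (simp only: axis_scale mult_zero_right)
qed

lemma Y_comm:
  fixes p :: "'n::finite idx" and y :: 'a
  assumes "gp p r" "\<alpha> \<in> Delta_max R"
  defines "s \<equiv> kap (- p) * y"
  shows "X (- p) r y *v axis 0 x = axis 0 x"
    "E (axis p 1 + s *s axis r 1) (axis 0 (fst \<alpha>)) (br (snd \<alpha>))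
      = X r p (br (snd \<alpha>) * br s) ** Y r (\<alpha> \<odot> br s) ** Y p \<alpha>"
proof -
  obtain x z where \<alpha>: "\<alpha> = (x, z)" by (cases \<alpha>)
  note ne = gpD[OF assms(1)]
  show "X (- p) r y *v axis 0 x = axis 0 x" for x
    using ne by (simp add: X_def E_apply B_axis_axis)
  have z: "br (br z) = - lm * br z - B (axis 0 x) (axis 0 x)"
    using assms(2) by (auto simp: Delta_max_def \<alpha> B_axis_axis algebra_simps eq_neg_iff_add_eq_0)
  have 1: "E (s *s axis r 1) (axis 0 x + br z *s axis p 1) (br z)
      = E (axis r 1) (axis p (br z * br s) + axis 0 (x * br s)) (br (br (br s) * z * br s))"
    unfolding E_scale by (simp add: axis_scale vector_add_ldistrib mult_ac add.commute)
  have "E (axis p 1 + s *s axis r 1) (axis 0 x) (br z)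
      = E (s *s axis r 1) (axis 0 x + br z *s axis p 1) (br z) ** E (axis p 1) (axis 0 x) (br z)"
    using ne z by (subst E_base_add) (simp_all add: B_axis_axis)
  also have "E (s *s axis r 1) (axis 0 x + br z *s axis p 1) (br z)
      = E (axis r 1) (axis p (br z * br s)) 0 ** E (axis r 1) (axis 0 (x * br s)) (br (br (br s) * z * br s))"
    unfolding 1 using ne by (subst E_mult) (simp_all add: B_axis_axis)
  finally show "E (axis p 1 + s *s axis r 1) (axis 0 (fst \<alpha>)) (br (snd \<alpha>))
      = X r p (br (snd \<alpha>) * br s) ** Y r (\<alpha> \<odot> br s) ** Y p \<alpha>"
    by (simp add: \<alpha> X_def Y_def ci_eq)
qed

end

text \<open>The normalisation hypothesis in terms of transvections. For \<open>r = p\<close> it covers the long root elements.\<close>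

locale normalized_subgroup = unitary_subgroup R \<Delta> H
  for R :: "'a::comm_ring_1 hermitian" and \<Delta> and H :: "('a, 'n::finite) matrix set" +
  fixes I :: "'a set"
  assumes card: "CARD('n) \<ge> 4"
    and I: "ring_ideal I"
    and I_br: "x \<in> I \<Longrightarrow> br x \<in> I"
    and X_norm: "p \<noteq> 0 \<Longrightarrow> r \<noteq> 0 \<Longrightarrow> r \<noteq> - p \<Longrightarrow> x \<in> I \<Longrightarrow> X p r x \<in> normalizer G H"
    and Y_norm: "p \<noteq> 0 \<Longrightarrow> \<alpha> \<in> \<Delta> \<Longrightarrow> x \<in> I \<Longrightarrow> Y p (\<alpha> \<odot> x) \<in> normalizer G H"
begin

sublocale G: group "G :: ('a, 'n) matrix monoid"
  by (rule group_G)

abbreviation N :: "('a, 'n) matrix set" where "N \<equiv> normalizer G H"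

lemma subgroup_N: "subgroup N G"
  by (rule G.normalizer_imp_subgroup[OF subgroup.subset[OF H]])

lemma N_G: "g \<in> N \<Longrightarrow> g \<in> carrier G"
  using subgroup.subset[OF subgroup_N] by auto

lemma H_mult: "g \<in> H \<Longrightarrow> k \<in> H \<Longrightarrow> g ** k \<in> H"
  using subgroup.m_closed[OF H] by simp

lemma H_inv: "g \<in> H \<Longrightarrow> inv\<^bsub>G\<^esub> g \<in> H"
  by (rule subgroup.m_inv_closed[OF H])

lemma H_one: "mat 1 \<in> H"
  using subgroup.one_closed[OF H] by simp

lemma H_cancel:
  assumes "g \<in> H" "g ** k \<in> H"
  shows "k \<in> H"
proof -
  have "k = inv\<^bsub>G\<^esub> g ** (g ** k)"
    by (simp add: matrix_mul_assoc inv_G[OF H_G[OF assms(1)]])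
  then show ?thesis
    using H_mult[OF H_inv[OF assms(1)] assms(2)] by simp
qed

lemma H_cancel_right:
  assumes "k \<in> H" "g ** k \<in> H"
  shows "g \<in> H"
proof -
  have "g = (g ** k) ** inv\<^bsub>G\<^esub> k"
    by (simp add: inv_G[OF H_G[OF assms(1)]] flip: matrix_mul_assoc)
  then show ?thesis
    using H_mult[OF assms(2) H_inv[OF assms(1)]] by simp
qed

lemma pick:
  assumes "a \<noteq> 0" "b \<noteq> 0" "c \<noteq> 0"
  obtains k :: "'n idx" where "gp k a" "gp k b" "gp k c"
  using gp_exists[OF card assms] by blast

abbreviation Ik where "Ik \<equiv> ideal_power I"

lemmas Ik = ring_ideal_power[of I]

lemma Ik_Suc_mem: "y \<in> I \<Longrightarrow> w \<in> Ik m \<Longrightarrow> y * w \<in> Ik (Suc m)"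
  by (simp add: ideal_power_Suc ideal_mult_base)

lemma Ik_induct [consumes 1, case_names mult zero add]:
  assumes "x \<in> Ik (Suc m)" "\<And>a b. a \<in> I \<Longrightarrow> b \<in> Ik m \<Longrightarrow> P (a * b)" "P 0" "\<And>x y. P x \<Longrightarrow> P y \<Longrightarrow> P (x + y)"
  shows "P x"
  using assms(1) unfolding ideal_power_Suc by (rule ideal_gen_additive_induct[OF _ I]) (use assms in auto)

lemma Ik_Suc_subset: "Ik (Suc m) \<subseteq> Ik m"
proof
  fix x assume "x \<in> Ik (Suc m)"
  then show "x \<in> Ik m"
    by (induction rule: Ik_induct) (simp_all add: ideal_scale[OF Ik] ideal_add[OF Ik] ideal_0[OF Ik])
qed

lemma Ik_mono: "m \<le> m' \<Longrightarrow> Ik m' \<subseteq> Ik m"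
  by (induction rule: dec_induct) (use Ik_Suc_subset in auto)

lemma Ik_0 [simp]: "Ik 0 = UNIV"
  by (simp add: ideal_power_def)

lemma Ik_br: "w \<in> Ik m \<Longrightarrow> br w \<in> Ik m"
proof (induction m arbitrary: w)
  case (Suc m)
  from Suc.prems show ?case
    by (induction rule: Ik_induct) (simp_all add: Ik_Suc_mem I_br Suc.IH ideal_add[OF Ik] ideal_0[OF Ik])
qed simp

text \<open>Membership in \<open>H\<close> can only be moved from one position to another by commutators with matrices over
  \<open>I\<close>. The index \<open>m\<close> counts the powers of \<open>I\<close> that are lost.\<close>

definition L :: "nat \<Rightarrow> 'n idx \<Rightarrow> 'n idx \<Rightarrow> 'a set" where
  "L m p r = {a. \<forall>w\<in>Ik m. X p r (a * w) \<in> H}"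

lemma LD: "a \<in> L m p r \<Longrightarrow> w \<in> Ik m \<Longrightarrow> X p r (a * w) \<in> H"
  by (simp add: L_def)

lemma L_ideal:
  assumes "gp p r"
  shows "ring_ideal (L m p r)"
proof (rule ring_idealI)
  note ne = gpD[OF assms]
  show "0 \<in> L m p r"
    by (simp add: L_def X_0 H_one)
  show "x + y \<in> L m p r" if "x \<in> L m p r" "y \<in> L m p r" for x y
    using that H_mult ne by (auto simp: L_def distrib_right simp flip: X_add)
  show "c * x \<in> L m p r" if "x \<in> L m p r" for c x
  proof -
    have "X p r (c * x * w) \<in> H" if "w \<in> Ik m" for w
      using LD[OF \<open>x \<in> L m p r\<close> ideal_scale[OF Ik that, of c]] by (simp add: mult_ac)
    then show ?thesis by (simp add: L_def)
  qed
qed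

lemma L_swap:
  assumes "gp p r" "a \<in> L m p r"
  shows "br a \<in> L m r p"
proof -
  have "X r p (br a * w) \<in> H" if w: "w \<in> Ik m" for w
  proof -
    have "X r p (br a * w) = X p r (a * (- lmi * br w))"
      using gpD[OF assms(1)] by (subst X_swap) (simp_all add: mult_ac)
    then show ?thesis
      using LD[OF assms(2) ideal_scale[OF Ik Ik_br[OF w], of "- lmi"]] by simp
  qed
  then show ?thesis by (simp add: L_def)
qed

lemma L_mono: "m \<le> m' \<Longrightarrow> a \<in> L m p r \<Longrightarrow> a \<in> L m' p r"
  using Ik_mono by (auto simp: L_def)

text \<open>The commutator with \<open>X (- p) p' y\<close>, where \<open>y \<in> I\<close>, replaces the index \<open>p\<close> by \<open>p'\<close> and multiplies the
  coefficient by \<open>y\<close>. The case \<open>r = p'\<close> is included; it yields long root elements.\<close>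

lemma L_move_aux:
  assumes a: "a \<in> L m p r" and g: "gp p p'" "gp p r" "r \<noteq> - p'" and w: "w \<in> Ik (Suc m)"
  shows "X p' r (a * w) \<in> H"
  using w
proof (induction rule: Ik_induct)
  case (mult y v)
  note ne = gpD[OF g(1)] gpD[OF g(2)]
  define y' where "y' = br (kap (- p)) * br y"
  have y': "y' \<in> I"
    unfolding y'_def by (rule ideal_scale[OF I I_br[OF mult(1)]])
  have N: "X (- p) p' y' \<in> N"
    using ne y' by (intro X_norm) auto
  have s: "br (kap (- p) * y') * (a * v) = a * (y * v)"
    by (simp add: y'_def mult_ac)
  have "commutator G (X (- p) p' y') (X p r (a * v)) = X p' r (a * (y * v))"
  proof (rule G.commutator_eqI)
    have "X (- p) p' y' ** X p r (a * v) ** inv\<^bsub>G\<^esub> (X (- p) p' y')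
        = E (axis p 1 + (kap (- p) * y') *s axis p' 1) (axis r (a * v)) 0"
      unfolding X_def[of p r] G_E_conj[OF N_G[OF N]] using X_comm(1,2)[OF g ne(2), of y'] by simp
    then show "X (- p) p' y' \<otimes>\<^bsub>G\<^esub> X p r (a * v) \<otimes>\<^bsub>G\<^esub> inv\<^bsub>G\<^esub> X (- p) p' y' = X p' r (a * (y * v)) \<otimes>\<^bsub>G\<^esub> X p r (a * v)"
      using X_comm(3)[OF g ne(2), of y' "a * v"] by (simp only: mult_G s)
  qed (use N_G[OF N] ne g in \<open>auto intro!: X_in_G\<close>)
  then show ?case
    using G.commutator_H(1)[OF H N LD[OF a mult(2)]] by simp
next
  case (add x y)
  then show ?case
    using H_mult gpD[OF g(1)] gpD[OF g(2)] g(3) by (simp add: distrib_left flip: X_add)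
qed (simp add: X_0 H_one)

lemma L_move1: "a \<in> L m p r \<Longrightarrow> gp p r \<Longrightarrow> gp p p' \<Longrightarrow> gp p' r \<Longrightarrow> a \<in> L (Suc m) p' r"
  using L_move_aux[of a m p r p'] gpD[of p' r] by (auto simp: L_def)

lemma L_move2:
  assumes "a \<in> L m p r" "gp p r" "gp r r'" "gp p r'"
  shows "a \<in> L (Suc m) p r'"
proof -
  have "br a \<in> L (Suc m) r' p"
    by (rule L_move1[OF L_swap[OF assms(2,1)]]) (use assms in \<open>simp_all add: gp_sym\<close>)
  from L_swap[OF _ this] show ?thesis
    using assms by (simp add: gp_sym)
qed

lemma L_long:
  assumes "a \<in> L m p r" "gp p r" "w \<in> Ik (Suc m)"
  shows "Y r (0, zz (br (a * w))) \<in> H"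
  using L_move_aux[OF assms(1), of r w] assms gpD[OF assms(2)] by (simp add: X_long)

definition LL :: "nat \<Rightarrow> 'a set" where
  "LL m = {a. \<forall>p r. gp p r \<longrightarrow> a \<in> L m p r}"

lemma LL_L: "a \<in> LL m \<Longrightarrow> gp p r \<Longrightarrow> a \<in> L m p r"
  by (simp add: LL_def)

lemma LL_ideal: "ring_ideal (LL m)"
  unfolding LL_def using L_ideal
  by (intro ring_idealI) (auto intro: ideal_0 ideal_add ideal_scale)

lemma LL_br: "a \<in> LL m \<Longrightarrow> br a \<in> LL m"
  unfolding LL_def using L_swap by (auto simp: gp_sym)

lemma LL_mono: "m \<le> m' \<Longrightarrow> a \<in> LL m \<Longrightarrow> a \<in> LL m'"
  using L_mono by (auto simp: LL_def)

lemma LL_X: "a \<in> LL m \<Longrightarrow> w \<in> Ik m \<Longrightarrow> gp p r \<Longrightarrow> X p r (a * w) \<in> H"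
  by (intro LD LL_L)

lemma LL_long:
  assumes "a \<in> LL m" "w \<in> Ik (Suc m)" "r \<noteq> 0"
  shows "Y r (0, zz (a * w)) \<in> H"
proof -
  obtain p where p: "gp p r"
    using pick[OF assms(3) assms(3) assms(3)] by blast
  from L_long[OF LL_L[OF LL_br[OF assms(1)] p] p Ik_br[OF assms(2)]] show ?thesis
    by simp
qed

lemma Y_hp_H: "r \<noteq> 0 \<Longrightarrow> Y r \<alpha> \<in> H \<Longrightarrow> Y r \<beta> \<in> H \<Longrightarrow> Y r (\<alpha> \<boxplus> \<beta>) \<in> H"
  using H_mult[of "Y r \<beta>" "Y r \<alpha>"] by (simp add: Y_hp)

text \<open>The commutator of \<open>X (- p) r y\<close> and \<open>Y p \<alpha>\<close> is the product of the wanted matrix and of the short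
  root element in the last assumption.\<close>

lemma Y_move:
  assumes "gp p r" "\<alpha> \<in> \<Delta>" "commutator G (X (- p) r y) (Y p \<alpha>) \<in> H"
    "X r p (br (snd \<alpha>) * br (kap (- p) * y)) \<in> H"
  shows "Y r (\<alpha> \<odot> br (kap (- p) * y)) \<in> H"
proof -
  note ne = gpD[OF assms(1)]
  define s where "s = kap (- p) * y"
  have X: "X (- p) r y \<in> carrier G"
    using ne by (intro X_in_G) auto
  have \<alpha>: "\<alpha> \<in> Delta_max R"
    using Delta_max assms(2) by auto
  have e: "X (- p) r y *v axis p 1 = axis p 1 + s *s axis r 1"
    using ne by (simp add: X_def E_apply B_axis_axis axis_scale s_def mult_ac)
  have "commutator G (X (- p) r y) (Y p \<alpha>) = X r p (br (snd \<alpha>) * br s) ** Y r (\<alpha> \<odot> br s)"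
  proof (rule G.commutator_eqI[OF X])
    have "X (- p) r y ** Y p \<alpha> ** inv\<^bsub>G\<^esub> (X (- p) r y)
        = E (axis p 1 + s *s axis r 1) (axis 0 (fst \<alpha>)) (br (snd \<alpha>))"
      unfolding Y_def G_E_conj[OF X] e Y_comm(1)[OF assms(1) \<alpha>] ..
    then show "X (- p) r y \<otimes>\<^bsub>G\<^esub> Y p \<alpha> \<otimes>\<^bsub>G\<^esub> inv\<^bsub>G\<^esub> X (- p) r y
        = (X r p (br (snd \<alpha>) * br s) ** Y r (\<alpha> \<odot> br s)) \<otimes>\<^bsub>G\<^esub> Y p \<alpha>"
      using Y_comm(2)[OF assms(1) \<alpha>, of y] by (simp add: s_def)
    show "X r p (br (snd \<alpha>) * br s) ** Y r (\<alpha> \<odot> br s) \<in> carrier G"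
      unfolding mult_G[symmetric] using ne by (intro G.m_closed X_in_G Y_in_G D.ci_mem assms) auto
  qed (use ne assms in \<open>auto intro: Y_in_G\<close>)
  then show ?thesis
    using H_cancel[OF assms(4)[folded s_def]] assms(3) by (simp add: s_def)
qed

text \<open>Here the roles in \<open>Y_move\<close> are interchanged: the short root element lies in \<open>H\<close> and the extra short one
  in the normaliser.\<close>

lemma LL_Y:
  assumes a: "a \<in> LL m" and "\<alpha> \<in> \<Delta>" "r \<noteq> 0" and w: "w \<in> Ik (Suc m)"
  shows "Y r (\<alpha> \<odot> (a * w)) \<in> H"
proof -
  have "w \<in> Ik (Suc m) \<and> Y r (\<alpha> \<odot> (a * w)) \<in> H"
    using w
  proof (induction rule: Ik_induct)
    case (mult y v)
    obtain p where p: "gp p r"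
      using pick[OF assms(3) assms(3) assms(3)] by blast
    note ne = gpD[OF p]
    define b where "b = br (kap (- p)) * br (a * v)"
    have s: "br (kap (- p) * b) = a * v"
      by (simp add: b_def)
    have "b = br a * (br (kap (- p)) * br v)"
      by (simp add: b_def mult_ac)
    then have XH: "X (- p) r b \<in> H"
      using LL_X[OF LL_br[OF a] ideal_scale[OF Ik Ik_br[OF mult(2)]]] p by simp
    have "commutator G (X (- p) r b) (Y p (\<alpha> \<odot> y)) \<in> H"
      by (rule G.commutator_H(2)[OF H Y_norm XH]) (use ne assms mult in auto)
    moreover have "X r p (br (snd (\<alpha> \<odot> y)) * br (kap (- p) * b)) \<in> H"
      unfolding s using LL_X[OF a ideal_scale[OF Ik mult(2)], of r p "br (snd (\<alpha> \<odot> y))"] p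
      by (simp add: gp_sym mult_ac)
    ultimately have "Y r (\<alpha> \<odot> y \<odot> (a * v)) \<in> H"
      using Y_move[OF p D.ci_mem[OF assms(2)], of b y] by (simp only: s)
    then show ?case
      using Ik_Suc_mem[OF mult] by (simp add: ci_ci mult_ac)
  next
    case zero
    show ?case
      by (cases \<alpha>) (simp add: ci_eq Y_0 H_one ideal_0[OF Ik])
  next
    case (add u v)
    obtain x z where \<alpha>: "\<alpha> = (x, z)" by (cases \<alpha>)
    have "(x, z) \<in> Delta_max R"
      using assms(2) Delta_max \<alpha> by auto
    note ci_add[OF this, of "a * u" "a * v"]
    moreover have "Y r (0, zz (br (a * v) * z * (a * u))) \<in> H"
      using LL_long[OF a ideal_scale[OF Ik, of u "Suc m" "br (a * v) * z"] assms(3)] add by (simp add: mult_ac)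
    ultimately show ?case
      using add Y_hp_H[OF assms(3)] ideal_add[OF Ik] by (simp add: \<alpha> distrib_left)
  qed
  then show ?thesis by simp
qed

end


section \<open>Extraction of root elements\<close>

context normalized_subgroup
begin

lemma isom_N: "g \<in> N \<Longrightarrow> B (g *v u) (g *v v) = B u v"
  by (rule G_isom[OF N_G])

lemma conj_N: "g \<in> N \<Longrightarrow> g ** E e v z ** inv\<^bsub>G\<^esub> g = E (g *v e) (g *v v) z"
  by (rule G_E_conj[OF N_G])

lemma axis_1_scale: "axis p x = x *s axis p (1 :: 'a)"
  by (simp add: axis_scale)

text \<open>The commutator of \<open>r\<close> with the commutator of \<open>t'\<close> and a conjugate of \<open>t\<close> is computed twice. For
  the conjugate by \<open>\<sigma> \<tau> \<sigma>\<^sup>-\<^sup>1\<close> the matrix \<open>t\<close> is read as a transvection along the basis vector of index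
  \<open>-a\<close>, which is fixed. The commutator with \<open>t'\<close> then only retains a long root element at the index
  \<open>-a\<close>, whatever \<open>\<sigma>\<close> is, and this commutes with \<open>r\<close>. For the conjugate by \<open>\<tau>\<close> the matrix \<open>t\<close> is read as a
  transvection along the basis vector of index \<open>k\<close>, which is fixed by \<open>\<tau>\<close>; the result is the
  transvection in the conclusion.\<close>

lemma transvection_extraction:
  fixes a b c k m :: "'n idx"
  assumes s: "\<sigma> \<in> H" and \<tau>: "\<tau> \<in> N"
    and fx: "(\<sigma> ** \<tau> ** inv\<^bsub>G\<^esub> \<sigma>) *v axis (- a) 1 = axis (- a) 1"
    and \<tau>k: "\<tau> *v axis k 1 = axis k 1"
    and \<tau>a: "\<tau> *v axis (- a) 1 = axis (- a) 1 + axis a da + axis b db + axis c dc"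
    and gps: "gp a b" "gp a c" "gp b c" "gp k a" "gp k b" "gp k c" "gp m a" "gp m b" "gp m k"
    and yzw: "y \<in> I" "z \<in> I" "w \<in> I"
  defines "f \<equiv> axis (- b) (z * kap (- a) * da) - axis (- a) (lmi * kap (- b) * br z * db)"
    and "om \<equiv> - lmi * kap (- k) * br w"
  shows "\<exists>\<zeta>. (da = 0 \<longrightarrow> \<zeta> = 0) \<and> br \<zeta> = - lm * \<zeta>
    \<and> E (om *s axis m 1) (y *s f + \<zeta> *s axis k 1) \<zeta> \<in> H"
proof -
  note ne = gps[THEN gpD(1)] gps[THEN gpD(2)] gps[THEN gpD(3)] gps[THEN gpD(4)] gps[THEN gpD(5)]
    gps[THEN gpD(6)] gps[THEN gpD(7)] gps[THEN gpD(8)]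
  define t where "t = X k (- a) y"
  define t' where "t' = X (- a) (- b) z"
  define r where "r = X m (- k) w"
  have N: "t \<in> N" "t' \<in> N" "r \<in> N"
    unfolding t_def t'_def r_def using ne yzw by (auto intro!: X_norm)
  note NG = N[THEN N_G] N_G[OF \<tau>]
  have t': "t' *v v = v + axis (- b) (z * kap (- a) * v $ a) - axis (- a) (lmi * kap (- b) * br z * v $ b)" for v
    unfolding t'_def using ne by (simp add: X_apply)
  have r: "r *v v = v + axis (- k) (w * kap m * v $ (- m)) - axis m (lmi * kap (- k) * br w * v $ k)" for v
    unfolding r_def using ne by (simp add: X_apply)
  define p where "p = axis (- a) 1 + axis a da + axis b db + axis c dc"
  have p_nth: "p $ a = da" "p $ b = db"
    using ne by (simp_all add: p_def axis_nth_if)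
  have pp: "B p p = 0"
    using isom_N[OF \<tau>, of "axis (- a) 1" "axis (- a) 1"] ne by (simp add: \<tau>a p_def[symmetric] B_axis_axis)
  have kp: "B (axis k 1) p = 0"
    using ne by (simp add: p_def B_axis_axis)
  have kk: "B (axis k 1) (axis k 1) = 0" and kf: "B (axis k 1) f = 0" and ff: "B f f = 0"
    using ne by (simp_all add: f_def B_axis_axis)
  have t'p: "t' *v p = p + f"
    by (simp add: t' p_nth f_def)
  have pf: "B p f = - B f p"
    using isom_N[OF N(2), of p p] by (simp add: t'p pp ff eq_neg_iff_add_eq_0 add.commute)
  have fp: "da = 0 \<Longrightarrow> B f p = 0"
    using ne p_nth by (simp add: f_def B_axis_left)
  define \<zeta> where "\<zeta> = lmi * br y * y * B f p"
  have br\<zeta>: "br \<zeta> = - lm * \<zeta>"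
  proof -
    have "lm * br (B f p) = B p f"
      using B_swap[of p f] by (simp add: mult.commute)
    moreover have "br \<zeta> = y * br y * (lm * br (B f p))"
      by (simp add: \<zeta>_def mult_ac)
    ultimately have "br \<zeta> = y * br y * (- B f p)"
      by (simp only: pf)
    also have "\<dots> = - (y * br y * B f p)"
      by simp
    also have "y * br y * B f p = lm * \<zeta>"
      unfolding \<zeta>_def mult.assoc lm_lmi_assoc by (simp only: mult_ac)
    finally show ?thesis by simp
  qed
  \<comment> \<open>the element on the side of \<open>\<tau>\<close>\<close>
  have g1: "\<tau> \<otimes>\<^bsub>G\<^esub> t \<otimes>\<^bsub>G\<^esub> inv\<^bsub>G\<^esub> \<tau> = E (axis k 1) (y *s p) 0"
    using conj_N[OF \<tau>, of "axis k 1" "axis (- a) y" 0]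
    by (simp add: t_def X_def axis_1_scale[of _ y] mult_vec_scale \<tau>k \<tau>a p_def)
  have g1G: "E (axis k 1) (y *s p) 0 \<in> carrier G"
    unfolding g1[symmetric] by (intro G.m_closed G.inv_closed NG)
  have c1: "commutator G t' (\<tau> \<otimes>\<^bsub>G\<^esub> t \<otimes>\<^bsub>G\<^esub> inv\<^bsub>G\<^esub> \<tau>) = E (axis k 1) (y *s f) \<zeta>"
  proof (unfold g1, rule G.commutator_eqI[OF NG(2) g1G])
    have t'k: "t' *v axis k 1 = axis k 1"
      using ne by (simp add: t' axis_nth_if)
    have e1: "t' ** E (axis k 1) (y *s p) 0 ** inv\<^bsub>G\<^esub> t' = E (axis k 1) (y *s (p + f)) 0"
      unfolding conj_N[OF N(2)] t'k mult_vec_scale t'p ..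
    have e2: "E (axis k 1) (y *s f) \<zeta> ** E (axis k 1) (y *s p) 0 = E (axis k 1) (y *s (p + f)) 0"
      by (subst E_mult) (simp_all add: kk kf kp \<zeta>_def vector_add_ldistrib add.commute mult_ac)
    show "t' \<otimes>\<^bsub>G\<^esub> E (axis k 1) (y *s p) 0 \<otimes>\<^bsub>G\<^esub> inv\<^bsub>G\<^esub> t' = E (axis k 1) (y *s f) \<zeta> \<otimes>\<^bsub>G\<^esub> E (axis k 1) (y *s p) 0"
      using e1 e2 by simp
    have "E (axis k 1) (y *s f) \<zeta> = (t' ** E (axis k 1) (y *s p) 0 ** inv\<^bsub>G\<^esub> t') ** inv\<^bsub>G\<^esub> (E (axis k 1) (y *s p) 0)"
      unfolding e1 e2[symmetric] by (simp add: inv_G[OF g1G] flip: matrix_mul_assoc)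
    then show "E (axis k 1) (y *s f) \<zeta> \<in> carrier G"
      using G.m_closed G.inv_closed NG g1G by (metis mult_G)
  qed
  have c1G: "E (axis k 1) (y *s f) \<zeta> \<in> carrier G"
    unfolding c1[symmetric] by (intro G.commutator_closed G.m_closed G.inv_closed NG)
  have c2: "commutator G r (E (axis k 1) (y *s f) \<zeta>) = E (om *s axis m 1) (y *s f + \<zeta> *s axis k 1) \<zeta>"
  proof (rule G.commutator_eqI[OF NG(3) c1G])
    have rk: "r *v axis k 1 = axis k 1 + om *s axis m 1" and rf: "r *v f = f"
      using ne by (simp_all add: r om_def f_def axis_nth_if axis_scale axis_minus[symmetric])
    have e1: "r ** E (axis k 1) (y *s f) \<zeta> ** inv\<^bsub>G\<^esub> r = E (axis k 1 + om *s axis m 1) (y *s f) \<zeta>"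
      unfolding conj_N[OF N(3)] mult_vec_scale rk rf ..
    have e2: "E (axis k 1 + om *s axis m 1) (y *s f) \<zeta>
        = E (om *s axis m 1) (y *s f + \<zeta> *s axis k 1) \<zeta> ** E (axis k 1) (y *s f) \<zeta>"
    proof (rule E_base_add)
      show "br \<zeta> = - lm * \<zeta> - B (y *s f) (y *s f)"
        by (simp add: br\<zeta> ff)
    qed (use ne in \<open>simp_all add: kf f_def B_axis_axis\<close>)
    show "r \<otimes>\<^bsub>G\<^esub> E (axis k 1) (y *s f) \<zeta> \<otimes>\<^bsub>G\<^esub> inv\<^bsub>G\<^esub> r
        = E (om *s axis m 1) (y *s f + \<zeta> *s axis k 1) \<zeta> \<otimes>\<^bsub>G\<^esub> E (axis k 1) (y *s f) \<zeta>"
      using e1 e2 by simp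
    have "E (om *s axis m 1) (y *s f + \<zeta> *s axis k 1) \<zeta>
        = (r ** E (axis k 1) (y *s f) \<zeta> ** inv\<^bsub>G\<^esub> r) ** inv\<^bsub>G\<^esub> (E (axis k 1) (y *s f) \<zeta>)"
      unfolding e1 e2 by (simp add: inv_G[OF c1G] flip: matrix_mul_assoc)
    then show "E (om *s axis m 1) (y *s f + \<zeta> *s axis k 1) \<zeta> \<in> carrier G"
      using G.m_closed G.inv_closed NG c1G by (metis mult_G)
  qed
  \<comment> \<open>the element on the side of \<open>\<sigma> \<tau> \<sigma>\<^sup>-\<^sup>1\<close>, which fixes the basis vector of index \<open>-a\<close>\<close>
  define \<xi> where "\<xi> = \<sigma> \<otimes>\<^bsub>G\<^esub> \<tau> \<otimes>\<^bsub>G\<^esub> inv\<^bsub>G\<^esub> \<sigma>"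
  have \<xi>G: "\<xi> \<in> carrier G"
    unfolding \<xi>_def by (intro G.m_closed G.inv_closed NG H_G[OF s])
  have \<xi>a: "\<xi> *v axis (- a) 1 = axis (- a) 1"
    using fx by (simp add: \<xi>_def)
  define v where "v = \<xi> *v axis k (- lmi * br y)"
  have g2: "\<xi> \<otimes>\<^bsub>G\<^esub> t \<otimes>\<^bsub>G\<^esub> inv\<^bsub>G\<^esub> \<xi> = E (axis (- a) 1) v 0"
  proof -
    have "t = E (axis (- a) 1) (axis k (- lmi * br y)) 0"
      using ne X_swap[of k "- a" y] by (simp add: t_def X_def)
    then show ?thesis
      using G_E_conj[OF \<xi>G] by (simp add: \<xi>a v_def)
  qed
  have g2G: "E (axis (- a) 1) v 0 \<in> carrier G"
    unfolding g2[symmetric] by (intro G.m_closed G.inv_closed NG \<xi>G)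
  have aa: "B (axis (- a) 1) (axis (- a) 1) = 0"
    using ne by (simp add: B_axis_axis)
  have av: "B (axis (- a) 1) v = 0"
    using G_isom[OF \<xi>G, of "axis (- a) 1" "axis k (- lmi * br y)"] ne by (simp add: \<xi>a v_def B_axis_axis)
  have "v $ a = br (kap (- a)) * B (axis (- a) 1) v"
    using ne by (simp add: B_axis_left)
  then have va: "v $ a = 0"
    unfolding av by simp
  define \<eta> where "\<eta> = - (lmi * kap (- b) * br z * v $ b)"
  have t'v: "t' *v v = v + \<eta> *s axis (- a) 1"
    by (simp add: t' va \<eta>_def axis_scale axis_minus[symmetric])
  have t'a: "t' *v axis (- a) 1 = axis (- a) 1"
    using ne by (simp add: t' axis_nth_if)
  define C where "C = E (axis (- a) 1) (\<eta> *s axis (- a) 1) 0"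
  have C: "commutator G t' (\<xi> \<otimes>\<^bsub>G\<^esub> t \<otimes>\<^bsub>G\<^esub> inv\<^bsub>G\<^esub> \<xi>) = C" and CG: "C \<in> carrier G"
  proof -
    have e1: "t' ** E (axis (- a) 1) v 0 ** inv\<^bsub>G\<^esub> t' = E (axis (- a) 1) (v + \<eta> *s axis (- a) 1) 0"
      unfolding conj_N[OF N(2)] t'a t'v ..
    have e2: "E (axis (- a) 1) (v + \<eta> *s axis (- a) 1) 0 = C ** E (axis (- a) 1) v 0"
      unfolding C_def by (subst E_mult) (simp_all add: aa av add.commute)
    have "C = (t' ** E (axis (- a) 1) v 0 ** inv\<^bsub>G\<^esub> t') ** inv\<^bsub>G\<^esub> (E (axis (- a) 1) v 0)"
      unfolding e1 e2 by (simp add: inv_G[OF g2G] flip: matrix_mul_assoc)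
    then show "C \<in> carrier G"
      using G.m_closed G.inv_closed NG g2G by (metis mult_G)
    then show "commutator G t' (\<xi> \<otimes>\<^bsub>G\<^esub> t \<otimes>\<^bsub>G\<^esub> inv\<^bsub>G\<^esub> \<xi>) = C"
      unfolding g2 using e1 e2 by (intro G.commutator_eqI NG g2G) simp_all
  qed
  have "commutator G r C = \<one>\<^bsub>G\<^esub>"
  proof (rule G.commutator_eqI[OF NG(3) CG])
    have "r *v axis (- a) 1 = axis (- a) 1"
      using ne by (simp add: r axis_nth_if)
    then have "r ** C ** inv\<^bsub>G\<^esub> r = C"
      unfolding C_def conj_N[OF N(3)] mult_vec_scale by simp
    then show "r \<otimes>\<^bsub>G\<^esub> C \<otimes>\<^bsub>G\<^esub> inv\<^bsub>G\<^esub> r = \<one>\<^bsub>G\<^esub> \<otimes>\<^bsub>G\<^esub> C"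
      by simp
  qed (rule G.one_closed)
  then have "commutator G r (commutator G t' (\<tau> \<otimes>\<^bsub>G\<^esub> t \<otimes>\<^bsub>G\<^esub> inv\<^bsub>G\<^esub> \<tau>)) \<in> H"
    using C by (intro G.double_commutator_in[OF H s \<tau> N]) (simp only: \<xi>_def)
  then have "E (om *s axis m 1) (y *s f + \<zeta> *s axis k 1) \<zeta> \<in> H"
    unfolding c1 c2 .
  moreover have "da = 0 \<longrightarrow> \<zeta> = 0"
    by (simp add: \<zeta>_def fp)
  ultimately show ?thesis
    using br\<zeta> by blast
qed

text \<open>For \<open>da = 0\<close> the direction of the transvection in \<open>transvection_extraction\<close> is a multiple of one basis
  vector.\<close>

lemma extraction_short:
  fixes a b c k m :: "'n idx"
  assumes "\<sigma> \<in> H" "\<tau> \<in> N" "(\<sigma> ** \<tau> ** inv\<^bsub>G\<^esub> \<sigma>) *v axis (- a) 1 = axis (- a) 1"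
    "\<tau> *v axis k 1 = axis k 1"
    "\<tau> *v axis (- a) 1 = axis (- a) 1 + axis a 0 + axis b db + axis c dc"
    and gps: "gp a b" "gp a c" "gp b c" "gp k a" "gp k b" "gp k c" "gp m a" "gp m b" "gp m k"
    and yzw: "y \<in> I" "z \<in> I" "w \<in> I"
  shows "X m (- a) (db * (y * (z * w))) \<in> H"
proof -
  define w' where "w' = kap (- k) * br (kap (- b)) * w"
  have "w' \<in> I" "br z \<in> I"
    using yzw by (simp_all add: w'_def ideal_scale[OF I] I_br)
  from transvection_extraction[OF assms(1-5) gps yzw(1) this(2,1)]
  have "E ((- lmi * kap (- k) * br w') *s axis m 1) (y *s - axis (- a) (lmi * kap (- b) * z * db)) 0 \<in> H"
    by auto
  moreover have "E ((- lmi * kap (- k) * br w') *s axis m 1) (y *s - axis (- a) (lmi * kap (- b) * z * db)) 0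
      = X m (- a) (db * (y * (z * w)))"
    unfolding E_scale
    by (simp add: X_def w'_def axis_scale axis_minus mult_ac)
  ultimately show ?thesis by simp
qed

text \<open>In general a further commutator, with \<open>X k a\<close>, singles out the coordinate at index \<open>-a\<close>.\<close>

lemma extraction_long:
  fixes a b c k m :: "'n idx"
  assumes "\<sigma> \<in> H" "\<tau> \<in> N" "(\<sigma> ** \<tau> ** inv\<^bsub>G\<^esub> \<sigma>) *v axis (- a) 1 = axis (- a) 1"
    "\<tau> *v axis k 1 = axis k 1"
    "\<tau> *v axis (- a) 1 = axis (- a) 1 + axis a da + axis b db + axis c dc"
    and gps: "gp a b" "gp a c" "gp b c" "gp k a" "gp k b" "gp k c" "gp m a" "gp m b" "gp m k"
    and yzw: "y \<in> I" "z \<in> I" "w \<in> I" "x \<in> I"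
  shows "X m k (db * (y * (z * (w * x)))) \<in> H"
proof -
  note ne = gps[THEN gpD(1)] gps[THEN gpD(2)] gps[THEN gpD(3)] gps[THEN gpD(4)] gps[THEN gpD(5)]
    gps[THEN gpD(6)] gps[THEN gpD(7)] gps[THEN gpD(8)]
  define w' where "w' = - lm * kap (- k) * br (kap a) * br (kap (- b)) * w"
  have w': "w' \<in> I" "br z \<in> I"
    using yzw by (simp_all add: w'_def ideal_scale[OF I] I_br ideal_neg[OF I])
  define f where "f = axis (- b) (br z * kap (- a) * da) - axis (- a) (lmi * kap (- b) * z * db)"
  define om where "om = - lmi * kap (- k) * br w'"
  obtain \<zeta> where \<zeta>: "br \<zeta> = - lm * \<zeta>" "E (om *s axis m 1) (y *s f + \<zeta> *s axis k 1) \<zeta> \<in> H"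
    using transvection_extraction[OF assms(1-5) gps yzw(1) w'(2,1)] by (auto simp: f_def om_def)
  define V where "V = y *s f + \<zeta> *s axis k 1"
  define r where "r = X k a (br x)"
  have r: "r \<in> N"
    unfolding r_def using ne yzw by (intro X_norm I_br) auto
  define A where "A = lmi * kap a * x * (y * (lmi * kap (- b) * z * db))"
  have rm: "r *v axis m 1 = axis m 1" and rV: "r *v V = axis k A + V"
    unfolding r_def using ne
    by (simp_all add: X_apply axis_nth_if V_def f_def A_def axis_minus[symmetric] mult_ac add.commute)
  have hG: "E (om *s axis m 1) V \<zeta> \<in> carrier G"
    using H_G[OF \<zeta>(2)] by (simp add: V_def)
  have X: "E (om *s axis m 1) (axis k A) 0 = X m k (br om * A)"
    unfolding E_scale by (simp add: X_def axis_scale)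
  have "commutator G r (E (om *s axis m 1) V \<zeta>) = E (om *s axis m 1) (axis k A) 0"
  proof (rule G.commutator_eqI[OF N_G[OF r] hG])
    have "r ** E (om *s axis m 1) V \<zeta> ** inv\<^bsub>G\<^esub> r = E (om *s axis m 1) (axis k A + V) \<zeta>"
      unfolding conj_N[OF r] mult_vec_scale rm rV ..
    also have "\<dots> = E (om *s axis m 1) (axis k A) 0 ** E (om *s axis m 1) V \<zeta>"
      using ne by (subst E_mult) (simp_all add: V_def f_def B_axis_axis)
    finally show "r \<otimes>\<^bsub>G\<^esub> E (om *s axis m 1) V \<zeta> \<otimes>\<^bsub>G\<^esub> inv\<^bsub>G\<^esub> r = E (om *s axis m 1) (axis k A) 0 \<otimes>\<^bsub>G\<^esub> E (om *s axis m 1) V \<zeta>"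
      by simp
    show "E (om *s axis m 1) (axis k A) 0 \<in> carrier G"
      unfolding X using ne by (intro X_in_G) auto
  qed
  then have "X m k (br om * A) \<in> H"
    using G.commutator_H(1)[OF H r, of "E (om *s axis m 1) V \<zeta>"] \<zeta>(2) by (simp add: X V_def)
  moreover have "br om * A = db * (y * (z * (w * x)))"
    unfolding om_def w'_def A_def by (simp add: mult_ac)
  ultimately show ?thesis by simp
qed

end


section \<open>Off-diagonal entries\<close>

context normalized_subgroup
begin

lemma L_prod:
  assumes "gp p r" "\<And>x. x \<in> I \<Longrightarrow> a * x \<in> L m p r"
  shows "a \<in> L (Suc m) p r"
proof -
  have "X p r (a * w) \<in> H" if "w \<in> Ik (Suc m)" for w
    using that
  proof (induction rule: Ik_induct)
    case (mult x v)
    then show ?case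
      using LD[OF assms(2)] by (simp add: mult.assoc)
  next
    case (add x y)
    then show ?case
      using H_mult gpD[OF assms(1)] by (simp add: distrib_left flip: X_add)
  qed (simp add: X_0 H_one)
  then show ?thesis by (simp add: L_def)
qed

lemma LL_prod: "(\<And>x. x \<in> I \<Longrightarrow> a * x \<in> LL m) \<Longrightarrow> a \<in> LL (Suc m)"
  using L_prod by (simp add: LL_def)

lemma L_0I: "(\<And>x. x \<in> I \<Longrightarrow> X p r (a * x) \<in> H) \<Longrightarrow> x \<in> I \<Longrightarrow> a * x \<in> L 0 p r"
  by (simp add: L_def mult.assoc ideal_scale2[OF I])

lemma L_4I:
  assumes "gp p r" "\<And>x1 x2 x3 x4. x1 \<in> I \<Longrightarrow> x2 \<in> I \<Longrightarrow> x3 \<in> I \<Longrightarrow> x4 \<in> I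
    \<Longrightarrow> X p r (a * (x1 * (x2 * (x3 * x4)))) \<in> H"
  shows "a \<in> L 4 p r"
proof -
  have "a \<in> L (Suc (Suc (Suc (Suc 0)))) p r"
    by (intro L_prod assms(1) L_0I) (use assms(2) in \<open>simp_all add: mult.assoc\<close>)
  then show ?thesis
    by (simp add: eval_nat_numeral)
qed

lemma L_5I:
  assumes "gp p r" "\<And>x1 x2 x3 x4 x5. x1 \<in> I \<Longrightarrow> x2 \<in> I \<Longrightarrow> x3 \<in> I \<Longrightarrow> x4 \<in> I \<Longrightarrow> x5 \<in> I
    \<Longrightarrow> X p r (a * (x1 * (x2 * (x3 * (x4 * x5))))) \<in> H"
  shows "a \<in> L 5 p r"
proof -
  have "a \<in> L (Suc (Suc (Suc (Suc (Suc 0))))) p r"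
    by (intro L_prod assms(1) L_0I) (use assms(2) in \<open>simp_all add: mult.assoc\<close>)
  then show ?thesis
    by (simp add: eval_nat_numeral)
qed

lemma N_mult: "g \<in> N \<Longrightarrow> k \<in> N \<Longrightarrow> g ** k \<in> N"
  using subgroup.m_closed[OF subgroup_N] by simp

lemma E_add_left:
  assumes "B u u = 0" "B u' u' = 0" "B u u' = 0" "B u v = 0" "B u' v = 0" "B v v = 0"
  shows "E (u + u') v 0 = E u' v 0 ** E u v 0"
  using assms B_swap[of u' u] by (subst E_base_add) simp_all

lemma E_add_right:
  assumes "B u u = 0" "B u v = 0" "B u v' = 0" "B v v' = 0"
  shows "E u (v + v') 0 = E u v 0 ** E u v' 0"
  using assms by (simp add: E_mult)

lemma E_axis_axis_N:
  "p \<noteq> 0 \<Longrightarrow> r \<noteq> 0 \<Longrightarrow> r \<noteq> - p \<Longrightarrow> br s * x \<in> I \<Longrightarrow> E (axis p s) (axis r x) 0 \<in> N"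
  unfolding E_axis_axis by (rule X_norm)

text \<open>A transvection along two vectors of an isotropic coordinate subspace is a product of
  elementary ones.\<close>

lemma E_isotropic_N:
  assumes "gp a b" "gp a c" "gp b c" "x \<in> I"
  shows "E (axis a ua + axis b ub) (x *s (axis a va + axis b vb + axis c vc)) 0 \<in> N"
proof -
  note ne = gpD[OF assms(1)] gpD[OF assms(2)] gpD[OF assms(3)]
  define v where "v = axis a (x * va) + axis b (x * vb) + axis c (x * vc)"
  have v: "x *s (axis a va + axis b vb + axis c vc) = v"
    by (simp add: v_def axis_scale vector_add_ldistrib)
  have *: "E (axis p s) v 0 \<in> N" if "p \<in> {a, b}" for p s
  proof -
    have "E (axis p s) v 0 = E (axis p s) (axis a (x * va) + axis b (x * vb)) 0 ** E (axis p s) (axis c (x * vc)) 0"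
      unfolding v_def by (rule E_add_right) (use ne that in \<open>auto simp: B_axis_axis\<close>)
    also have "E (axis p s) (axis a (x * va) + axis b (x * vb)) 0
        = E (axis p s) (axis a (x * va)) 0 ** E (axis p s) (axis b (x * vb)) 0"
      by (rule E_add_right) (use ne that in \<open>auto simp: B_axis_axis\<close>)
    finally have "E (axis p s) v 0 = E (axis p s) (axis a (x * va)) 0 ** E (axis p s) (axis b (x * vb)) 0
        ** E (axis p s) (axis c (x * vc)) 0" .
    moreover have "br s * (x * t) \<in> I" for t
      by (rule ideal_scale[OF I ideal_scale2[OF I assms(4)]])
    ultimately show ?thesis
      using ne that by (auto intro!: N_mult E_axis_axis_N)
  qed
  have "E (axis a ua + axis b ub) v 0 = E (axis b ub) v 0 ** E (axis a ua) v 0"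
    using ne by (subst E_add_left) (simp_all add: B_axis_axis v_def)
  then show ?thesis
    unfolding v using * N_mult by simp
qed

text \<open>The transvections used in the extraction: both vectors are orthogonal to the \<open>a\<close>-th row of
  \<open>\<sigma>\<close>, so that conjugation by \<open>\<sigma>\<close> yields a transvection fixing a basis vector.\<close>

lemma row_transvection:
  fixes a b c k :: "'n idx"
  assumes s: "\<sigma> \<in> H" and gps: "gp a b" "gp a c" "gp b c" and x: "x \<in> I"
    and v: "\<sigma> $ a $ a * va + \<sigma> $ a $ b * vb + \<sigma> $ a $ c * vc = 0"
  defines "\<tau> \<equiv> E (axis a (\<sigma> $ a $ b) + axis b (- \<sigma> $ a $ a)) (x *s (axis a va + axis b vb + axis c vc)) 0"
  shows "\<tau> \<in> N" "(\<sigma> ** \<tau> ** inv\<^bsub>G\<^esub> \<sigma>) *v axis (- a) 1 = axis (- a) 1"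
    "gp k a \<Longrightarrow> gp k b \<Longrightarrow> gp k c \<Longrightarrow> \<tau> *v axis k 1 = axis k 1"
    "\<tau> *v axis (- a) 1 = axis (- a) 1
      + axis a (x * va * kap a * br (\<sigma> $ a $ b) - \<sigma> $ a $ b * lmi * br x * kap a * br va)
      + axis b (x * vb * kap a * br (\<sigma> $ a $ b) + \<sigma> $ a $ a * lmi * br x * kap a * br va)
      + axis c (x * vc * kap a * br (\<sigma> $ a $ b))"
proof -
  note ne = gpD[OF gps(1)] gpD[OF gps(2)] gpD[OF gps(3)]
  show "\<tau> \<in> N"
    unfolding \<tau>_def by (rule E_isotropic_N[OF gps x])
  have u: "(\<sigma> *v (axis a (\<sigma> $ a $ b) + axis b (- \<sigma> $ a $ a))) $ a = 0"
    by (simp add: matrix_vector_right_distrib mult_axis_nth mult.commute)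
  have "(\<sigma> *v (axis a va + axis b vb + axis c vc)) $ a = 0"
    using v by (simp add: matrix_vector_right_distrib mult_axis_nth)
  then show "(\<sigma> ** \<tau> ** inv\<^bsub>G\<^esub> \<sigma>) *v axis (- a) 1 = axis (- a) 1"
    unfolding \<tau>_def G_E_conj[OF H_G[OF s]] E_apply mult_vec_scale using ne u by (simp add: B_axis_right)
  show "gp k a \<Longrightarrow> gp k b \<Longrightarrow> gp k c \<Longrightarrow> \<tau> *v axis k 1 = axis k 1"
    unfolding \<tau>_def E_apply by (auto simp: B_axis_axis dest: gpD)
  show "\<tau> *v axis (- a) 1 = axis (- a) 1
      + axis a (x * va * kap a * br (\<sigma> $ a $ b) - \<sigma> $ a $ b * lmi * br x * kap a * br va)
      + axis b (x * vb * kap a * br (\<sigma> $ a $ b) + \<sigma> $ a $ a * lmi * br x * kap a * br va)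
      + axis c (x * vc * kap a * br (\<sigma> $ a $ b))"
    unfolding \<tau>_def E_apply using ne
    by (simp add: B_axis_axis vec_eq_iff axis_nth_if algebra_simps)
qed

lemma row_transvection_ex:
  fixes a b c :: "'n idx"
  assumes s: "\<sigma> \<in> H" and gps: "gp a b" "gp a c" "gp b c" and x: "x \<in> I"
    and v: "\<sigma> $ a $ a * va + \<sigma> $ a $ b * vb + \<sigma> $ a $ c * vc = 0"
  obtains \<tau> da db dc where "\<tau> \<in> N" "(\<sigma> ** \<tau> ** inv\<^bsub>G\<^esub> \<sigma>) *v axis (- a) 1 = axis (- a) 1"
    "\<And>k. gp k a \<Longrightarrow> gp k b \<Longrightarrow> gp k c \<Longrightarrow> \<tau> *v axis k 1 = axis k 1"
    "\<tau> *v axis (- a) 1 = axis (- a) 1 + axis a da + axis b db + axis c dc"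
    "\<tau> *v axis (- a) 1 = axis (- a) 1 + axis a da + axis c dc + axis b db"
    "va = 0 \<Longrightarrow> da = 0" "va = 0 \<Longrightarrow> db = x * vb * kap a * br (\<sigma> $ a $ b)"
    "dc = x * vc * kap a * br (\<sigma> $ a $ b)"
proof -
  note T = row_transvection[OF s gps x v]
  show thesis
    by (rule that[OF T(1,2) T(3) T(4) trans[OF T(4)]]) (simp_all add: add_ac)
qed

lemma kap_I: "x \<in> I \<Longrightarrow> br (kap p) * x \<in> I" "x \<in> I \<Longrightarrow> - (br (kap p) * x) \<in> I"
  by (simp_all add: ideal_scale[OF I] ideal_neg[OF I])

text \<open>In this and the following lemmas the vector with coordinates \<open>va\<close>, \<open>vb\<close>, \<open>vc\<close> orthogonal to the row is a Koszul
  relation between two of its entries.\<close>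

lemma quad_aa:
  fixes a b k m :: "'n idx"
  assumes s: "\<sigma> \<in> H" and g: "gp a b" "gp k a" "gp k b" "m = b \<or> m = - b"
  shows "\<sigma> $ a $ a * br (\<sigma> $ a $ b) \<in> L 5 m k"
proof (rule L_5I)
  show mk: "gp m k"
    using g by (auto simp: gp_sym)
  fix x1 x2 x3 x4 x5 assume x: "x1 \<in> I" "x2 \<in> I" "x3 \<in> I" "x4 \<in> I" "x5 \<in> I"
  obtain c where c: "gp c a" "gp c b" "gp c k"
    using pick[of a b k] gpD[OF g(1)] gpD[OF g(2)] by blast
  have v: "\<sigma> $ a $ a * \<sigma> $ a $ c + \<sigma> $ a $ b * 0 + \<sigma> $ a $ c * (- \<sigma> $ a $ a) = 0"
    by (simp add: mult.commute)
  have gps: "gp a b" "gp a c" "gp b c"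
    using g c by (auto simp: gp_sym)
  from row_transvection_ex[OF s gps kap_I(2)[OF x(1), of a] v] obtain \<tau> da db dc where
    T: "\<tau> \<in> N" "(\<sigma> ** \<tau> ** inv\<^bsub>G\<^esub> \<sigma>) *v axis (- a) 1 = axis (- a) 1"
    "\<And>k. gp k a \<Longrightarrow> gp k b \<Longrightarrow> gp k c \<Longrightarrow> \<tau> *v axis k 1 = axis k 1"
    "\<tau> *v axis (- a) 1 = axis (- a) 1 + axis a da + axis c dc + axis b db"
    "dc = - (br (kap a) * x1) * (- \<sigma> $ a $ a) * kap a * br (\<sigma> $ a $ b)"
    by metis
  have gk: "gp k a" "gp k b" "gp k c"
    using g c by (auto simp: gp_sym)
  have "X m k (dc * (x2 * (x3 * (x4 * x5)))) \<in> H"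
    by (rule extraction_long[OF s T(1,2) T(3)[OF gk] T(4)]) (use g c x mk in \<open>auto simp: gp_sym\<close>)
  then show "X m k (\<sigma> $ a $ a * br (\<sigma> $ a $ b) * (x1 * (x2 * (x3 * (x4 * x5))))) \<in> H"
    unfolding T(5) by (simp add: mult_ac)
qed

lemma quad_bb:
  fixes a b m :: "'n idx"
  assumes s: "\<sigma> \<in> H" and g: "gp a b" "m = b \<or> m = - b"
  shows "\<sigma> $ a $ b * br (\<sigma> $ a $ b) \<in> L 4 m (- a)"
proof (rule L_4I)
  show ma: "gp m (- a)"
    using g by (auto simp: gp_sym)
  fix x1 x2 x3 x4 assume x: "x1 \<in> I" "x2 \<in> I" "x3 \<in> I" "x4 \<in> I"
  obtain c where c: "gp c a" "gp c b"
    using pick[of a b a] gpD[OF g(1)] by blast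
  obtain k where k: "gp k a" "gp k b" "gp k c"
    using pick[of a b c] gpD[OF g(1)] gpD[OF c(1)] by blast
  have v: "\<sigma> $ a $ a * 0 + \<sigma> $ a $ b * \<sigma> $ a $ c + \<sigma> $ a $ c * (- \<sigma> $ a $ b) = 0"
    by (simp add: mult.commute)
  have gps: "gp a b" "gp a c" "gp b c"
    using g c by (auto simp: gp_sym)
  from row_transvection_ex[OF s gps kap_I(2)[OF x(1), of a] v] obtain \<tau> db dc where
    T: "\<tau> \<in> N" "(\<sigma> ** \<tau> ** inv\<^bsub>G\<^esub> \<sigma>) *v axis (- a) 1 = axis (- a) 1"
    "\<And>k. gp k a \<Longrightarrow> gp k b \<Longrightarrow> gp k c \<Longrightarrow> \<tau> *v axis k 1 = axis k 1"
    "\<tau> *v axis (- a) 1 = axis (- a) 1 + axis a 0 + axis c dc + axis b db"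
    "dc = - (br (kap a) * x1) * (- \<sigma> $ a $ b) * kap a * br (\<sigma> $ a $ b)"
    by metis
  have "X m (- a) (dc * (x2 * (x3 * x4))) \<in> H"
    by (rule extraction_short[OF s T(1,2) T(3)[OF k] T(4)]) (use g c k x ma in \<open>auto simp: gp_sym\<close>)
  then show "X m (- a) (\<sigma> $ a $ b * br (\<sigma> $ a $ b) * (x1 * (x2 * (x3 * x4)))) \<in> H"
    unfolding T(5) by (simp add: mult_ac)
qed

lemma quad_cb:
  fixes a b c m :: "'n idx"
  assumes s: "\<sigma> \<in> H" and gps: "gp a b" "gp a c" "gp b c" and m: "m = c \<or> m = - c"
  shows "\<sigma> $ a $ c * br (\<sigma> $ a $ b) \<in> L 4 m (- a)"
proof (rule L_4I)
  show ma: "gp m (- a)"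
    using gps m by (auto simp: gp_sym)
  fix x1 x2 x3 x4 assume x: "x1 \<in> I" "x2 \<in> I" "x3 \<in> I" "x4 \<in> I"
  obtain k where k: "gp k a" "gp k b" "gp k c"
    using pick[of a b c] gpD[OF gps(1)] gpD[OF gps(2)] by blast
  have v: "\<sigma> $ a $ a * 0 + \<sigma> $ a $ b * \<sigma> $ a $ c + \<sigma> $ a $ c * (- \<sigma> $ a $ b) = 0"
    by (simp add: mult.commute)
  from row_transvection_ex[OF s gps kap_I(1)[OF x(1), of a] v] obtain \<tau> db dc where
    T: "\<tau> \<in> N" "(\<sigma> ** \<tau> ** inv\<^bsub>G\<^esub> \<sigma>) *v axis (- a) 1 = axis (- a) 1"
    "\<And>k. gp k a \<Longrightarrow> gp k b \<Longrightarrow> gp k c \<Longrightarrow> \<tau> *v axis k 1 = axis k 1"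
    "\<tau> *v axis (- a) 1 = axis (- a) 1 + axis a 0 + axis b db + axis c dc"
    "db = br (kap a) * x1 * \<sigma> $ a $ c * kap a * br (\<sigma> $ a $ b)"
    by metis
  have "X m (- a) (db * (x2 * (x3 * x4))) \<in> H"
    by (rule extraction_short[OF s T(1,2) T(3)[OF k] T(4)]) (use gps m k x ma in \<open>auto simp: gp_sym\<close>)
  then show "X m (- a) (\<sigma> $ a $ c * br (\<sigma> $ a $ b) * (x1 * (x2 * (x3 * x4)))) \<in> H"
    unfolding T(5) by (simp add: mult_ac)
qed

lemma not_gp: "p \<noteq> 0 \<Longrightarrow> r \<noteq> 0 \<Longrightarrow> \<not> gp p r \<Longrightarrow> p = r \<or> p = - r"
  by (auto simp: gp_def)

lemma quad_cb6:
  fixes a b c i j :: "'n idx"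
  assumes s: "\<sigma> \<in> H" and gps: "gp a b" "gp a c" "gp b c" and ij: "gp i j" "gp i a" "gp j a"
  shows "\<sigma> $ a $ c * br (\<sigma> $ a $ b) \<in> L 6 i j"
proof (cases "gp j c")
  case True
  show ?thesis
  proof (cases "gp i c")
    case i: True
    have "\<sigma> $ a $ c * br (\<sigma> $ a $ b) \<in> L (Suc (Suc 4)) i j"
      by (rule L_move1[OF L_move2[OF quad_cb[OF s gps, of c]]]) (use gps ij True i in \<open>simp_all add: gp_sym\<close>)
    then show ?thesis by simp
  next
    case i: False
    have m: "i = c \<or> i = - c"
      using not_gp[of i c] i gpD[OF ij(1)] gpD[OF gps(2)] by blast
    have "\<sigma> $ a $ c * br (\<sigma> $ a $ b) \<in> L (Suc 4) i j"
      by (rule L_move2[OF quad_cb[OF s gps m]]) (use gps ij in \<open>simp_all add: gp_sym\<close>)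
    then show ?thesis
      using L_mono[of 5 6] by simp
  qed
next
  case False
  then have j: "j = c \<or> j = - c"
    using not_gp[of j c] gpD[OF ij(1)] gpD[OF gps(2)] by blast
  then have bj: "gp b j"
    using gps by auto
  have "\<sigma> $ a $ b * br (\<sigma> $ a $ c) \<in> L 4 b (- a)"
    by (rule quad_cb[OF s]) (use gps in \<open>simp_all add: gp_sym\<close>)
  from L_swap[OF _ this] have "\<sigma> $ a $ c * br (\<sigma> $ a $ b) \<in> L 4 (- a) b"
    using gps by (simp add: gp_sym mult.commute)
  then have "\<sigma> $ a $ c * br (\<sigma> $ a $ b) \<in> L (Suc (Suc 4)) i j"
    by (intro L_move1[OF L_move2[of _ _ "- a" b j]]) (use gps ij bj in \<open>simp_all add: gp_sym\<close>)
  then show ?thesis by simp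
qed

lemma quad_bb6:
  fixes a b i j :: "'n idx"
  assumes s: "\<sigma> \<in> H" and gab: "gp a b" and ij: "gp i j" "gp i a" "gp j a"
  shows "\<sigma> $ a $ b * br (\<sigma> $ a $ b) \<in> L 6 i j"
proof (cases "gp j b")
  case True
  show ?thesis
  proof (cases "gp i b")
    case i: True
    have "\<sigma> $ a $ b * br (\<sigma> $ a $ b) \<in> L (Suc (Suc 4)) i j"
      by (rule L_move1[OF L_move2[OF quad_bb[OF s gab, of b]]]) (use gab ij True i in \<open>simp_all add: gp_sym\<close>)
    then show ?thesis by simp
  next
    case i: False
    have m: "i = b \<or> i = - b"
      using not_gp[of i b] i gpD[OF ij(1)] gpD[OF gab] by blast
    have "\<sigma> $ a $ b * br (\<sigma> $ a $ b) \<in> L (Suc 4) i j"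
      by (rule L_move2[OF quad_bb[OF s gab m]]) (use gab ij in \<open>simp_all add: gp_sym\<close>)
    then show ?thesis
      using L_mono[of 5 6] by simp
  qed
next
  case False
  then have j: "j = b \<or> j = - b"
    using not_gp[of j b] gpD[OF ij(1)] gpD[OF gab] by blast
  have "\<sigma> $ a $ b * br (\<sigma> $ a $ b) \<in> L 4 (- a) j"
    using L_swap[OF _ quad_bb[OF s gab j]] ij by (simp add: gp_sym mult.commute)
  then have "\<sigma> $ a $ b * br (\<sigma> $ a $ b) \<in> L (Suc 4) i j"
    by (rule L_move1) (use ij in \<open>simp_all add: gp_sym\<close>)
  then show ?thesis
    using L_mono[of 5 6] by simp
qed

lemma quad_aa7:
  fixes a b i j :: "'n idx"
  assumes s: "\<sigma> \<in> H" and gab: "gp a b" and ij: "gp i j" "gp i a" "gp j a"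
  shows "\<sigma> $ a $ a * br (\<sigma> $ a $ b) \<in> L 7 i j"
proof (cases "gp j b")
  case True
  show ?thesis
  proof (cases "gp i b")
    case i: True
    have "\<sigma> $ a $ a * br (\<sigma> $ a $ b) \<in> L (Suc 5) i j"
      by (rule L_move1[OF quad_aa[OF s gab ij(3) True, of b]]) (use gab ij True i in \<open>simp_all add: gp_sym\<close>)
    then show ?thesis
      using L_mono[of 6 7] by simp
  next
    case i: False
    have m: "i = b \<or> i = - b"
      using not_gp[of i b] i gpD[OF ij(1)] gpD[OF gab] by blast
    show ?thesis
      using L_mono[of 5 7] quad_aa[OF s gab ij(3) True m] by simp
  qed
next
  case False
  then have j: "j = b \<or> j = - b"
    using not_gp[of j b] gpD[OF ij(1)] gpD[OF gab] by blast
  obtain k where k: "gp k a" "gp k b" "gp k i"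
    using pick[of a b i] gpD[OF gab] gpD[OF ij(1)] by blast
  have "\<sigma> $ a $ a * br (\<sigma> $ a $ b) \<in> L (Suc (Suc 5)) i j"
    by (rule L_move2[OF L_move1[OF quad_aa[OF s gab k(1,2), of b]]])
      (use gab ij k j in \<open>auto simp: gp_sym\<close>)
  then show ?thesis by simp
qed

lemma H_conj: "\<sigma> \<in> H \<Longrightarrow> g \<in> N \<Longrightarrow> g ** \<sigma> ** inv\<^bsub>G\<^esub> g \<in> H"
  using G.normalizer_conj[OF _ _ subgroup.subset[OF H]] by simp

lemma nth_conj: "((g :: ('a, 'n) matrix) ** (\<sigma> :: ('a, 'n) matrix) ** (g' :: ('a, 'n) matrix)) $ i $ j = (g *v (\<sigma> *v (g' *v axis j 1))) $ i"
  using mult_axis_nth[of "g ** \<sigma> ** g'" j 1 i] by (simp flip: matrix_vector_mul_assoc)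

lemma H_conj_X:
  assumes "\<sigma> \<in> H" "z \<in> I" "gp p r"
  obtains \<sigma>' where "\<sigma>' \<in> H"
    "\<And>i j. \<sigma>' $ i $ j = (X p r z *v (\<sigma> *v (X p r (- z) *v axis j 1))) $ i"
proof (rule that)
  show "X p r z ** \<sigma> ** inv\<^bsub>G\<^esub> (X p r z) \<in> H"
    by (intro H_conj assms X_norm) (use gpD[OF assms(3)] in auto)
qed (use gpD[OF assms(3)] in \<open>simp add: nth_conj inv_X\<close>)

lemma H_conj_Y:
  assumes "\<sigma> \<in> H" "z \<in> I" "p \<noteq> 0" "y \<in> Jd"
  obtains \<sigma>' \<zeta> \<zeta>' where "\<sigma>' \<in> H"
    "\<And>i j. \<sigma>' $ i $ j = (Y p (y * z, \<zeta>) *v (\<sigma> *v (Y p (- (y * z), \<zeta>') *v axis j 1))) $ i"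
proof -
  obtain y' where y': "(y, y') \<in> \<Delta>"
    using assms(4) by (auto simp: J_of_def)
  show thesis
  proof (rule that)
    show "Y p ((y, y') \<odot> z) ** \<sigma> ** inv\<^bsub>G\<^esub> (Y p ((y, y') \<odot> z)) \<in> H"
      by (intro H_conj assms Y_norm y')
    show "(Y p ((y, y') \<odot> z) ** \<sigma> ** inv\<^bsub>G\<^esub> (Y p ((y, y') \<odot> z))) $ i $ j
        = (Y p (y * z, br z * y' * z) *v (\<sigma> *v (Y p (- (y * z), - (br z * y' * z) - br (y * z) * mu R * (y * z)) *v axis j 1))) $ i" for i j
      unfolding nth_conj inv_Y[OF assms(3) D.ci_mem[OF y']] by (simp only: ci_eq hinv_eq)
  qed
qed

text \<open>Entries at \<open>-a\<close>, \<open>0\<close> and \<open>-b\<close> are not covered by the transvections above. Conjugating \<open>\<sigma>\<close> by an elementary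
  matrix adds a multiple of them to an entry that is covered.\<close>

lemma quad_opp_a:
  fixes a b i j :: "'n idx"
  assumes s: "\<sigma> \<in> H" and gab: "gp a b" and ij: "gp i j" "gp i a" "gp j a"
  shows "\<sigma> $ a $ (- a) * br (\<sigma> $ a $ b) \<in> L 7 i j"
proof -
  obtain c where c: "gp c a" "gp c b"
    using pick[of a b a] gpD[OF gab] by blast
  note L = L_ideal[OF ij(1), of 6]
  have "\<sigma> $ a $ (- a) * br (\<sigma> $ a $ b) * x \<in> L 6 i j" if x: "x \<in> I" for x
  proof -
    obtain \<sigma>' where \<sigma>': "\<sigma>' \<in> H" "\<And>i j. \<sigma>' $ i $ j
        = (X (- c) (- a) (br (kap (- c)) * x) *v (\<sigma> *v (X (- c) (- a) (- (br (kap (- c)) * x)) *v axis j 1))) $ i"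
      using H_conj_X[OF s kap_I(1)[OF x]] c by (metis gp_minus)
    note ne = gpD[OF gab] gpD[OF c(1)] gpD[OF c(2)]
    have e: "\<sigma>' $ a $ c = \<sigma> $ a $ c - x * \<sigma> $ a $ (- a)" "\<sigma>' $ a $ b = \<sigma> $ a $ b"
      unfolding \<sigma>'(2) using ne
      by (simp_all add: X_apply entry_simps mult_ac)
    have q: "\<sigma>' $ a $ c * br (\<sigma>' $ a $ b) \<in> L 6 i j" "\<sigma> $ a $ c * br (\<sigma> $ a $ b) \<in> L 6 i j"
      using c gab by (auto intro!: quad_cb6 s \<sigma>' ij simp: gp_sym)
    from ideal_diff[OF L q(2,1)] show ?thesis
      unfolding e by (simp add: algebra_simps)
  qed
  from L_prod[OF ij(1) this] show ?thesis by simp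
qed

lemma quad_zero:
  fixes a b i j :: "'n idx"
  assumes s: "\<sigma> \<in> H" and gab: "gp a b" and ij: "gp i j" "gp i a" "gp j a" and y: "y \<in> Jd"
  shows "\<sigma> $ a $ 0 * y * br (\<sigma> $ a $ b) \<in> L 7 i j"
proof -
  obtain c where c: "gp c a" "gp c b"
    using pick[of a b a] gpD[OF gab] by blast
  note L = L_ideal[OF ij(1), of 6]
  have "\<sigma> $ a $ 0 * y * br (\<sigma> $ a $ b) * x \<in> L 6 i j" if x: "x \<in> I" for x
  proof -
    note ne = gpD[OF gab] gpD[OF c(1)] gpD[OF c(2)]
    define x' where "x' = br (kap (- c)) * x"
    have "- c \<noteq> 0" using ne by simp
    from H_conj_Y[OF s kap_I(1)[OF x] this y]
    obtain \<sigma>' \<zeta> \<zeta>' where \<sigma>': "\<sigma>' \<in> H" "\<And>i j. \<sigma>' $ i $ j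
        = (Y (- c) (y * x', \<zeta>) *v (\<sigma> *v (Y (- c) (- (y * x'), \<zeta>') *v axis j 1))) $ i"
      unfolding x'_def by blast
    have e: "\<sigma>' $ a $ c = \<sigma> $ a $ c - y * x * \<sigma> $ a $ 0 + br \<zeta>' * kap (- c) * \<sigma> $ a $ (- c)"
      "\<sigma>' $ a $ b = \<sigma> $ a $ b"
      unfolding \<sigma>'(2) using ne
      by (simp_all add: x'_def Y_apply entry_simps mult_ac)
    have q: "\<sigma>' $ a $ c * br (\<sigma>' $ a $ b) \<in> L 6 i j" "\<sigma> $ a $ c * br (\<sigma> $ a $ b) \<in> L 6 i j"
      "\<sigma> $ a $ (- c) * br (\<sigma> $ a $ b) \<in> L 6 i j"
      using c gab by (auto intro!: quad_cb6 s \<sigma>' ij simp: gp_sym)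
    from ideal_diff[OF L ideal_add[OF L q(2) ideal_scale[OF L q(3), of "br \<zeta>' * kap (- c)"]] q(1)] show ?thesis
      unfolding e by (simp add: algebra_simps)
  qed
  from L_prod[OF ij(1) this] show ?thesis by simp
qed

lemma quad_opp_relation:
  fixes a b c i j :: "'n idx"
  assumes s: "\<sigma> \<in> H" and gps: "gp a b" "gp a c" "gp b c" and ij: "gp i j" "gp i a" "gp j a" and x: "x \<in> I"
  shows "x * (\<sigma> $ a $ (- b) * br (\<sigma> $ a $ b)
    - br (kap (- c)) * lm * br (kap (- b)) * (\<sigma> $ a $ c * br (\<sigma> $ a $ (- c)))) \<in> L 6 i j"
proof -
  note ne = gpD[OF gps(1)] gpD[OF gps(2)] gpD[OF gps(3)]
  note L = L_ideal[OF ij(1), of 6]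
  have gcb: "gp (- c) (- b)"
    using gps by (simp add: gp_sym)
  obtain \<sigma>' where \<sigma>': "\<sigma>' \<in> H" "\<And>i j. \<sigma>' $ i $ j
      = (X (- c) (- b) (br (kap (- c)) * x) *v (\<sigma> *v (X (- c) (- b) (- (br (kap (- c)) * x)) *v axis j 1))) $ i"
    using H_conj_X[OF s kap_I(1)[OF x] gcb] by blast
  define t where "t = lm * br (kap (- b)) * (br (kap (- c)) * x)"
  have e: "\<sigma>' $ a $ c = \<sigma> $ a $ c - x * \<sigma> $ a $ (- b)" "\<sigma>' $ a $ b = \<sigma> $ a $ b + br t * \<sigma> $ a $ (- c)"
    unfolding \<sigma>'(2) using ne
    by (simp_all add: t_def X_apply entry_simps mult_ac)
  have q: "\<sigma>' $ a $ c * br (\<sigma>' $ a $ b) \<in> L 6 i j" "\<sigma> $ a $ c * br (\<sigma> $ a $ b) \<in> L 6 i j"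
    "\<sigma> $ a $ (- b) * br (\<sigma> $ a $ (- c)) \<in> L 6 i j"
    using gps by (auto intro!: quad_cb6 s \<sigma>' ij simp: gp_sym)
  from ideal_diff[OF L ideal_diff[OF L q(2) ideal_scale[OF L q(3), of "t * x"]] q(1)] show ?thesis
    unfolding e by (simp add: t_def algebra_simps)
qed

text \<open>A row of an invertible matrix is unimodular, and the products of its entries with the conjugate of the given one
  lie in the ideal. Only the entry at \<open>-b\<close> is controlled less well, namely after a further
  multiplication by an entry of the row; for it the unimodularity relation is applied twice.\<close>

lemma off_diagonal_row:
  fixes a b i j :: "'n idx"
  assumes s: "\<sigma> \<in> H" and gab: "gp a b" and ij: "gp i j" "gp i a" "gp j a"
  shows "br (\<sigma> $ a $ b) \<in> L 7 i j"
proof -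
  note L = L_ideal[OF ij(1), of 7] and L6 = L_ideal[OF ij(1), of 6]
  note ne = gpD[OF gab]
  define sb where "sb = br (\<sigma> $ a $ b)"
  define \<omega> where "\<omega> = (inv\<^bsub>G\<^esub> \<sigma>) $ (- b) $ a"
  have trm: "\<sigma> $ a $ p * (inv\<^bsub>G\<^esub> \<sigma>) $ p $ a * sb \<in> L 7 i j" if p: "p \<noteq> - b" for p
  proof (cases "p = 0")
    case True
    have y: "(inv\<^bsub>G\<^esub> \<sigma>) $ 0 $ a \<in> Jd"
      using MD_G[OF inv_G(1)[OF H_G[OF s]], of "axis a 1"] ne by (simp add: mult_axis_nth)
    show ?thesis
      unfolding True sb_def by (rule quad_zero[OF s gab ij y])
  next
    case False
    have "\<sigma> $ a $ p * sb \<in> L 7 i j"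
    proof (cases "gp p a")
      case pa: True
      show ?thesis
      proof (cases "gp p b")
        case True
        then show ?thesis
          unfolding sb_def using pa gab L_mono[of 6 7] by (intro L_mono[of 6 7] quad_cb6 s ij) (simp_all add: gp_sym)
      next
        case False
        then have "p = b"
          using p not_gp[of p b] \<open>p \<noteq> 0\<close> ne by blast
        then show ?thesis
          unfolding sb_def using quad_bb6[OF s gab ij] L_mono[of 6 7] by simp
      qed
    next
      case pa: False
      then have "p = a \<or> p = - a"
        using not_gp[of p a] \<open>p \<noteq> 0\<close> ne by blast
      then show ?thesis
        unfolding sb_def using quad_aa7[OF s gab ij] quad_opp_a[OF s gab ij] by auto
    qed
    from ideal_scale[OF L this, of "(inv\<^bsub>G\<^esub> \<sigma>) $ p $ a"] show ?thesis
      by (simp add: mult_ac)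
  qed
  have "(\<Sum>p\<in>UNIV. \<sigma> $ a $ p * (inv\<^bsub>G\<^esub> \<sigma>) $ p $ a) = 1"
    using arg_cong[OF inv_G(3)[OF H_G[OF s]], of "\<lambda>A. A $ a $ a"] by (simp add: matrix_matrix_mult_def mat_def)
  then have "sb = (\<Sum>p\<in>UNIV. \<sigma> $ a $ p * (inv\<^bsub>G\<^esub> \<sigma>) $ p $ a) * sb"
    by simp
  also have "\<dots> = (\<Sum>p\<in>UNIV. \<sigma> $ a $ p * (inv\<^bsub>G\<^esub> \<sigma>) $ p $ a * sb)"
    by (rule sum_distrib_right)
  also have "\<dots> = \<sigma> $ a $ (- b) * \<omega> * sb + (\<Sum>p\<in>UNIV - {- b}. \<sigma> $ a $ p * (inv\<^bsub>G\<^esub> \<sigma>) $ p $ a * sb)"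
    unfolding \<omega>_def by (rule sum.remove) simp_all
  finally have "sb - \<sigma> $ a $ (- b) * \<omega> * sb = (\<Sum>p\<in>UNIV - {- b}. \<sigma> $ a $ p * (inv\<^bsub>G\<^esub> \<sigma>) $ p $ a * sb)"
    unfolding diff_eq_eq by (subst add.commute)
  also have "\<dots> \<in> L 7 i j"
    by (rule ideal_sum[OF L]) (use trm in auto)
  finally have 1: "sb - \<sigma> $ a $ (- b) * \<omega> * sb \<in> L 7 i j" .
  obtain c where c: "gp c a" "gp c b"
    using pick[of a b a] ne by blast
  have "\<sigma> $ a $ (- b) * \<omega> * (\<sigma> $ a $ (- b) * sb) * x \<in> L 6 i j" if x: "x \<in> I" for x
  proof -
    have gps: "gp a c" "gp b c"
      using c by (simp_all add: gp_sym)
    have q: "\<sigma> $ a $ (- b) * br (\<sigma> $ a $ (- c)) \<in> L 6 i j"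
      by (rule quad_cb6[OF s _ _ _ ij]) (use gps gab in \<open>simp_all add: gp_sym\<close>)
    have "\<sigma> $ a $ (- b) * \<omega> * (\<sigma> $ a $ (- b) * sb) * x
        = \<sigma> $ a $ (- b) * \<omega> * (x * (\<sigma> $ a $ (- b) * sb
          - br (kap (- c)) * lm * br (kap (- b)) * (\<sigma> $ a $ c * br (\<sigma> $ a $ (- c)))))
        + (\<omega> * x * br (kap (- c)) * lm * br (kap (- b)) * \<sigma> $ a $ c) * (\<sigma> $ a $ (- b) * br (\<sigma> $ a $ (- c)))"
      by (simp add: algebra_simps)
    also have "\<dots> \<in> L 6 i j"
      unfolding sb_def
      by (intro ideal_add[OF L6] ideal_scale[OF L6] quad_opp_relation[OF s gab gps ij x] q)
    finally show ?thesis .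
  qed
  from L_prod[OF ij(1) this] have 2: "\<sigma> $ a $ (- b) * \<omega> * (\<sigma> $ a $ (- b) * sb) \<in> L 7 i j"
    by simp
  have "sb = (sb - \<sigma> $ a $ (- b) * \<omega> * sb) + \<omega> * (\<sigma> $ a $ (- b) * (sb - \<sigma> $ a $ (- b) * \<omega> * sb)
      + \<sigma> $ a $ (- b) * \<omega> * (\<sigma> $ a $ (- b) * sb))"
    by (simp add: algebra_simps)
  also have "\<dots> \<in> L 7 i j"
    by (intro ideal_add[OF L] ideal_scale[OF L] 1 2)
  finally show ?thesis
    by (simp add: sb_def)
qed

end


section \<open>Generators of the ideal of the upper level\<close>

context normalized_subgroup
begin

lemma entry_inv:
  assumes s: "\<sigma> \<in> H" and "a \<noteq> 0" "b \<noteq> 0"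
  shows "\<sigma> $ a $ b = br (kap (- a)) * kap (- b) * br ((inv\<^bsub>G\<^esub> \<sigma>) $ (- b) $ (- a))"
proof -
  have "kap (- a) * \<sigma> $ a $ b = br ((inv\<^bsub>G\<^esub> \<sigma>) $ (- b) $ (- a)) * kap (- b)"
    using G_B_inv(2)[OF H_G[OF s], of "axis (- a) 1" "axis b 1"] assms
    by (simp add: B_axis_left B_axis_right mult_axis_nth)
  then have "br (kap (- a)) * (kap (- a) * \<sigma> $ a $ b) = br (kap (- a)) * (br ((inv\<^bsub>G\<^esub> \<sigma>) $ (- b) $ (- a)) * kap (- b))"
    by (simp only:)
  then show ?thesis
    by (simp only: kap_br_assoc) (simp only: mult_ac)
qed

text \<open>Besides the row of \<open>\<sigma>\<close> one can use the row of \<open>\<sigma>\<^sup>-\<^sup>1\<close> that corresponds to the column of the entry.\<close>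

lemma off_diagonal_L7:
  fixes a b i j :: "'n idx"
  assumes s: "\<sigma> \<in> H" and ab: "gp a b" and ij: "gp i j" "gp i a \<and> gp j a \<or> gp i b \<and> gp j b"
  shows "\<sigma> $ a $ b \<in> L 7 i j"
  using ij(2)
proof
  assume "gp i a \<and> gp j a"
  then have "br (\<sigma> $ a $ b) \<in> L 7 j i"
    using ij(1) by (intro off_diagonal_row s ab) (auto simp: gp_sym)
  from L_swap[OF _ this] show ?thesis
    using ij(1) by (simp add: gp_sym)
next
  assume "gp i b \<and> gp j b"
  then have "br ((inv\<^bsub>G\<^esub> \<sigma>) $ (- b) $ (- a)) \<in> L 7 i j"
    using ij(1) ab by (intro off_diagonal_row H_inv s) (auto simp: gp_sym)
  from ideal_scale[OF L_ideal[OF ij(1)] this, of "br (kap (- a)) * kap (- b)"] show ?thesis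
    using entry_inv[OF s] gpD[OF ab] by simp
qed

lemma LL_8I: "(\<And>i j. gp i j \<Longrightarrow> r \<in> L 8 i j) \<Longrightarrow> r \<in> LL 8"
  by (simp add: LL_def)

lemma L_prod8: "gp p r \<Longrightarrow> (\<And>x. x \<in> I \<Longrightarrow> a * x \<in> L 7 p r) \<Longrightarrow> a \<in> L 8 p r"
  using L_prod[of p r a 7] by simp

lemma gp_off_LL:
  assumes s: "\<sigma> \<in> H" and ab: "gp a b"
  shows "\<sigma> $ a $ b \<in> LL 8"
proof (rule LL_8I)
  fix i j :: "'n idx" assume ij: "gp i j"
  have "\<exists>l. gp l i \<and> gp l j \<and> (gp i a \<and> gp l a \<or> gp i b \<and> gp l b)"
  proof (cases "gp i a")
    case True
    then show ?thesis
      using pick[of i j a] gpD[OF ij] gpD[OF ab] by metis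
  next
    case False
    then have "i = a \<or> i = - a"
      using not_gp[of i a] gpD[OF ij] gpD[OF ab] by blast
    then have "gp i b"
      using ab by auto
    then show ?thesis
      using pick[of i j b] gpD[OF ij] gpD[OF ab] by metis
  qed
  then obtain l where l: "gp l i" "gp l j" "gp i a \<and> gp l a \<or> gp i b \<and> gp l b"
    by blast
  have "\<sigma> $ a $ b \<in> L (Suc 7) i j"
    by (rule L_move2[OF off_diagonal_L7[OF s ab _ l(3)]]) (use l ij in \<open>simp_all add: gp_sym\<close>)
  then show "\<sigma> $ a $ b \<in> L 8 i j" by simp
qed

text \<open>The remaining generators of the ideal of the upper level are treated alike: conjugation by an elementary matrix over
  \<open>I\<close> adds a multiple of the given element to an off-diagonal entry.\<close>

lemma opp_LL:
  assumes s: "\<sigma> \<in> H" and p: "p \<noteq> 0"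
  shows "\<sigma> $ p $ (- p) \<in> LL 8"
proof (rule LL_8I, rule L_prod8)
  fix i j :: "'n idx" and x assume ij: "gp i j" and x: "x \<in> I"
  obtain l where l: "gp l p" "gp l i" "gp l j"
    using pick[of p i j] p gpD[OF ij] by blast
  note ne = gpD[OF l(1)]
  have "gp (- p) l" using l by (simp add: gp_sym)
  from H_conj_X[OF s kap_I(1)[OF x, of "- p"] this] obtain \<sigma>' where \<sigma>': "\<sigma>' \<in> H" "\<And>i j. \<sigma>' $ i $ j
      = (X (- p) l (br (kap (- p)) * x) *v (\<sigma> *v (X (- p) l (- (br (kap (- p)) * x)) *v axis j 1))) $ i"
    by blast
  have e: "\<sigma>' $ l $ (- p) = \<sigma> $ l $ (- p) + \<sigma> $ p $ (- p) * x"
    unfolding \<sigma>'(2) using ne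
    by (simp add: X_apply entry_simps mult_ac)
  have "\<sigma>' $ l $ (- p) \<in> L 7 i j" "\<sigma> $ l $ (- p) \<in> L 7 i j"
    using l ij by (auto intro!: off_diagonal_L7 s \<sigma>' simp: gp_sym)
  from ideal_diff[OF L_ideal[OF ij] this] show "\<sigma> $ p $ (- p) * x \<in> L 7 i j"
    unfolding e by simp
qed

lemma off_LL:
  assumes "\<sigma> \<in> H" "a \<noteq> 0" "b \<noteq> 0" "a \<noteq> b"
  shows "\<sigma> $ a $ b \<in> LL 8"
  using gp_off_LL[of \<sigma> a b] opp_LL[of \<sigma> a] not_gp[of b a] assms by (metis gp_sym)

lemma diag_L8:
  assumes s: "\<sigma> \<in> H" and ij: "gp i j" and l: "gp l p" "gp l i" "gp l j"
  shows "\<sigma> $ p $ p - \<sigma> $ l $ l \<in> L 8 i j"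
proof (rule L_prod8[OF ij])
  fix x assume x: "x \<in> I"
  note ne = gpD[OF l(1)] and L = L_ideal[OF ij, of 7]
  have "gp (- p) l" using l by (simp add: gp_sym)
  from H_conj_X[OF s kap_I(1)[OF x, of "- p"] this] obtain \<sigma>' where \<sigma>': "\<sigma>' \<in> H" "\<And>i j. \<sigma>' $ i $ j
      = (X (- p) l (br (kap (- p)) * x) *v (\<sigma> *v (X (- p) l (- (br (kap (- p)) * x)) *v axis j 1))) $ i"
    by blast
  have e: "\<sigma>' $ l $ p = \<sigma> $ l $ p + (\<sigma> $ p $ p - \<sigma> $ l $ l) * x - x * x * \<sigma> $ p $ l"
    unfolding \<sigma>'(2) using ne
    by (simp add: X_apply entry_simps algebra_simps)
  have q: "\<sigma>' $ l $ p \<in> L 7 i j" "\<sigma> $ l $ p \<in> L 7 i j" "\<sigma> $ p $ l \<in> L 7 i j"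
    using l ij by (auto intro!: off_diagonal_L7 s \<sigma>' simp: gp_sym)
  from ideal_add[OF L ideal_diff[OF L q(1,2)] ideal_scale[OF L q(3), of "x * x"]]
  show "(\<sigma> $ p $ p - \<sigma> $ l $ l) * x \<in> L 7 i j"
    unfolding e by simp
qed

lemma diag_LL:
  assumes s: "\<sigma> \<in> H" and "p \<noteq> 0" "r \<noteq> 0"
  shows "\<sigma> $ p $ p - \<sigma> $ r $ r \<in> LL 8"
proof (rule LL_8I)
  fix i j :: "'n idx" assume ij: "gp i j"
  note ne = gpD[OF ij] and L = L_ideal[OF ij, of 8]
  obtain l where l: "gp l p" "gp l i" "gp l j"
    using pick[of p i j] assms ne by blast
  obtain k where k: "gp k r" "gp k i" "gp k j"
    using pick[of r i j] assms ne by blast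
  obtain m where m: "gp m l" "gp m i" "gp m j"
    using pick[of l i j] gpD[OF l(1)] ne by blast
  have "\<sigma> $ k $ k - \<sigma> $ l $ l \<in> L 8 i j"
  proof (cases "gp l k")
    case True
    then show ?thesis
      by (intro diag_L8 s ij l)
  next
    case False
    then have "gp m k"
      using m not_gp[of l k] gpD[OF k(1)] gpD[OF l(1)] by auto
    then have "\<sigma> $ k $ k - \<sigma> $ m $ m \<in> L 8 i j" "\<sigma> $ l $ l - \<sigma> $ m $ m \<in> L 8 i j"
      using m by (auto intro!: diag_L8 s ij)
    from ideal_diff[OF L this] show ?thesis by simp
  qed
  note ideal_diff[OF L ideal_diff[OF L diag_L8[OF s ij l] diag_L8[OF s ij k]] this]
  then show "\<sigma> $ p $ p - \<sigma> $ r $ r \<in> L 8 i j"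
    by simp
qed

lemma col0_LL:
  assumes s: "\<sigma> \<in> H" and p: "p \<noteq> 0" and y: "y \<in> Jd"
  shows "\<sigma> $ p $ 0 * y \<in> LL 8"
proof (rule LL_8I, rule L_prod8)
  fix i j :: "'n idx" and x assume ij: "gp i j" and x: "x \<in> I"
  obtain l where l: "gp l p" "gp l i" "gp l j"
    using pick[of p i j] p gpD[OF ij] by blast
  note ne = gpD[OF l(1)] and L = L_ideal[OF ij, of 7]
  define x' where "x' = br (kap (- l)) * x"
  have "- l \<noteq> 0" using ne by simp
  from H_conj_Y[OF s kap_I(1)[OF x] this y]
  obtain \<sigma>' \<zeta> \<zeta>' where \<sigma>': "\<sigma>' \<in> H" "\<And>i j. \<sigma>' $ i $ j
      = (Y (- l) (y * x', \<zeta>) *v (\<sigma> *v (Y (- l) (- (y * x'), \<zeta>') *v axis j 1))) $ i"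
    unfolding x'_def by blast
  have e: "\<sigma>' $ p $ l = \<sigma> $ p $ l - \<sigma> $ p $ 0 * y * x + br \<zeta>' * kap (- l) * \<sigma> $ p $ (- l)"
    unfolding \<sigma>'(2) using ne
    by (simp add: x'_def Y_apply entry_simps mult_ac)
  have q: "\<sigma>' $ p $ l \<in> L 7 i j" "\<sigma> $ p $ l \<in> L 7 i j" "\<sigma> $ p $ (- l) \<in> L 7 i j"
    using l ij by (auto intro!: off_diagonal_L7 s \<sigma>' simp: gp_sym)
  from ideal_diff[OF L ideal_add[OF L q(2) ideal_scale[OF L q(3), of "br \<zeta>' * kap (- l)"]] q(1)]
  show "\<sigma> $ p $ 0 * y * x \<in> L 7 i j"
    unfolding e by simp
qed

lemma row0_LL:
  assumes s: "\<sigma> \<in> H" and p: "p \<noteq> 0" and y: "y \<in> Jd"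
  shows "br y * mu R * \<sigma> $ 0 $ p \<in> LL 8"
proof (rule LL_8I, rule L_prod8)
  fix i j :: "'n idx" and x assume ij: "gp i j" and x: "x \<in> I"
  obtain l where l: "gp l p" "gp l i" "gp l j"
    using pick[of p i j] p gpD[OF ij] by blast
  note ne = gpD[OF l(1)] and L = L_ideal[OF ij, of 7]
  have x': "lmi * br x \<in> I"
    using x by (intro ideal_scale[OF I] I_br)
  from H_conj_Y[OF s x' ne(1) y]
  obtain \<sigma>' \<zeta> \<zeta>' where \<sigma>': "\<sigma>' \<in> H" "\<And>i j. \<sigma>' $ i $ j
      = (Y l (y * (lmi * br x), \<zeta>) *v (\<sigma> *v (Y l (- (y * (lmi * br x)), \<zeta>') *v axis j 1))) $ i"
    by blast
  have e: "\<sigma>' $ l $ p = \<sigma> $ l $ p - br y * mu R * \<sigma> $ 0 $ p * x + br \<zeta> * kap l * \<sigma> $ (- l) $ p"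
    unfolding \<sigma>'(2) using ne p
    by (simp add: Y_apply entry_simps lm_lmi_far mult_ac)
  have q: "\<sigma>' $ l $ p \<in> L 7 i j" "\<sigma> $ l $ p \<in> L 7 i j" "\<sigma> $ (- l) $ p \<in> L 7 i j"
    using l ij by (auto intro!: off_diagonal_L7 s \<sigma>' simp: gp_sym)
  from ideal_diff[OF L ideal_add[OF L q(2) ideal_scale[OF L q(3), of "br \<zeta> * kap l"]] q(1)]
  show "br y * mu R * \<sigma> $ 0 $ p * x \<in> L 7 i j"
    unfolding e by simp
qed

lemma mid_LL:
  assumes s: "\<sigma> \<in> H" and p: "p \<noteq> 0" and y: "y \<in> Jd" and y': "y' \<in> Jd"
  shows "br y * mu R * (\<sigma> $ 0 $ 0 - \<sigma> $ p $ p) * y' \<in> LL 9"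
proof -
  note L = LL_ideal[of 8]
  have "br y * mu R * (\<sigma> $ 0 $ 0 - \<sigma> $ p $ p) * y' * x \<in> LL 8" if x: "x \<in> I" for x
  proof -
    define x' where "x' = br (kap (- p)) * x"
    have "- p \<noteq> 0" using p by simp
    from H_conj_Y[OF s kap_I(1)[OF x] this y']
    obtain \<sigma>' \<zeta> \<zeta>' where \<sigma>': "\<sigma>' \<in> H" "\<And>i j. \<sigma>' $ i $ j
        = (Y (- p) (y' * x', \<zeta>) *v (\<sigma> *v (Y (- p) (- (y' * x'), \<zeta>') *v axis j 1))) $ i"
      unfolding x'_def by blast
    define t where "t = br \<zeta>' * kap (- p)"
    have e: "\<sigma>' $ 0 $ p = \<sigma> $ 0 $ p - (\<sigma> $ 0 $ 0 - \<sigma> $ p $ p) * y' * x + t * \<sigma> $ 0 $ (- p)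
        - y' * x * x * (\<sigma> $ p $ 0 * y') + y' * x * t * \<sigma> $ p $ (- p)"
      unfolding \<sigma>'(2) using p
      by (simp add: t_def x'_def Y_apply entry_simps algebra_simps)
    have "br y * mu R * (\<sigma> $ 0 $ 0 - \<sigma> $ p $ p) * y' * x
        = br y * mu R * \<sigma> $ 0 $ p + t * (br y * mu R * \<sigma> $ 0 $ (- p)) - (br y * mu R * y' * x * x) * (\<sigma> $ p $ 0 * y')
          + (br y * mu R * y' * x * t) * \<sigma> $ p $ (- p) - br y * mu R * \<sigma>' $ 0 $ p"
      unfolding e by (simp add: algebra_simps)
    also have "\<dots> \<in> LL 8"
      using p by (intro ideal_diff[OF L] ideal_add[OF L] ideal_scale[OF L, of "\<sigma> $ p $ 0 * y'"] ideal_scale[OF L, of "\<sigma> $ p $ (- p)"]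
          ideal_scale[OF L, of "br y * mu R * \<sigma> $ 0 $ (- p)"]
          row0_LL col0_LL opp_LL s \<sigma>' y y') auto
    finally show ?thesis .
  qed
  from LL_prod[OF this] show ?thesis by simp
qed

lemma upper_Y_LL: "upper_Y R \<Delta> H \<subseteq> LL 9"
proof -
  have 9: "x \<in> LL 8 \<Longrightarrow> x \<in> LL 9" for x
    by (rule LL_mono[of 8]) simp_all
  show ?thesis
    unfolding upper_Y_def by (auto intro!: 9[OF off_LL] 9[OF diag_LL] 9[OF col0_LL] 9[OF row0_LL] mid_LL)
qed

lemma JH_LL: "JH \<subseteq> LL 9"
  using upper_Y_LL LL_br by (intro JH_subset LL_ideal) auto

text \<open>Coefficients for which elementary matrices of every type are known to lie in \<open>H\<close>. For the long and the extra short
  root elements one more power of \<open>I\<close> is needed than for the short ones.\<close>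

definition A :: "nat \<Rightarrow> 'a set" where
  "A m = ideal_mult (LL m) (Ik (Suc m))"

lemma A_ideal: "ring_ideal (A m)"
  unfolding A_def by (rule ring_ideal_mult)

lemma A_base: "r \<in> LL m \<Longrightarrow> w \<in> Ik (Suc m) \<Longrightarrow> r * w \<in> A m"
  unfolding A_def by (rule ideal_mult_base)

lemma A_induct [consumes 1, case_names mult zero add]:
  assumes "t \<in> A m" "\<And>a b. a \<in> LL m \<Longrightarrow> b \<in> Ik (Suc m) \<Longrightarrow> P (a * b)" "P 0" "\<And>x y. P x \<Longrightarrow> P y \<Longrightarrow> P (x + y)"
  shows "P t"
  using assms(1) unfolding A_def by (rule ideal_gen_additive_induct[OF _ LL_ideal]) (use assms in auto)

lemma A_br: "t \<in> A m \<Longrightarrow> br t \<in> A m"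
  by (induction rule: A_induct) (simp_all add: A_base LL_br Ik_br ideal_add[OF A_ideal] ideal_0[OF A_ideal])

lemma A_X:
  assumes "t \<in> A m" "gp p r"
  shows "X p r t \<in> H"
  using assms(1)
proof (induction rule: A_induct)
  case (mult a b)
  then show ?case
    using LL_X[OF mult(1) _ assms(2)] Ik_Suc_subset by auto
next
  case (add x y)
  then show ?case
    using H_mult gpD[OF assms(2)] by (simp flip: X_add)
qed (simp add: X_0 H_one)

lemma A_long:
  assumes "t \<in> A m" "r \<noteq> 0"
  shows "Y r (0, zz t) \<in> H"
  using assms(1)
proof (induction rule: A_induct)
  case (mult a b)
  then show ?case
    using LL_long assms(2) by simp
next
  case (add x y)
  then show ?case
    using Y_hp_H[OF assms(2), of "(0, zz x)" "(0, zz y)"] by (simp add: hp_eq zz_simps)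
qed (simp add: Y_0 H_one zz_simps)

lemma Y_ci_add:
  assumes "(x, z) \<in> \<Delta>" "r \<noteq> 0" "Y r ((x, z) \<odot> u) \<in> H" "Y r ((x, z) \<odot> v) \<in> H" "br v * z * u \<in> A m"
  shows "Y r ((x, z) \<odot> (u + v)) \<in> H"
proof -
  have "(x, z) \<in> Delta_max R"
    using assms(1) Delta_max by auto
  from ci_add[OF this, of u v] show ?thesis
    using Y_hp_H[OF assms(2)] A_long[OF assms(5,2)] assms(3,4) by simp
qed

lemma A_Y:
  assumes "t \<in> A m" "r \<noteq> 0" "\<alpha> \<in> \<Delta>"
  shows "Y r (\<alpha> \<odot> t) \<in> H"
proof -
  obtain x z where \<alpha>: "\<alpha> = (x, z)" by (cases \<alpha>)
  have "t \<in> A m \<and> Y r ((x, z) \<odot> t) \<in> H"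
    using assms(1)
  proof (induction rule: A_induct)
    case (mult a b)
    then show ?case
      using LL_Y[OF mult(1) assms(3,2) mult(2)] A_base by (simp add: \<alpha>)
  next
    case (add u v)
    then show ?case
      using Y_ci_add[OF assms(3)[unfolded \<alpha>] assms(2), of u v m] ideal_add[OF A_ideal] ideal_scale[OF A_ideal] by blast
  qed (simp add: ci_eq Y_0 H_one ideal_0[OF A_ideal])
  then show ?thesis by (simp add: \<alpha>)
qed

text \<open>The matrices \<open>Y\<close> in a normalisation for which multiplication of matrices is the Heisenberg operation in the same order.\<close>

definition F :: "'n idx \<Rightarrow> 'a \<times> 'a \<Rightarrow> ('a, 'n) matrix" where
  "F p \<alpha> = E (axis p 1) (axis 0 (fst \<alpha>)) (lmi * snd \<alpha>)"

lemma F_hp: "p \<noteq> 0 \<Longrightarrow> F p \<alpha> ** F p \<beta> = F p (\<alpha> \<boxplus> \<beta>)"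
  unfolding F_def by (subst E_mult) (cases \<alpha>; cases \<beta>; simp add: B_axis_axis axis_add hp_eq algebra_simps)+

lemma F_Y: "F p (x, z) = Y p (x, br z * lm)"
  by (simp add: F_def Y_def mult.commute)

lemma F_ci: "F p ((x, z) \<odot> a) = Y p ((x, br z * lm) \<odot> a)"
  by (simp add: F_Y ci_eq mult_ac)

lemma A_F_long:
  assumes "t \<in> A m" "p \<noteq> 0"
  shows "F p (0, zz t) \<in> H"
proof -
  have "br (zz t) * lm = zz (- t)"
    by (simp add: zz_def left_diff_distrib mult.assoc)
  then show ?thesis
    using A_long[OF ideal_neg[OF A_ideal assms(1)] assms(2)] by (simp only: F_Y)
qed

lemma A_F: "t \<in> A m \<Longrightarrow> p \<noteq> 0 \<Longrightarrow> \<alpha> \<in> \<Delta> \<Longrightarrow> F p (\<alpha> \<odot> t) \<in> H"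
  using A_Y[of t m p "(fst \<alpha>, br (snd \<alpha>) * lm)"] D.flip_mem[of "fst \<alpha>" "snd \<alpha>"] Delta_max F_ci[of p "fst \<alpha>" "snd \<alpha>" t]
  by simp

lemma F_to_Y:
  assumes "\<alpha> \<in> \<Delta>" "p \<noteq> 0" "F p (\<alpha> \<odot> (- w)) \<in> H"
  shows "Y p (\<alpha> \<odot> w) \<in> H"
proof -
  obtain x z where \<alpha>: "\<alpha> = (x, z)" by (cases \<alpha>)
  have z: "br z * lm = - z - br x * mu R * x"
    using Delta_maxD assms(1) by (simp add: \<alpha> algebra_simps eq_neg_iff_add_eq_0)
  have "(x, br z * lm) \<odot> (- w) = inv\<^bsub>heis R\<^esub> (\<alpha> \<odot> w)"
    unfolding z \<alpha> ci_eq hinv_eq by (simp add: algebra_simps)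
  then have "Y p (inv\<^bsub>heis R\<^esub> (\<alpha> \<odot> w)) \<in> H"
    using assms(3) by (simp add: \<alpha> F_ci)
  then have "inv\<^bsub>G\<^esub> (Y p (\<alpha> \<odot> w)) \<in> H"
    using inv_Y[OF assms(2) D.ci_mem[OF assms(1)]] by simp
  from H_inv[OF this] show ?thesis
    using Y_in_G[OF assms(2) D.ci_mem[OF assms(1)]] by simp
qed

text \<open>Coordinates are added one at a time. Each addition changes the long root part of the transvection by
  \<open>zz t\<close> with \<open>t \<in> A m\<close>.\<close>

lemma hyperbolic_part:
  fixes p :: "'n idx"
  assumes p: "p \<noteq> 0" and D: "\<And>l. l \<noteq> 0 \<Longrightarrow> D $ l \<in> A m" and S: "finite S" "0 \<notin> S" "- p \<notin> S"
  defines "d \<equiv> \<lambda>S. \<Sum>l\<in>S. axis l (D $ l)"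
  shows "E (axis p 1) (d S) (- lmi * q (d S)) \<in> H"
  using S
proof (induction S rule: finite_induct)
  case empty
  then show ?case
    by (simp add: d_def E_zero H_one)
next
  case (insert l S)
  define x where "x = D $ l"
  have l: "l \<noteq> 0" "l \<noteq> - p" and x: "x \<in> A m"
    using insert D by (auto simp: x_def)
  have dl: "d (insert l S) = d S + axis l x"
    using insert by (simp add: d_def x_def add.commute)
  have d0: "d S $ 0 = 0" "d S $ (- p) = 0"
    using insert by (auto simp: d_def axis_nth_if intro!: sum.neutral)
  have dS: "d S $ k \<in> A m" for k
  proof -
    have "D $ l \<in> A m" if "l \<in> S" for l
      using that insert by (intro D) auto
    then show ?thesis
      by (auto simp: d_def axis_nth_if ideal_0[OF A_ideal] intro!: ideal_sum[OF A_ideal])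
  qed
  have pd: "B (axis p 1) (d S) = 0"
    using p d0 by (simp add: B_axis_left)
  define t where "t = h (axis l x) (d S)"
  have t: "t \<in> A m"
    unfolding t_def h_axis_left by (auto intro!: ideal_scale[OF A_ideal] dS ideal_0[OF A_ideal])
  have 1: "E (axis p 1) (axis l x) 0 \<in> H"
  proof (cases "l = p")
    case True
    then show ?thesis
      using X_long[OF p, of x] A_long[OF A_br[OF x] p] by (simp add: X_def)
  next
    case False
    then show ?thesis
      using A_X[OF x, of p l] l p by (simp add: X_def gp_def)
  qed
  have 2: "E (axis p 1) 0 (- lmi * zz t) \<in> H"
    using A_long[OF t p] by (simp add: Y_def zz_def lm_lmi_far right_diff_distrib mult_ac)
  have "E (axis p 1) (d (insert l S)) (- lmi * q (d (insert l S)))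
      = E (axis p 1) (d S) (- lmi * q (d S)) ** E (axis p 1) (axis l x) 0 ** E (axis p 1) 0 (- lmi * zz t)"
  proof -
    have "B (d S) (axis l x) = h (d S) (axis l x) + br t * lm"
      by (simp add: B_eq d0 t_def)
    then show ?thesis
      using p l pd by (simp add: E_mult B_axis_axis dl t_def[symmetric] zz_def algebra_simps)
  qed
  then show ?case
    using insert 1 2 H_mult by simp
qed

text \<open>The hyperbolic coordinates of the direction are negligible and can be split off by \<open>hyperbolic_part\<close>; what remains
  is an extra short root element.\<close>

lemma extra_part:
  fixes p :: "'n idx"
  assumes p: "p \<noteq> 0" and D: "\<And>l. l \<noteq> 0 \<Longrightarrow> D $ l \<in> A m" and Dp: "D $ (- p) = 0"
    and E: "E (axis p 1) D \<zeta> \<in> H"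
  shows "F p (D $ 0, q D + lm * \<zeta>) \<in> H"
proof -
  define d where "d = (\<Sum>l\<in>- {0, - p}. axis l (D $ l))"
  have D_eq: "D = d + axis 0 (D $ 0)"
  proof -
    have "D = (\<Sum>l\<in>insert 0 (- {0}). axis l (D $ l))"
      by (subst sum_axis[of D, symmetric]) (rule sum.cong, auto)
    also have "\<dots> = axis 0 (D $ 0) + (\<Sum>l\<in>- {0}. axis l (D $ l))"
      by (rule sum.insert) auto
    also have "(\<Sum>l\<in>- {0}. axis l (D $ l)) = d"
      unfolding d_def by (rule sum.mono_neutral_right) (auto simp: Dp)
    finally show ?thesis by (simp add: add.commute)
  qed
  have d0: "d $ 0 = 0" "d $ (- p) = 0"
    by (auto simp: d_def axis_nth_if intro!: sum.neutral)
  have qd: "q D = q d"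
    by (subst D_eq, subst (2) D_eq) (simp add: h_axis_left h_axis_right)
  have 1: "E (axis p 1) d (- lmi * q d) \<in> H"
    unfolding d_def by (rule hyperbolic_part[OF p D]) auto
  have "E (axis p 1) d (- lmi * q d) ** F p (D $ 0, q D + lm * \<zeta>) = E (axis p 1) D \<zeta>"
    using p d0 by (subst (3) D_eq) (simp add: F_def E_mult B_axis_left B_axis0_right axis_nth_if qd algebra_simps)
  then show ?thesis
    using H_cancel[OF 1] E by simp
qed

lemma F_cancel_right: "p \<noteq> 0 \<Longrightarrow> F p (\<alpha> \<boxplus> \<beta>) \<in> H \<Longrightarrow> F p \<beta> \<in> H \<Longrightarrow> F p \<alpha> \<in> H"
  using H_cancel_right[of "F p \<beta>" "F p \<alpha>"] by (simp add: F_hp)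

end


section \<open>Columns of the matrices in the subgroup\<close>

context normalized_subgroup
begin

lemma col_Delta: "\<sigma> \<in> H \<Longrightarrow> p \<noteq> 0 \<Longrightarrow> Q (\<sigma> *v axis p 1) \<in> \<Delta>"
  by (rule upper_Z_Delta) (auto simp: upper_Z_def mult_axis_column)

lemma LL_8_9: "r \<in> LL 8 \<Longrightarrow> r \<in> LL 9"
  by (rule LL_mono[of 8]) simp_all

lemma h_cols_LL:
  assumes s: "\<sigma> \<in> H" and r: "r \<noteq> 0" "p \<noteq> 0" "r \<notin> range Plus \<or> p \<notin> range Minus \<or> p \<noteq> - r"
  shows "h (\<sigma> *v axis r 1) (\<sigma> *v axis p 1) \<in> LL 8"
  unfolding h_def
proof (rule ideal_sum[OF LL_ideal])
  fix i :: "'n idx" assume i: "i \<in> range Plus"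
  then have i0: "i \<noteq> 0" by auto
  have "i \<noteq> r \<or> - i \<noteq> p"
    using i r by auto
  then show "br ((\<sigma> *v axis r 1) $ i) * (\<sigma> *v axis p 1) $ (- i) \<in> LL 8"
    using i0 r off_LL[OF s, of i r] off_LL[OF s, of "- i" p]
    by (auto simp: mult_axis_nth intro: ideal_scale[OF LL_ideal] ideal_scale2[OF LL_ideal] LL_br)
qed

lemma q_col_LL: "\<sigma> \<in> H \<Longrightarrow> p \<noteq> 0 \<Longrightarrow> snd (Q (\<sigma> *v axis p 1)) \<in> LL 8"
  using h_cols_LL[of \<sigma> p p] by (simp add: Q_eq)

text \<open>Expand \<open>B\<close> at the columns \<open>p\<close> and \<open>-p\<close> of \<open>\<sigma>\<close>; all terms but one contain an off-diagonal entry.\<close>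

lemma unit_LL:
  assumes s: "\<sigma> \<in> H" and "p \<noteq> 0" "r \<noteq> 0"
  shows "br (\<sigma> $ p $ p) * \<sigma> $ r $ r - 1 \<in> LL 8"
proof -
  note L = LL_ideal[of 8]
  have gen: "k = x + s \<Longrightarrow> x - k = - s" for k x s :: 'a
    by simp
  define u w where "u = \<sigma> *v axis p 1" and "w = \<sigma> *v axis (- p) 1"
  have "kap p = B u w"
    using assms(2) by (simp add: u_def w_def G_isom[OF H_G[OF s]] B_axis_axis)
  also have "\<dots> = (\<Sum>l\<in>UNIV. B u (axis l 1) * w $ l)"
    by (rule B_expand)
  also have "\<dots> = B u (axis (- p) 1) * w $ (- p) + (\<Sum>l\<in>UNIV - {- p}. B u (axis l 1) * w $ l)"
    by (rule sum.remove) simp_all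
  also have "B u (axis (- p) 1) * w $ (- p) = br (\<sigma> $ p $ p) * kap p * \<sigma> $ (- p) $ (- p)"
    using assms(2) by (simp add: B_axis_right u_def w_def mult_axis_nth)
  finally have "br (\<sigma> $ p $ p) * kap p * \<sigma> $ (- p) $ (- p) - kap p = - (\<Sum>l\<in>UNIV - {- p}. B u (axis l 1) * w $ l)"
    by (rule gen)
  also have "\<dots> \<in> LL 8"
  proof (rule ideal_neg[OF L ideal_sum[OF L]])
    fix l assume l: "l \<in> UNIV - {- p}"
    show "B u (axis l 1) * w $ l \<in> LL 8"
    proof (cases "l = 0")
      case True
      have "MD u"
        unfolding u_def by (intro MD_G H_G s) (simp add: assms)
      then have "br (u $ 0) * mu R * \<sigma> $ 0 $ (- p) \<in> LL 8"
        using assms by (intro row0_LL[OF s]) simp_all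
      then show ?thesis
        by (simp add: True B_axis0_right w_def mult_axis_nth)
    next
      case False
      then have "w $ l \<in> LL 8"
        using l assms off_LL[OF s, of l "- p"] by (simp add: w_def mult_axis_nth)
      then show ?thesis
        by (rule ideal_scale[OF L])
    qed
  qed
  finally have 1: "br (\<sigma> $ p $ p) * kap p * \<sigma> $ (- p) $ (- p) - kap p \<in> LL 8" .
  have "br (\<sigma> $ p $ p) * \<sigma> $ r $ r - 1
      = br (kap p) * (br (\<sigma> $ p $ p) * kap p * \<sigma> $ (- p) $ (- p) - kap p)
        + br (\<sigma> $ p $ p) * (\<sigma> $ r $ r - \<sigma> $ (- p) $ (- p))"
    by (simp add: right_diff_distrib mult.left_commute[of "br (kap p)"] mult.assoc)
  also have "\<dots> \<in> LL 8"
    using assms by (intro ideal_add[OF L] ideal_scale[OF L] 1 diag_LL s) simp_all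
  finally show ?thesis .
qed

lemma A_prod: "r \<in> LL m \<Longrightarrow> y \<in> I \<Longrightarrow> x \<in> Ik m \<Longrightarrow> c * (y * x) * r \<in> A m"
  using A_base[OF ideal_scale[OF LL_ideal, of r m c] Ik_Suc_mem[of y x m]] by (simp only: mult_ac)

text \<open>The transvection is a product of four elementary matrices, and only for \<open>g\<close> the coefficient is not divisible by an
  off-diagonal entry of \<open>\<sigma>\<close>.\<close>

lemma row_transvection_mod:
  fixes a b c :: "'n idx"
  assumes s: "\<sigma> \<in> H" and gps: "gp a b" "gp a c" "gp b c" and x: "x \<in> Ik 8" "x \<in> I"
  defines "\<tau> \<equiv> E (axis a (\<sigma> $ a $ b) + axis b (- \<sigma> $ a $ a))
      (x *s (axis a (\<sigma> $ a $ c) + axis b 0 + axis c (- \<sigma> $ a $ a))) 0"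
    and "g \<equiv> X b c (br (\<sigma> $ a $ a) * x * \<sigma> $ a $ a)"
  shows "g \<in> N" "\<tau> ** inv\<^bsub>G\<^esub> g \<in> H"
proof -
  note ne = gpD[OF gps(1)] gpD[OF gps(2)] gpD[OF gps(3)]
  define sa sb sc where "sa = \<sigma> $ a $ a" and "sb = \<sigma> $ a $ b" and "sc = \<sigma> $ a $ c"
  define v where "v = axis a (x * sc) + axis c (- (x * sa))"
  have "br sa * x * sa \<in> I"
    using ideal_scale[OF I x(2), of "br sa * sa"] by (simp add: mult_ac)
  then show g: "g \<in> N"
    unfolding g_def sa_def[symmetric] using ne by (intro X_norm) auto
  have sbc: "sb \<in> LL 8" "sc \<in> LL 8"
    unfolding sb_def sc_def using gps by (auto intro: gp_off_LL s)
  have e1: "E (axis b (- sa)) v 0 = g ** X b a (sc * (- br sa * x))"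
    unfolding v_def g_def sa_def[symmetric]
    by (subst add.commute, subst E_add_right) (use ne in \<open>auto simp: B_axis_axis E_axis_axis mult_ac\<close>)
  have e2: "E (axis a sb) v 0 = X a a (sc * (br sb * x)) ** X a c (br sb * (- (x * sa)))"
    unfolding v_def by (subst E_add_right) (use ne in \<open>auto simp: B_axis_axis E_axis_axis mult_ac\<close>)
  have "\<tau> = E (axis b (- sa)) v 0 ** E (axis a sb) v 0"
  proof -
    have "x *s (axis a sc + axis b 0 + axis c (- sa)) = v"
      by (simp add: v_def axis_scale vector_add_ldistrib)
    then show ?thesis
      unfolding \<tau>_def sa_def[symmetric] sb_def[symmetric] sc_def[symmetric] using ne
      by (subst E_add_left) (auto simp: B_axis_axis v_def)
  qed
  then have \<tau>: "\<tau> = g ** (X b a (sc * (- br sa * x)) ** (X a a (sc * (br sb * x)) ** X a c (br sb * (- (x * sa)))))"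
    unfolding e1 e2 by (simp only: matrix_mul_assoc)
  have "X b a (sc * (- br sa * x)) \<in> H"
    using ideal_scale[OF Ik x(1), of "- br sa"] gps by (intro LL_X[OF sbc(2)]) (auto simp: gp_sym)
  moreover have "X a c (br sb * (- (x * sa))) \<in> H"
    using ideal_neg[OF Ik ideal_scale2[OF Ik x(1)]] gps by (intro LL_X[OF LL_br[OF sbc(1)]]) auto
  moreover have "X a a (sc * (br sb * x)) \<in> H"
  proof -
    obtain p where p: "gp p a" "gp p c"
      using pick[of a c a] ne by blast
    then have "sc \<in> L 7 p a"
      unfolding sc_def using gps by (intro off_diagonal_L7[OF s]) auto
    moreover have "br sb * x \<in> Ik (Suc 7)"
      using ideal_scale[OF Ik x(1)] by simp
    ultimately show ?thesis
      using L_long[of sc 7 p a] p ne by (simp only: X_long simp_thms)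
  qed
  ultimately have "X b a (sc * (- br sa * x)) ** (X a a (sc * (br sb * x)) ** X a c (br sb * (- (x * sa)))) \<in> H"
    by (intro H_mult)
  from G.normalizer_conj[OF g this subgroup.subset[OF H]] show "\<tau> ** inv\<^bsub>G\<^esub> g \<in> H"
    by (simp only: \<tau> mult_G)
qed

lemma F_zz_right: "t \<in> A m \<Longrightarrow> p \<noteq> 0 \<Longrightarrow> F p (x, z + zz t) \<in> H \<Longrightarrow> F p (x, z) \<in> H"
  using F_cancel_right[of p "(x, z)" "(0, zz t)"] A_F_long by (simp add: hp_eq)

text \<open>The conjugates of \<open>t = X (- a) (- c) y\<close> by \<open>\<sigma> \<tau> \<sigma>\<^sup>-\<^sup>1\<close> and by \<open>g\<close> are transvections along the
  basis vector of index \<open>-a\<close>, with directions \<open>w1\<close> and \<open>w2\<close>, so their quotient is one with direction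
  \<open>w1 - w2\<close>. The hyperbolic coordinates of this difference are negligible, and \<open>extra_part\<close> applies.\<close>

lemma column_transvection:
  fixes a b c :: "'n idx"
  assumes s: "\<sigma> \<in> H" and gps: "gp a b" "gp a c" "gp b c" and x: "x \<in> Ik 8" "x \<in> I" and y: "y \<in> I"
  defines "u \<equiv> axis a (\<sigma> $ a $ b) + axis b (- \<sigma> $ a $ a)"
    and "v \<equiv> axis a (\<sigma> $ a $ c) + axis b 0 + axis c (- \<sigma> $ a $ a)"
  defines "g0 \<equiv> (br ((\<sigma> *v u) $ c) * kap c * y * x) *s v - (lmi * br x * br ((\<sigma> *v v) $ c) * kap c * y) *s u"
  shows "F (- a) (Q (\<sigma> *v g0)) \<in> H"
proof -
  note ne = gpD[OF gps(1)] gpD[OF gps(2)] gpD[OF gps(3)]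
  note A = A_ideal[of 8]
  define sa where "sa = \<sigma> $ a $ a"
  define \<tau> where "\<tau> = E u (x *s v) 0"
  define g where "g = X b c (br sa * x * sa)"
  define t where "t = X (- a) (- c) y"
  define \<xi> where "\<xi> = \<sigma> ** \<tau> ** inv\<^bsub>G\<^esub> \<sigma>"
  define w1 where "w1 = \<xi> *v axis (- c) y"
  define w2 where "w2 = axis (- c) y + axis b (- (lmi * kap c * br (br sa * x * sa) * y))"
  define P V where "P = (\<sigma> *v u) $ c" and "V = (\<sigma> *v v) $ c"
  define \<rho> \<theta> where "\<rho> = br P * kap c * y" and "\<theta> = lmi * br x * br V * kap c * y"
  have orth: "\<sigma> $ a $ a * \<sigma> $ a $ c + \<sigma> $ a $ b * 0 + \<sigma> $ a $ c * (- \<sigma> $ a $ a) = 0"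
    by (simp add: mult.commute)
  note T = row_transvection[OF s gps x(2) orth, folded u_def v_def, folded \<tau>_def]
  note M = row_transvection_mod[OF s gps x, folded u_def v_def sa_def, folded \<tau>_def, folded sa_def g_def]
  have tN: "t \<in> N"
    unfolding t_def using ne y by (intro X_norm) auto
  have \<sigma>N: "\<sigma> \<in> N"
    using normal_imp_subgroup[OF G.subgroup_in_normalizer[OF H], THEN subgroup.subset] s by auto
  have \<xi>N: "\<xi> \<in> N"
    unfolding \<xi>_def using subgroup.m_inv_closed[OF subgroup_N \<sigma>N] by (intro N_mult T(1) \<sigma>N) auto
  have \<xi>a: "\<xi> *v axis (- a) 1 = axis (- a) 1"
    unfolding \<xi>_def by (rule T(2))
  have w1a: "B (axis (- a) 1) w1 = 0"
    unfolding w1_def using ne by (subst \<xi>a[symmetric], subst G_isom[OF N_G[OF \<xi>N]]) (simp add: B_axis_axis)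
  have w2a: "B (axis (- a) 1) w2 = 0" and w22: "B w2 w2 = 0" and aa: "B (axis (- a) 1) (axis (- a) 1) = 0"
    and w20: "w2 $ 0 = 0" and qw2: "q w2 = 0"
    unfolding w2_def using ne by (auto simp: B_axis_axis axis_nth_if h_axis_left)
  have e1: "\<xi> ** t ** inv\<^bsub>G\<^esub> \<xi> = E (axis (- a) 1) w1 0"
    unfolding t_def X_def G_E_conj[OF N_G[OF \<xi>N]] \<xi>a w1_def ..
  have e2: "g ** t ** inv\<^bsub>G\<^esub> g = E (axis (- a) 1) w2 0"
  proof -
    have "g *v axis (- a) 1 = axis (- a) 1" "g *v axis (- c) y = w2"
      unfolding g_def w2_def using ne by (simp_all add: X_apply axis_nth_if axis_minus[symmetric] mult_ac)
    then show ?thesis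
      unfolding t_def X_def G_E_conj[OF N_G[OF M(1)]] by simp
  qed
  have "inv\<^bsub>G\<^esub> (E (axis (- a) 1) w2 0) = E (axis (- a) 1) (- w2) 0"
  proof (rule inv_G_eqI)
    show "E (axis (- a) 1) w2 0 \<in> carrier G"
      unfolding e2[symmetric] using N_G[OF M(1)] N_G[OF tN] by (simp flip: mult_G)
    show "E (axis (- a) 1) w2 0 ** E (axis (- a) 1) (- w2) 0 = mat 1"
      using E_inverse[OF aa w2a, of 0] by (simp add: w22)
  qed
  moreover have "(\<xi> ** t ** inv\<^bsub>G\<^esub> \<xi>) ** inv\<^bsub>G\<^esub> (g ** t ** inv\<^bsub>G\<^esub> g) \<in> H"
    using G.conj_compare[OF H s T(1) tN M(1)] M(2) by (simp only: mult_G \<xi>_def)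
  ultimately have "E (axis (- a) 1) w1 0 ** E (axis (- a) 1) (- w2) 0 \<in> H"
    unfolding e1 e2 by (simp only:)
  then have D: "E (axis (- a) 1) (w1 - w2) (lmi * B w1 w2) \<in> H"
    using aa w1a w2a by (simp add: E_mult)
  have w1: "w1 = axis (- c) y + \<sigma> *v g0"
  proof -
    define m where "m = inv\<^bsub>G\<^esub> \<sigma> *v axis (- c) y"
    have \<sigma>m: "\<sigma> *v m = axis (- c) y"
      unfolding m_def by (rule inv_G_apply(2)[OF H_G[OF s]])
    have "B u m = B (\<sigma> *v u) (\<sigma> *v m)" "B v m = B (\<sigma> *v v) (\<sigma> *v m)"
      by (simp_all add: G_isom[OF H_G[OF s]])
    then have Bm: "B u m = br ((\<sigma> *v u) $ c) * kap c * y" "B v m = br ((\<sigma> *v v) $ c) * kap c * y"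
      unfolding \<sigma>m using ne by (simp_all add: B_axis_right)
    have "w1 = \<sigma> *v (\<tau> *v m)"
      by (simp add: w1_def \<xi>_def m_def flip: matrix_vector_mul_assoc)
    also have "\<tau> *v m = m + g0"
      unfolding g0_def Bm[symmetric] by (simp add: \<tau>_def E_apply vector_smult_assoc vec_eq_iff Bm mult_ac)
    finally show ?thesis
      by (simp add: matrix_vector_right_distrib \<sigma>m)
  qed
  have Pv: "(\<sigma> *v u) $ l = \<sigma> $ a $ b * \<sigma> $ l $ a - sa * \<sigma> $ l $ b" for l
    by (simp add: u_def sa_def matrix_vector_right_distrib mult_axis_nth mult.commute)
  have Vv: "(\<sigma> *v v) $ l = \<sigma> $ a $ c * \<sigma> $ l $ a - sa * \<sigma> $ l $ c" for l
    by (simp add: v_def sa_def matrix_vector_right_distrib mult_axis_nth mult.commute)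
  have P: "P \<in> LL 8"
    unfolding P_def Pv using gps
    by (intro ideal_diff[OF LL_ideal] ideal_scale[OF LL_ideal] gp_off_LL s) (auto simp: gp_sym)
  have xy: "\<rho> * x * r \<in> A 8" "\<theta> * r' \<in> A 8" if "r' \<in> LL 8" for r r'
    using A_prod[OF ideal_scale[OF LL_ideal LL_br[OF P], of r] y x(1), of "kap c"]
      A_prod[OF that y Ik_br[OF x(1)], of "lmi * br V * kap c"]
    by (simp_all add: \<rho>_def \<theta>_def mult_ac)
  have sg: "\<sigma> *v g0 = (\<rho> * x) *s (\<sigma> *v v) - \<theta> *s (\<sigma> *v u)"
    by (simp add: g0_def \<rho>_def \<theta>_def P_def V_def matrix_vector_mult_diff_distrib mult_vec_scale)
  have DA: "(w1 - w2) $ l \<in> A 8" if l: "l \<noteq> 0" for l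
  proof (cases "l = b")
    case False
    then have "(w1 - w2) $ l = \<rho> * x * (\<sigma> *v v) $ l - \<theta> * (\<sigma> *v u) $ l"
      by (simp add: w1 w2_def sg axis_nth_if)
    moreover have "(\<sigma> *v u) $ l \<in> LL 8" if "l \<noteq> a"
      unfolding Pv using ne False that l
      by (intro ideal_diff[OF LL_ideal] ideal_scale[OF LL_ideal] off_LL[OF s]) auto
    moreover have "(\<sigma> *v u) $ l \<in> LL 8" if "l = a"
      unfolding Pv that sa_def using ne by (simp add: mult.commute ideal_0[OF LL_ideal])
    ultimately show ?thesis
      using xy by (metis ideal_diff[OF A])
  next
    case True
    have "(w1 - w2) $ b = \<rho> * x * (\<sigma> *v v) $ b - \<theta> * (\<sigma> $ a $ b * \<sigma> $ b $ a)
        + (lmi * kap c * sa) * (y * br x) * (br (\<sigma> $ a $ c) * \<sigma> $ b $ b * br (\<sigma> $ c $ a)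
          - br sa * (br (\<sigma> $ c $ c) * \<sigma> $ b $ b - 1))"
      unfolding w1 w2_def sg using ne
      by (simp add: axis_nth_if Pv \<theta>_def V_def Vv algebra_simps)
    moreover have "br (\<sigma> $ a $ c) * \<sigma> $ b $ b * br (\<sigma> $ c $ a) - br sa * (br (\<sigma> $ c $ c) * \<sigma> $ b $ b - 1) \<in> LL 8"
      using gps ne by (intro ideal_diff[OF LL_ideal] ideal_scale[OF LL_ideal] LL_br gp_off_LL unit_LL s) (auto simp: gp_sym)
    moreover have "\<sigma> $ a $ b * \<sigma> $ b $ a \<in> LL 8"
      using gps by (intro ideal_scale[OF LL_ideal] gp_off_LL s) (auto simp: gp_sym)
    ultimately show ?thesis
      unfolding True using xy A_prod[OF _ y Ik_br[OF x(1)]] by (metis ideal_add[OF A] ideal_diff[OF A])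
  qed
  have Da: "(w1 - w2) $ (- (- a)) = 0"
  proof -
    have "kap (- a) * (w1 - w2) $ a = 0"
      using w1a w2a ne by (simp add: B_axis_left right_diff_distrib)
    then have "br (kap (- a)) * (kap (- a) * (w1 - w2) $ a) = 0"
      by (simp only: mult_zero_right)
    then show ?thesis
      by (simp only: kap_br_assoc idx_minus_minus)
  qed
  have na: "- a \<noteq> 0" using ne by simp
  have 1: "F (- a) ((w1 - w2) $ 0, q (w1 - w2) + lm * (lmi * B w1 w2)) \<in> H"
    by (rule extra_part[OF na DA Da D])
  define d where "d = h w2 (w1 - w2)"
  have hA: "d \<in> A 8"
    unfolding d_def h_def by (rule ideal_sum[OF A], rule ideal_scale[OF A DA]) auto
  have q12: "q (w1 - w2) + lm * (lmi * B w1 w2) = q w1 + zz (- d)"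
  proof -
    have "h w2 w1 = d"
      by (simp add: d_def qw2)
    then show ?thesis
      by (simp add: B_eq w20 qw2 zz_def)
  qed
  have "(w1 - w2) $ 0 = w1 $ 0"
    by (simp add: w20)
  then have 2: "F (- a) (w1 $ 0, q w1) \<in> H"
    using F_zz_right[OF ideal_neg[OF A hA] na, of "w1 $ 0" "q w1"] 1 by (simp only: q12)
  define e where "e = h (\<sigma> *v g0) (axis (- c) y) - br y * y * br x * br V * P"
  have "br y * y * br x * br V * P \<in> A 8"
    using A_prod[OF P y Ik_br[OF x(1)], of "br y * br V"] by (simp add: mult_ac)
  moreover have "h (\<sigma> *v g0) (axis (- c) y) \<in> A 8"
  proof -
    have "(\<sigma> *v g0) $ c \<in> A 8"
      using DA[of c] ne by (simp add: w1 w2_def axis_nth_if)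
    then show ?thesis
      by (auto simp: h_axis_right ideal_0[OF A] intro: ideal_scale2[OF A] A_br)
  qed
  ultimately have e: "e \<in> A 8"
    unfolding e_def by (intro ideal_diff[OF A])
  \<comment> \<open>the two terms are conjugate to each other up to \<open>lm\<close>, so this is \<open>zz\<close> of a negligible element\<close>
  have "B (axis (- c) y) (\<sigma> *v g0) = lm * (br y * y * br P * x * V) - br y * y * br x * br V * P"
  proof -
    have "kap c * kap (- c) = lm"
      using ne by (intro kap_opp)
    moreover have "B (axis (- c) y) (\<sigma> *v g0) = (kap c * kap (- c)) * (br y * y * br P * x * V)
        - lmi * (kap c * kap (- c)) * (br y * y * br x * br V * P)"
      using ne by (simp add: B_axis_left sg \<rho>_def \<theta>_def P_def V_def algebra_simps)
    ultimately show ?thesis by simp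
  qed
  then have "q w1 = q (\<sigma> *v g0) + zz e"
    using Q_add[of "axis (- c) y" "\<sigma> *v g0"] ne
    by (simp add: w1 Q_eq hp_eq e_def zz_def axis_nth_if mult_ac) (simp add: algebra_simps)
  moreover have "w1 $ 0 = (\<sigma> *v g0) $ 0"
    using ne by (simp add: w1 axis_nth_if)
  ultimately show ?thesis
    using 2 F_zz_right[OF e na] by (simp add: Q_eq)
qed


lemma F_zz_left: "t \<in> A m \<Longrightarrow> p \<noteq> 0 \<Longrightarrow> \<beta> \<in> \<Delta> \<Longrightarrow> t' \<in> A m
    \<Longrightarrow> F p (\<alpha> \<boxplus> \<beta> \<odot> t \<boxplus> (0, zz t')) \<in> H \<Longrightarrow> F p \<alpha> \<in> H"
  using F_cancel_right[of p "\<alpha> \<boxplus> \<beta> \<odot> t" "(0, zz t')"] F_cancel_right[of p \<alpha> "\<beta> \<odot> t"] A_F A_F_long by blast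

text \<open>In \<open>column_transvection\<close> the vector \<open>\<sigma> g0\<close> is a combination of three columns of \<open>\<sigma>\<close>. The coefficients of the
  columns \<open>a\<close> and \<open>c\<close> are negligible, so only column \<open>b\<close> remains.\<close>

lemma column_extra_mult:
  fixes p b :: "'n idx"
  assumes s: "\<sigma> \<in> H" and pb: "gp p b" and y: "y \<in> I" and w: "w \<in> Ik 8"
  shows "Y p (Q (\<sigma> *v axis b 1) \<odot> (y * w)) \<in> H"
proof -
  define a where "a = - p"
  have gab: "gp a b" using pb by (simp add: a_def)
  obtain c where c: "gp c a" "gp c b"
    using pick[of a b b] gpD[OF gab] by blast
  have gps: "gp a b" "gp a c" "gp b c"
    using gab c by (simp_all add: gp_sym)
  note ne = gpD[OF gps(1)] gpD[OF gps(2)] gpD[OF gps(3)]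
  note A = A_ideal[of 8]
  define sa sb sc where "sa = \<sigma> $ a $ a" and "sb = \<sigma> $ a $ b" and "sc = \<sigma> $ a $ c"
  define c0 where "c0 = \<sigma> $ c $ c"
  \<comment> \<open>with this choice the coefficient of column \<open>b\<close> becomes \<open>- y w\<close> times the norms of \<open>c0\<close> and \<open>sa\<close>,
    which are 1 modulo negligible terms\<close>
  define x where "x = lmi * kap c * br w * br c0"
  have x8: "x \<in> Ik 8"
    unfolding x_def by (rule ideal_scale2[OF Ik ideal_scale[OF Ik Ik_br[OF w]]])
  have "Ik 8 \<subseteq> Ik (Suc 0)"
    by (rule Ik_mono) simp
  moreover have "Ik (Suc 0) \<subseteq> I"
  proof
    fix r assume "r \<in> Ik (Suc 0)"
    then show "r \<in> I"
      by (induction rule: Ik_induct) (simp_all add: ideal_scale2[OF I] ideal_0[OF I] ideal_add[OF I])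
  qed
  ultimately have xI: "x \<in> I"
    using x8 by blast
  define u v where "u = axis a (\<sigma> $ a $ b) + axis b (- \<sigma> $ a $ a)"
    and "v = axis a (\<sigma> $ a $ c) + axis b 0 + axis c (- \<sigma> $ a $ a)"
  define P V where "P = (\<sigma> *v u) $ c" and "V = (\<sigma> *v v) $ c"
  define \<rho> \<theta> where "\<rho> = br P * kap c * y * x" and "\<theta> = lmi * br x * br V * kap c * y"
  define \<kappa> where "\<kappa> = \<theta> * sa"
  have 1: "F p (Q (\<sigma> *v (\<rho> *s v - \<theta> *s u))) \<in> H"
    using column_transvection[OF s gps x8 xI y, folded u_def v_def, folded P_def V_def, folded \<rho>_def \<theta>_def]
    by (simp add: a_def)
  have Pv: "P = sb * \<sigma> $ c $ a - sa * \<sigma> $ c $ b"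
    by (simp add: P_def u_def sa_def sb_def matrix_vector_right_distrib mult_axis_nth mult.commute)
  have Vv: "V = sc * \<sigma> $ c $ a - sa * c0"
    by (simp add: V_def v_def sa_def sc_def c0_def matrix_vector_right_distrib mult_axis_nth mult.commute)
  have P: "P \<in> LL 8"
    unfolding Pv using gps
    by (intro ideal_diff[OF LL_ideal] ideal_scale[OF LL_ideal] gp_off_LL s) (auto simp: gp_sym)
  have sb: "sb \<in> LL 8"
    unfolding sb_def using gps by (intro gp_off_LL s)
  have \<rho>: "\<rho> * r \<in> A 8" for r
    using A_prod[OF ideal_scale[OF LL_ideal LL_br[OF P], of r] y x8, of "kap c"] by (simp add: \<rho>_def mult_ac)
  have \<theta>: "\<theta> * sb \<in> A 8"
    using A_prod[OF sb y Ik_br[OF x8], of "lmi * br V * kap c"] by (simp add: \<theta>_def mult_ac)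
  define \<kappa>a \<kappa>c where "\<kappa>a = \<rho> * sc - \<theta> * sb" and "\<kappa>c = \<rho> * (- sa)"
  have \<kappa>ac: "\<kappa>a \<in> A 8" "\<kappa>c \<in> A 8"
    unfolding \<kappa>a_def \<kappa>c_def by (intro ideal_diff[OF A] \<rho> \<theta>)+
  define ea eb ec where "ea = \<sigma> *v axis a 1" and "eb = \<sigma> *v axis b 1" and "ec = \<sigma> *v axis c 1"
  have "\<rho> *s v - \<theta> *s u = \<kappa> *s axis b 1 + (\<kappa>a *s axis a 1 + \<kappa>c *s axis c 1)"
    using ne by (simp add: vec_eq_iff axis_nth_if u_def v_def \<kappa>_def \<kappa>a_def \<kappa>c_def sa_def sb_def sc_def algebra_simps)
  then have e: "\<sigma> *v (\<rho> *s v - \<theta> *s u) = \<kappa> *s eb + (\<kappa>a *s ea + \<kappa>c *s ec)"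
    by (simp add: matrix_vector_right_distrib mult_vec_scale ea_def eb_def ec_def)
  have B0: "B eb ea = 0" "B eb ec = 0" "B ea ec = 0"
    unfolding ea_def eb_def ec_def G_isom[OF H_G[OF s]] using ne by (simp_all add: B_axis_axis)
  have D: "Q ea \<in> \<Delta>" "Q eb \<in> \<Delta>" "Q ec \<in> \<Delta>"
    unfolding ea_def eb_def ec_def using ne by (auto intro!: col_Delta s)
  have "Q (\<kappa> *s eb + (\<kappa>a *s ea + \<kappa>c *s ec)) = Q eb \<odot> \<kappa> \<boxplus> (Q ea \<odot> \<kappa>a \<boxplus> Q ec \<odot> \<kappa>c
      \<boxplus> (0, zz (br \<kappa>c * \<kappa>a * h ec ea))) \<boxplus> (0, zz (br \<kappa>a * \<kappa> * h ea eb + br \<kappa>c * \<kappa> * h ec eb))"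
    by (simp add: Q_add Q_scale B0 distrib_left mult_ac)
  also have "\<dots> = Q eb \<odot> \<kappa> \<boxplus> Q ea \<odot> \<kappa>a \<boxplus> (0, zz 0) \<boxplus> Q ec \<odot> \<kappa>c
      \<boxplus> (0, zz (br \<kappa>c * \<kappa>a * h ec ea + (br \<kappa>a * \<kappa> * h ea eb + br \<kappa>c * \<kappa> * h ec eb)))"
    by (cases "Q eb"; cases "Q ea"; cases "Q ec") (simp add: hp_eq ci_eq zz_simps algebra_simps)
  finally have 2: "F p (Q eb \<odot> \<kappa> \<boxplus> Q ea \<odot> \<kappa>a \<boxplus> (0, zz 0) \<boxplus> Q ec \<odot> \<kappa>c
      \<boxplus> (0, zz (br \<kappa>c * \<kappa>a * h ec ea + (br \<kappa>a * \<kappa> * h ea eb + br \<kappa>c * \<kappa> * h ec eb)))) \<in> H"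
    using 1 by (simp only: e)
  have "br \<kappa>c * \<kappa>a * h ec ea + (br \<kappa>a * \<kappa> * h ea eb + br \<kappa>c * \<kappa> * h ec eb) \<in> A 8"
    by (intro ideal_add[OF A] ideal_scale2[OF A] A_br \<kappa>ac)
  from F_zz_left[OF \<kappa>ac(2) gpD(1)[OF pb] D(3) this 2]
  have "F p (Q eb \<odot> \<kappa>) \<in> H"
    by (rule F_zz_left[OF \<kappa>ac(1) gpD(1)[OF pb] D(1) ideal_0[OF A]])
  then have 3: "Y p (Q eb \<odot> (- \<kappa>)) \<in> H"
    using F_to_Y[OF D(2) gpD(1)[OF pb], of "- \<kappa>"] by simp
  define d where "d = y * w + \<kappa>"
  have d: "d \<in> A 8"
  proof -
    have k: "lmi * (lm * (br (kap c) * (w * c0))) * kap c = w * c0"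
      by (simp add: mult_ac)
    have \<theta>_eq: "\<theta> = y * (w * c0) * br V"
      unfolding \<theta>_def x_def using k by (simp add: mult_ac)
    then have "d = 1 * (y * w) * (c0 * br sc * sa * br (\<sigma> $ c $ a)
        - ((br c0 * c0 - 1) * (br sa * sa) + (br sa * sa - 1)))"
      unfolding d_def \<kappa>_def \<theta>_eq Vv by (simp add: algebra_simps)
    also have "\<dots> \<in> A 8"
    proof (rule A_prod[OF _ y w])
      show "c0 * br sc * sa * br (\<sigma> $ c $ a) - ((br c0 * c0 - 1) * (br sa * sa) + (br sa * sa - 1)) \<in> LL 8"
        unfolding c0_def sa_def using gps ne
        by (intro ideal_diff[OF LL_ideal] ideal_add[OF LL_ideal] ideal_scale[OF LL_ideal] ideal_scale2[OF LL_ideal]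
            LL_br gp_off_LL unit_LL s) (auto simp: gp_sym)
    qed
    finally show ?thesis .
  qed
  obtain x0 z0 where eb: "Q eb = (x0, z0)" by (cases "Q eb")
  have "Y p ((x0, z0) \<odot> (- \<kappa> + d)) \<in> H"
    using D(2) 3 A_Y[OF d gpD(1)[OF pb] D(2)] unfolding eb
    by (rule Y_ci_add[OF _ gpD(1)[OF pb], where m = 8]) (intro ideal_scale2[OF A] A_br d)
  then show ?thesis
    by (simp add: eb[symmetric] d_def eb_def)
qed

text \<open>Additivity of \<open>Y p (\<alpha> \<odot> w)\<close> in \<open>w\<close> fails by a long root element whose coefficient is a multiple of the second
  coordinate of \<open>\<alpha>\<close>.\<close>

lemma Y_ideal_induct:
  assumes w: "w \<in> Ik (Suc m)" and p: "p \<noteq> 0" and \<alpha>: "\<alpha> \<in> \<Delta>" "snd \<alpha> \<in> LL k" "k \<le> m"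
    and mult: "\<And>y w. y \<in> I \<Longrightarrow> w \<in> Ik m \<Longrightarrow> Y p (\<alpha> \<odot> (y * w)) \<in> H"
  shows "Y p (\<alpha> \<odot> w) \<in> H"
proof -
  obtain x z where xz: "\<alpha> = (x, z)" by (cases \<alpha>)
  have z: "z \<in> LL m"
    using LL_mono[OF \<alpha>(3,2)] by (simp add: xz)
  have "w \<in> Ik (Suc m) \<and> Y p (\<alpha> \<odot> w) \<in> H"
    using w
  proof (induction rule: Ik_induct)
    case (mult a b)
    then show ?case using Ik_Suc_mem assms(6) by simp
  next
    case zero
    show ?case
      by (simp add: xz ci_eq Y_0 H_one ideal_0[OF Ik])
  next
    case (add u v)
    have "br v * z * u \<in> A m"
      using A_base[OF ideal_scale[OF LL_ideal z, of "br v"], of u] add by simp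
    with add show ?case
      using Y_ci_add[OF \<alpha>(1)[unfolded xz] p] ideal_add[OF Ik] by (simp add: xz)
  qed
  then show ?thesis by simp
qed

lemma column_extra_gp:
  fixes p b :: "'n idx"
  assumes "\<sigma> \<in> H" "gp p b" "w \<in> Ik 9"
  shows "Y p (Q (\<sigma> *v axis b 1) \<odot> w) \<in> H"
  by (rule Y_ideal_induct[of w 8 _ _ 8]) (use assms gpD[OF assms(2)] in \<open>auto intro!: col_Delta q_col_LL column_extra_mult\<close>)

text \<open>For \<open>p = b\<close> and \<open>p = - b\<close> the root element is moved from a third index.\<close>

lemma column_extra:
  fixes p b :: "'n idx"
  assumes s: "\<sigma> \<in> H" and "p \<noteq> 0" "b \<noteq> 0" and w: "w \<in> Ik 10"
  shows "Y p (Q (\<sigma> *v axis b 1) \<odot> w) \<in> H"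
proof (rule Y_ideal_induct[of w 9 _ _ 8])
  fix y w assume y: "y \<in> I" and w: "w \<in> Ik 9"
  define \<alpha> where "\<alpha> = Q (\<sigma> *v axis b 1)"
  have \<alpha>: "\<alpha> \<in> \<Delta>" "snd \<alpha> \<in> LL 8"
    unfolding \<alpha>_def using assms by (simp_all add: col_Delta q_col_LL)
  obtain r where r: "gp r p" "gp r b"
    using pick[of p b b] assms by blast
  note ne = gpD[OF r(1)]
  define y' where "y' = br (kap (- r)) * br y"
  have k: "br (kap (- r) * y') = y"
    by (simp add: y'_def)
  have rN: "X (- r) p y' \<in> N"
    unfolding y'_def using ne ideal_scale[OF I I_br[OF y]] by (intro X_norm) auto
  have Yr: "Y r (\<alpha> \<odot> w) \<in> H"
    unfolding \<alpha>_def by (rule column_extra_gp[OF s r(2) w])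
  have w8: "w \<in> Ik 8"
    using w Ik_mono[of 8 9] by auto
  have "X p r (br (snd (\<alpha> \<odot> w)) * br (kap (- r) * y')) \<in> H"
    unfolding k using LL_X[OF LL_br[OF \<alpha>(2)] ideal_scale[OF Ik Ik_br[OF w8], of "w * y"], of p r] r
    by (cases \<alpha>) (simp add: ci_eq gp_sym mult_ac)
  from Y_move[OF r(1) D.ci_mem[OF \<alpha>(1)] G.commutator_H(1)[OF H rN Yr] this]
  show "Y p (Q (\<sigma> *v axis b 1) \<odot> (y * w)) \<in> H"
    unfolding k by (simp add: ci_ci \<alpha>_def mult.commute)
qed (use assms in \<open>auto intro: col_Delta q_col_LL\<close>)

end


section \<open>Middle columns and the lower bound\<close>

context herm
begin

lemma Q_Y:
  assumes "p \<in> range Plus"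
  shows "Q (Y p \<alpha> *v w) = Q w \<boxplus> \<alpha> \<odot> (w $ (- p))"
proof -
  obtain x z where \<alpha>: "\<alpha> = (x, z)" by (cases \<alpha>)
  obtain k where p: "p = Plus k" using assms by blast
  define r where "r = br z * w $ (- p) - lmi * br x * mu R * w $ 0"
  have e: "Y p \<alpha> *v w = (w + axis 0 (x * w $ (- p))) + axis p r"
    using p by (simp add: \<alpha> Y_apply r_def axis_add[symmetric] axis_minus[symmetric] diff_conv_add_uminus del: add_uminus_conv_diff)
  have "q (Y p \<alpha> *v w) = q w + br r * w $ (- p)"
    unfolding e using p by (simp add: h_axis_left h_axis_right axis_nth_if image_iff)
  moreover have "br r = z * br (w $ (- p)) - mu R * x * br (w $ 0)"
    by (simp add: r_def br_mu lm_lmi_far mult_ac)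
  moreover have "(Y p \<alpha> *v w) $ 0 = w $ 0 + x * w $ (- p)"
    unfolding e using p by (simp add: axis_nth_if)
  ultimately show ?thesis
    by (simp add: \<alpha> Q_eq hp_eq ci_eq algebra_simps)
qed

text \<open>For fixed \<open>\<nu>\<close> and \<open>c\<close>, the middle generators of the upper level depend on \<open>\<alpha>\<close> compatibly with the action of the ring.\<close>

lemma mid_ci:
  "((\<nu> \<odot> fst \<alpha> \<boxplus> \<alpha>) \<boxminus> \<alpha> \<odot> c) \<odot> k = (\<nu> \<odot> fst (\<alpha> \<odot> k) \<boxplus> \<alpha> \<odot> k) \<boxminus> (\<alpha> \<odot> k) \<odot> c"
proof -
  have "fst (\<alpha> \<odot> k) = fst \<alpha> * k"
    by (cases \<alpha>) (simp add: ci_eq)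
  then show ?thesis
    unfolding ci_hp ci_inv ci_ci by (simp only: mult.commute[of k c])
qed

lemma mid_eq:
  "((\<nu> \<boxminus> (1, 0)) \<odot> fst \<beta> \<boxplus> \<beta>) \<boxminus> \<beta> \<odot> c = \<nu> \<odot> fst \<beta> \<boxplus> (0, snd \<beta>) \<boxplus> (inv\<^bsub>heis R\<^esub> \<beta>) \<odot> c"
  by (cases \<nu>; cases \<beta>) (simp add: ci_hm ci_inv, simp add: hp_eq hinv_eq ci_eq algebra_simps)

end

context normalized_subgroup
begin

lemma Y_cancel:
  assumes "p \<noteq> 0" "Y p (\<alpha> \<boxplus> \<beta>) \<in> H"
  shows "Y p \<alpha> \<in> H \<Longrightarrow> Y p \<beta> \<in> H" "Y p \<beta> \<in> H \<Longrightarrow> Y p \<alpha> \<in> H"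
  using assms H_cancel_right[of "Y p \<alpha>" "Y p \<beta>"] H_cancel[of "Y p \<beta>" "Y p \<alpha>"] by (simp_all add: Y_hp)

text \<open>Conjugating \<open>\<sigma>\<close> by an extra short root element \<open>g\<close> at an index \<open>-j\<close> produces a matrix in \<open>H\<close> whose column \<open>j\<close>
  is the image under \<open>g\<close> of a combination of the columns \<open>j\<close>, \<open>-j\<close> and \<open>0\<close> of \<open>\<sigma>\<close>. Its value under \<open>Q\<close>
  is the wanted element up to terms that are known from \<open>column_extra_gp\<close>.\<close>

lemma middle_extra_mult:
  fixes p i :: "'n idx"
  assumes s: "\<sigma> \<in> H" and i: "i \<noteq> 0" and p: "p \<noteq> 0" and \<alpha>: "\<alpha> \<in> \<Delta>" and k: "k \<in> I" and w: "w \<in> Ik 9"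
  shows "Y p ((((Q (\<sigma> *v axis 0 1) \<boxminus> (1, 0)) \<odot> fst \<alpha> \<boxplus> \<alpha>) \<boxminus> \<alpha> \<odot> (\<sigma> $ i $ i)) \<odot> (k * w)) \<in> H"
proof -
  note L = LL_ideal[of 8]
  obtain k0 where "gp k0 p"
    using pick[of p p p] p by blast
  \<comment> \<open>for a negative index \<open>j\<close> the conjugation changes \<open>Q\<close> of a vector by exactly one multiple of \<open>\<beta>\<close>
    (\<open>Q_Y\<close>), and \<open>h ej em\<close> only contains off-diagonal entries\<close>
  then obtain j where j: "j \<in> range Minus" "gp p j"
  proof (cases k0)
    case (Plus l)
    with \<open>gp k0 p\<close> have "gp p (Minus l)"
      by (cases p) (auto simp: gp_def)
    then show ?thesis
      using that[of "Minus l"] by simp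
  next
    case (Minus l)
    with \<open>gp k0 p\<close> show ?thesis
      using that[of k0] by (simp add: gp_sym)
  qed (simp add: gp_def)
  note ne = gpD[OF j(2)]
  have kj: "kap (- j) = 1" "- j \<in> range Plus" "j \<notin> range Plus"
    using j(1) by auto
  define \<beta>' \<beta> where "\<beta>' = \<alpha> \<odot> k" and "\<beta> = inv\<^bsub>heis R\<^esub> (\<alpha> \<odot> k)"
  obtain x z where xz: "\<beta>' = (x, z)" by (cases \<beta>')
  have D: "\<beta>' \<in> \<Delta>" "\<beta> \<in> \<Delta>" "\<beta> \<in> Delta_max R"
    unfolding \<beta>'_def \<beta>_def using D.hinv_mem[OF D.ci_mem[OF \<alpha>, of k]] D.ci_mem[OF \<alpha>, of k] Delta_max by auto
  have xJ: "x \<in> Jd"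
    using D(1) xz by (auto intro: Jd_I)
  define g where "g = Y (- j) \<beta>"
  have gN: "g \<in> N"
    unfolding g_def \<beta>_def ci_inv[symmetric] using ne k by (intro Y_norm D.hinv_mem[OF \<alpha>]) auto
  have gi: "inv\<^bsub>G\<^esub> g = Y (- j) \<beta>'"
    unfolding g_def using ne D inv_Y[of "- j" \<beta>] by (simp add: \<beta>_def \<beta>'_def group.inv_inv[OF group_heis])
  define \<sigma>1 where "\<sigma>1 = g ** \<sigma> ** inv\<^bsub>G\<^esub> g"
  have s1: "\<sigma>1 \<in> H"
    using G.normalizer_conj[OF gN s subgroup.subset[OF H]] by (simp add: \<sigma>1_def)
  define c where "c = \<sigma> $ i $ i"
  define e0 ej em where "e0 = \<sigma> *v axis 0 1" and "ej = \<sigma> *v axis j 1" and "em = \<sigma> *v axis (- j) 1"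
  define u1 where "u1 = br z *s em + ej"
  define a1 where "a1 = u1 + x *s e0"
  have "inv\<^bsub>G\<^esub> g *v axis j 1 = axis (- j) (br z) + axis j 1 + axis 0 x"
    unfolding gi xz using ne kj by (simp add: Y_apply axis_nth_if add_ac)
  also have "\<dots> = br z *s axis (- j) 1 + axis j 1 + x *s axis 0 1"
    by (simp add: axis_scale)
  finally have "\<sigma>1 *v axis j 1 = g *v a1"
    by (simp add: \<sigma>1_def a1_def u1_def e0_def ej_def em_def matrix_vector_right_distrib mult_vec_scale
        flip: matrix_vector_mul_assoc)
  then have Q1: "Q (\<sigma>1 *v axis j 1) = Q a1 \<boxplus> \<beta> \<odot> (a1 $ j)"
    using Q_Y[OF kj(2), of \<beta> a1] by (simp add: g_def)
  have B0: "B em ej = 1" "B em e0 = 0" "B ej e0 = 0"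
    unfolding e0_def ej_def em_def G_isom[OF H_G[OF s]] using ne kj by (simp_all add: B_axis_axis)
  define t1 t2 where "t1 = br z * h ej em" and "t2 = br x * h e0 u1"
  have Qu: "Q u1 = Q em \<odot> br z \<boxplus> Q ej \<boxplus> (0, z + zz t1)"
    by (simp add: u1_def Q_add Q_scale B0 t1_def)
  have Qa: "Q a1 = Q u1 \<boxplus> Q e0 \<odot> x \<boxplus> (0, zz t2)"
    unfolding a1_def Q_add Q_scale by (simp add: t2_def) (simp add: u1_def B0)
  have t1: "t1 \<in> LL 8"
    unfolding t1_def ej_def em_def using ne kj by (intro ideal_scale[OF L] h_cols_LL s) auto
  have t2: "t2 \<in> LL 8"
  proof -
    have "t2 = (\<Sum>i\<in>range Plus. br (\<sigma> $ i $ 0 * x) * u1 $ (- i))"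
      unfolding t2_def h_def sum_distrib_left by (rule sum.cong) (simp_all add: e0_def mult_axis_nth mult_ac)
    also have "\<dots> \<in> LL 8"
      using xJ by (intro ideal_sum[OF L] ideal_scale2[OF L] LL_br col0_LL s) auto
    finally show ?thesis .
  qed
  define e where "e = (\<sigma> $ j $ j - c) + \<sigma> $ j $ 0 * x + br z * \<sigma> $ j $ (- j)"
  have e: "e \<in> LL 8"
    unfolding e_def c_def using ne i xJ
    by (intro ideal_add[OF L] ideal_scale[OF L, of "\<sigma> $ j $ (- j)"] diag_LL col0_LL opp_LL s) auto
  have aj: "a1 $ j = c + e"
    by (simp add: a1_def u1_def e_def e0_def ej_def em_def mult_axis_nth mult.commute)
  define t where "t = t1 + t2 + br e * snd \<beta> * c"
  have t: "t \<in> LL 8"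
    unfolding t_def using t1 t2 by (intro ideal_add[OF L] ideal_scale2[OF L] LL_br e)
  define \<mu> where "\<mu> = ((Q e0 \<boxminus> (1, 0)) \<odot> fst \<beta>' \<boxplus> \<beta>') \<boxminus> \<beta>' \<odot> c"
  have \<mu>: "\<mu> = Q e0 \<odot> x \<boxplus> (0, z) \<boxplus> \<beta> \<odot> c"
    unfolding \<mu>_def mid_eq by (simp add: xz \<beta>_def \<beta>'_def[symmetric])
  have be: "\<beta> \<odot> (c + e) = \<beta> \<odot> c \<boxplus> \<beta> \<odot> e \<boxplus> (0, zz (br e * snd \<beta> * c))"
    using ci_add[of "fst \<beta>" "snd \<beta>" c e] D(3) by simp
  have "Q (\<sigma>1 *v axis j 1) = (Q em \<odot> br z \<boxplus> Q ej) \<boxplus> (\<mu> \<boxplus> (\<beta> \<odot> e \<boxplus> (0, zz t)))"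
    unfolding Q1 Qa Qu aj be \<mu> t_def
    by (cases "Q em \<odot> br z \<boxplus> Q ej"; cases "Q e0"; cases "\<beta> \<odot> c"; cases "\<beta> \<odot> e") (simp add: hp_eq ci_eq zz_simps algebra_simps)
  then have "Q (\<sigma>1 *v axis j 1) \<odot> w = (Q em \<odot> (br z * w) \<boxplus> Q ej \<odot> w) \<boxplus> (\<mu> \<odot> w \<boxplus> (\<beta> \<odot> (e * w) \<boxplus> (0, zz (br w * t * w))))"
    by (simp add: ci_hp ci_ci) (simp add: ci_eq zz_simps)
  moreover have "Y p (Q (\<sigma>1 *v axis j 1) \<odot> w) \<in> H"
    by (rule column_extra_gp[OF s1 j(2) w])
  moreover have 1: "Y p (Q em \<odot> (br z * w) \<boxplus> Q ej \<odot> w) \<in> H"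
    unfolding em_def ej_def using j(2) by (intro Y_hp_H column_extra_gp s w ideal_scale[OF Ik w] p) auto
  ultimately have 2: "Y p (\<mu> \<odot> w \<boxplus> (\<beta> \<odot> (e * w) \<boxplus> (0, zz (br w * t * w)))) \<in> H"
    using Y_cancel(1)[OF p] by simp
  have w9: "w \<in> Ik (Suc 8)" using w by simp
  have tw: "br w * t * w \<in> A 8"
    using A_base[OF ideal_scale[OF L t, of "br w"] w9] .
  have "Y p (\<beta> \<odot> (e * w) \<boxplus> (0, zz (br w * t * w))) \<in> H"
    by (intro Y_hp_H p A_Y[OF A_base[OF e w9]] D A_long[OF tw])
  from Y_cancel(2)[OF p 2 this] have "Y p (\<mu> \<odot> w) \<in> H" .
  moreover have "\<mu> = (((Q e0 \<boxminus> (1, 0)) \<odot> fst \<alpha> \<boxplus> \<alpha>) \<boxminus> \<alpha> \<odot> c) \<odot> k"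
    unfolding \<mu>_def \<beta>'_def by (rule mid_ci[symmetric])
  ultimately show ?thesis
    by (simp only: ci_ci e0_def c_def)
qed

lemma middle_snd_LL:
  fixes i :: "'n idx"
  assumes s: "\<sigma> \<in> H" and i: "i \<noteq> 0" and yz: "(y, z) \<in> \<Delta>"
  shows "snd (((Q (\<sigma> *v axis 0 1) \<boxminus> (1, 0)) \<odot> y \<boxplus> (y, z)) \<boxminus> (y, z) \<odot> (\<sigma> $ i $ i)) \<in> LL 9"
proof -
  note L = LL_ideal[of 9]
  have yJ: "y \<in> Jd" using yz by (rule Jd_I)
  define c d e0 where "c = \<sigma> $ i $ i" and "d = \<sigma> $ 0 $ 0 - c" and "e0 = \<sigma> *v axis 0 1"
  have d: "\<sigma> $ 0 $ 0 = c + d" by (simp add: d_def)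
  have "Q e0 = (c + d, q e0)"
    by (simp add: Q_eq e0_def mult_axis_nth d)
  then have "snd (((Q e0 \<boxminus> (1, 0)) \<odot> y \<boxplus> (y, z)) \<boxminus> (y, z) \<odot> c)
      = br y * q e0 * y - z * (br c * c - 1) + lm * c * br (br y * mu R * d * y)"
    by (simp add: hm_eq hp_eq ci_eq br_mu lm_lmi_far algebra_simps)
  moreover have "br y * q e0 * y \<in> LL 9"
  proof -
    have "br y * q e0 * y = (\<Sum>i\<in>range Plus. br (\<sigma> $ i $ 0 * y) * (\<sigma> $ (- i) $ 0 * y))"
      unfolding h_def sum_distrib_left sum_distrib_right by (rule sum.cong) (simp_all add: e0_def mult_axis_nth mult_ac)
    also have "\<dots> \<in> LL 9"
      using yJ by (intro ideal_sum[OF L] ideal_scale[OF L] LL_8_9 col0_LL s) auto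
    finally show ?thesis .
  qed
  moreover have "br c * c - 1 \<in> LL 9"
    unfolding c_def by (intro LL_8_9 unit_LL s i)
  moreover have "br y * mu R * d * y \<in> LL 9"
    unfolding d_def c_def by (intro mid_LL s i yJ)
  ultimately show ?thesis
    by (simp only: e0_def c_def ideal_add[OF L] ideal_diff[OF L] ideal_scale[OF L] LL_br)
qed

lemma upper_Z_extra:
  assumes "\<zeta> \<in> upper_Z R \<Delta> H" "p \<noteq> 0" "w \<in> Ik 10"
  shows "Y p (\<zeta> \<odot> w) \<in> H"
  using assms(1)
proof (cases rule: upper_Z_cases)
  case (col \<sigma> j)
  then show ?thesis
    using column_extra assms by simp
next
  case (mid \<sigma> i y z)
  show ?thesis
  proof (rule Y_ideal_induct[of w 9 _ _ 9])
    show "snd \<zeta> \<in> LL 9"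
      unfolding mid by (rule middle_snd_LL[OF mid(1-3)])
    show "Y p (\<zeta> \<odot> (k * w)) \<in> H" if "k \<in> I" "w \<in> Ik 9" for k w
      using middle_extra_mult[OF mid(1,2) assms(2) mid(3) that] by (simp add: mid)
  qed (use assms upper_Z_Delta in auto)
qed

text \<open>Closing under multiples makes this a submodule, so that the inclusion of an odd form parameter can be tested on its
  generators.\<close>

definition T :: "('a \<times> 'a) set" where
  "T = {\<alpha> \<in> \<Delta>. \<forall>a p. p \<noteq> 0 \<longrightarrow> Y p (\<alpha> \<odot> a) \<in> H}"

lemma T_bullet: "bullet_submodule R T"
  unfolding bullet_submodule_def
proof (intro conjI ballI allI subgroup_heisI)
  show "(0, 0) \<in> T"
    by (simp add: T_def D.zero_mem ci_eq Y_0 H_one)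
  show "\<alpha> \<boxplus> \<beta> \<in> T" if "\<alpha> \<in> T" "\<beta> \<in> T" for \<alpha> \<beta>
    using that by (simp add: T_def D.hp_mem ci_hp Y_hp_H)
  show "inv\<^bsub>heis R\<^esub> \<alpha> \<in> T" if "\<alpha> \<in> T" for \<alpha>
  proof -
    have "Y p ((inv\<^bsub>heis R\<^esub> \<alpha>) \<odot> a) \<in> H" if p: "p \<noteq> 0" for p :: "'n idx" and a
      unfolding ci_inv using H_inv[of "Y p (\<alpha> \<odot> a)"] inv_Y[OF p D.ci_mem, of \<alpha> a] \<open>\<alpha> \<in> T\<close> p by (simp add: T_def)
    then show ?thesis
      using that by (simp add: T_def D.hinv_mem)
  qed
  show "\<alpha> \<odot> a \<in> T" if "\<alpha> \<in> T" for \<alpha> a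
    using that by (simp add: T_def D.ci_mem ci_ci)
qed

lemma T_A:
  assumes t: "t \<in> A m"
  shows "(0, zz t) \<in> T" "\<alpha> \<in> \<Delta> \<Longrightarrow> \<alpha> \<odot> t \<in> T"
proof -
  have "(0, zz t) \<odot> a = (0, zz (br a * t * a))" for a
    by (simp add: ci_eq zz_simps)
  then show "(0, zz t) \<in> T"
    using A_long[OF ideal_scale2[OF A_ideal ideal_scale[OF A_ideal t]]] by (simp add: T_def zz_Delta)
  show "\<alpha> \<odot> t \<in> T" if "\<alpha> \<in> \<Delta>"
    using A_Y[OF ideal_scale2[OF A_ideal t] _ that] that by (simp add: T_def D.ci_mem ci_ci)
qed

lemma T_SH: "set_circ R SH (Ik 10) \<subseteq> T"
proof -
  interpret T: bullet R T by unfold_locales (rule T_bullet)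
  define S where "S = {\<alpha> \<in> \<Delta>. \<forall>w\<in>Ik 10. \<alpha> \<odot> w \<in> T}"
  have JA: "x * w \<in> A 9" if "x \<in> JH" "w \<in> Ik 10" for x w
    using A_base[of x 9 w] JH_LL that by auto
  have "SH \<subseteq> S"
  proof (rule SH_subset)
    show "bullet_submodule R S"
      unfolding bullet_submodule_def
      by (intro conjI ballI allI subgroup_heisI)
        (auto simp: S_def D.zero_mem T.zero_mem D.hp_mem ci_hp T.hp_mem D.hinv_mem ci_inv T.hinv_mem D.ci_mem ci_ci
          ideal_scale[OF Ik], auto simp: ci_eq T.zero_mem)
    show "(0, zz x) \<in> S" if "x \<in> JH" for x
    proof -
      have "(0, zz x) \<odot> w \<in> T" if "w \<in> Ik 10" for w
      proof -
        have "(0, zz x) \<odot> w = (0, zz (br w * (x * w)))"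
          by (simp only: mult.assoc[symmetric]) (simp add: ci_eq zz_simps)
        then show ?thesis
          using T_A(1)[OF ideal_scale[OF A_ideal JA[OF \<open>x \<in> JH\<close> that], of "br w"]] by simp
      qed
      then show ?thesis by (simp add: S_def zz_Delta)
    qed
    show "\<alpha> \<odot> a \<in> S" if "\<alpha> \<in> \<Delta>" "a \<in> JH" for \<alpha> a
      unfolding S_def using that T_A(2)[OF JA] by (simp add: D.ci_mem ci_ci)
    show "\<zeta> \<in> S" if "\<zeta> \<in> upper_Z R \<Delta> H" for \<zeta>
      using that upper_Z_extra[OF that] ideal_scale2[OF Ik] upper_Z_Delta
      by (auto simp: S_def T_def D.ci_mem ci_ci)
  qed
  then show ?thesis
    using T_bullet by (intro set_circ_subset) (auto simp: S_def bullet_submodule_def)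
qed

theorem EU_level_subset: "EU_ideal R \<Delta> (form_ideal_mult R \<Delta> (upper_level R \<Delta> H) (ideal_power I 10)) \<subseteq> H"
proof -
  interpret T: bullet R T by unfold_locales (rule T_bullet)
  define K where "K = ideal_mult JH (Ik 10)"
  define S where "S = Omega_min R \<Delta> K <#>\<^bsub>heis R\<^esub> set_circ R SH (Ik 10)"
  have KA: "K \<subseteq> A 9"
  proof
    fix t assume "t \<in> K"
    then show "t \<in> A 9"
      unfolding K_def
      by (rule ideal_gen_additive_induct[OF _ ring_ideal_JH])
        (use JH_LL A_base[of _ 9] in \<open>auto simp: ideal_0[OF A_ideal] ideal_add[OF A_ideal]\<close>)
  qed
  have "set_circ R \<Delta> K \<subseteq> T"
    using T_bullet KA T_A(2) by (intro set_circ_subset) (auto simp: bullet_submodule_def)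
  then have Omega_T: "\<alpha> \<boxplus> \<beta> \<in> T" if "\<alpha> \<in> {(0, zz x) | x. x \<in> K}" "\<beta> \<in> set_circ R \<Delta> K" for \<alpha> \<beta>
    using that T_A(1) KA by (intro T.hp_mem) auto
  have ST: "S \<subseteq> T"
  proof
    fix \<gamma> assume "\<gamma> \<in> S"
    then obtain \<alpha> \<beta> \<delta> where "\<gamma> = \<alpha> \<boxplus> \<beta> \<boxplus> \<delta>" "\<alpha> \<in> {(0, zz x) | x. x \<in> K}" "\<beta> \<in> set_circ R \<Delta> K"
      "\<delta> \<in> set_circ R SH (Ik 10)"
      unfolding S_def Omega_min_def set_mult_def zz_def by (elim UN_E) simp
    with Omega_T T_SH show "\<gamma> \<in> T"
      by (simp only: T.hp_mem subsetD)
  qed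
  have TD: "T \<subseteq> Delta_max R"
    using Delta_max by (auto simp: T_def)
  have "EU_ideal R \<Delta> (K, S) \<subseteq> H"
    unfolding EU_ideal_def prod.case
  proof (rule G.generate_subgroup_incl[OF _ H], intro Un_least subsetI)
    fix \<tau> :: "('a, 'n) matrix"
    assume "\<tau> \<in> {T_short R i j x | i j x. i \<noteq> 0 \<and> j \<noteq> 0 \<and> i \<noteq> j \<and> i \<noteq> - j \<and> x \<in> K}"
    then obtain i j x where *: "\<tau> = T_short R i j x" "i \<noteq> 0" "j \<noteq> 0" "i \<noteq> j" "i \<noteq> - j" "x \<in> K"
      by blast
    have "X (- j) i (x * br (kap (- j))) \<in> H"
      using * KA by (intro A_X[of _ 9] ideal_scale2[OF A_ideal]) (auto simp: gp_def)
    then show "\<tau> \<in> H"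
      using * by (simp add: T_short_eq)
  next
    fix \<tau> :: "('a, 'n) matrix"
    assume "\<tau> \<in> {T_extra R i \<alpha> |i \<alpha>. i \<noteq> 0 \<and> \<alpha> \<in> sgn_param R (- eps i) S}"
    then obtain i x y where *: "\<tau> = T_extra R i (x, y)" "i \<noteq> 0" "(x, y) \<in> sgn_param R (- eps i) S"
      by auto
    then have "(x, y) \<in> sgn_param R (- eps i) T"
      using ST by (auto simp: sgn_param_def split: if_splits)
    from sgn_param_mem[OF T_bullet TD *(2) this] have "Y i ((br (kap i) * x, kap i * br y) \<odot> 1) \<in> H"
      using *(2) by (auto simp: T_def)
    then show "\<tau> \<in> H"
      using * by (simp add: T_extra_eq ci_eq)
  qed
  then show ?thesis
    by (simp add: upper_level_eq form_ideal_mult_def K_def S_def)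
qed

end

theorem theorem47:
  fixes R :: "'a::comm_ring_1 hermitian"
    and \<Delta> \<Omega> :: "('a \<times> 'a) set"
    and I :: "'a set"
    and H :: "(('a, 'n::finite) matrix) set"
  assumes "CARD('n) \<ge> 4"
    and "hermitian_form_ring R \<Delta>"
    and "odd_form_ideal R \<Delta> (I, \<Omega>)"
    and "subgroup H (U_group R \<Delta>)"
    and "EU_ideal R \<Delta> (I, \<Omega>) \<subseteq> normalizer (U_group R \<Delta>) H"
  shows "EU_ideal R \<Delta> (form_ideal_mult R \<Delta> (upper_level R \<Delta> H) (ideal_power I 10)) \<subseteq> H
    \<and> H \<subseteq> CU_ideal R \<Delta> (upper_level R \<Delta> H)"
proof -
  interpret unitary_subgroup R \<Delta> H
    using assms by (intro unitary_subgroup.intro form_ring.intro form_ring_axioms.intro herm.intro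
        unitary_subgroup_axioms.intro) (simp_all add: hermitian_form_ring_def)
  have I: "ring_ideal I" "\<And>x. x \<in> I \<Longrightarrow> br x \<in> I" and \<Omega>: "bullet_submodule R \<Omega>" "Omega_min R \<Delta> I \<subseteq> \<Omega>" "\<Omega> \<subseteq> \<Delta>"
    using assms(3) by (auto simp: odd_form_ideal_def invol_invariant_def Omega_max_def)
  have \<Omega>D: "\<Omega> \<subseteq> Delta_max R"
    using \<Omega>(3) Delta_max by blast
  interpret C: bullet R "set_circ R \<Delta> I"
    by unfold_locales (intro set_circ_bullet ideal_scale2[OF I(1)])
  have \<Omega>_zz: "(0, zz x) \<in> \<Omega>" if "x \<in> I" for x
  proof -
    have "(0, zz x) = (0, zz x) \<boxplus> (0, 0)"
      by (simp add: hp_eq)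
    then show ?thesis
      using \<Omega>(2) that C.zero_mem unfolding Omega_min_def set_mult_def zz_def by blast
  qed
  have \<Omega>_ci: "\<alpha> \<odot> x \<in> \<Omega>" if "\<alpha> \<in> \<Delta>" "x \<in> I" for \<alpha> x
  proof -
    have "\<alpha> \<odot> x = (0, 0 - br 0 * lm) \<boxplus> \<alpha> \<odot> x"
      by (cases \<alpha>) (simp add: hp_eq ci_eq)
    then show ?thesis
      using \<Omega>(2) set_circ_base[OF that] ideal_0[OF I(1)] unfolding Omega_min_def set_mult_def by blast
  qed
  have EX: "T_short R i j x \<in> normalizer G H" if "i \<noteq> 0" "j \<noteq> 0" "i \<noteq> j" "i \<noteq> - j" "x \<in> I" for i j x
    using that by (intro subsetD[OF assms(5)], unfold EU_ideal_def prod.case) (rule generate.incl, blast)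
  have EY: "Y p \<alpha> \<in> normalizer G H" if p: "p \<noteq> 0" and \<alpha>: "\<alpha> \<in> \<Omega>" for p \<alpha>
  proof -
    obtain \<beta> where "\<beta> \<in> sgn_param R (- eps p) \<Omega>" "(Y p \<alpha> :: ('a, 'n) matrix) = T_extra R p \<beta>"
      using Y_eq_T_extra[OF \<Omega>(1) \<Omega>D p \<alpha>] by blast
    then show ?thesis
      using p by (intro subsetD[OF assms(5)], unfold EU_ideal_def prod.case) (rule generate.incl, blast)
  qed
  interpret normalized_subgroup R \<Delta> H I
  proof unfold_locales
    fix p r :: "'n idx" and x
    assume *: "p \<noteq> 0" "r \<noteq> 0" "r \<noteq> - p" "x \<in> I"
    show "X p r x \<in> normalizer G H"
    proof (cases "r = p")
      case True
      then show ?thesis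
        using EY[OF *(1) \<Omega>_zz[OF I(2)[OF *(4)]]] * by (simp add: X_long)
    next
      case False
      have "T_short R r (- p) (x * kap p) = X p r x"
        using * by (simp add: T_short_eq mult.assoc)
      then show ?thesis
        using EX[of r "- p" "x * kap p"] * False ideal_scale2[OF I(1)] by simp
    qed
  next
    show "Y p (\<alpha> \<odot> x) \<in> normalizer G H" if "p \<noteq> 0" "\<alpha> \<in> \<Delta>" "x \<in> I" for p :: "'n idx" and \<alpha> x
      by (rule EY[OF that(1) \<Omega>_ci[OF that(2,3)]])
  qed (use assms I in auto)
  show ?thesis
    using EU_level_subset H_subset_CU by blast
qed

end
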